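(* Let $\Sigma$ be a finite linearly ordered alphabet with $k=|\Sigma|$. Given a word $v\in\Sigma^n$, the rank of $v$ with respect to the set of bracelets of length $n$ over the alphabet $\Sigma$, $RB(v)$, can be computed in $O(k\cdot n^4)$ time.
   Context: $\Sigma$ is a finite linearly ordered alphabet, $k=|\Sigma|$, and words of length $n$ are compared lexicographically. The rotation of $w=w_1\cdots w_n$ by $r$ is $w_{r+1}\cdots w_n w_1\cdots w_r$; the reversal is $w^R=w_n\cdots w_1$. A bracelet of length $n$ is an equivalence class of words in $\Sigma^n$ under the combination of rotations and reversal; its representative is the lexicographically smallest word in the class. The rank $RB(v)$ of $v\in\Sigma^n$ with respect to the set of bracelets is the number of bracelets of length $n$ over $\Sigma$ whose representative is smaller than $v$. *)

theory Defs
  imports Main "HOL-Library.List_Lexorder"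
begin

section \<open>Bracelets and their ranking\<close>

text \<open>Words are lists. The theory \<open>List_Lexorder\<close> makes \<open><\<close> and \<open>\<le>\<close> on lists the lexicographic
  order. The library function \<open>rotate r\<close> sends \<open>w\<^sub>1\<dots>w\<^sub>n\<close> to \<open>w\<^sub>r\<^sub>+\<^sub>1\<dots>w\<^sub>n w\<^sub>1\<dots>w\<^sub>r\<close>, with \<open>r\<close> read
  modulo \<open>n\<close>.\<close>

definition words :: "'a set \<Rightarrow> nat \<Rightarrow> 'a list set" where
  "words \<Sigma> n = {w. set w \<subseteq> \<Sigma> \<and> length w = n}"

definition bracelet_rel :: "'a set \<Rightarrow> nat \<Rightarrow> ('a list \<times> 'a list) set" where
  "bracelet_rel \<Sigma> n =
     {(u, w) \<in> words \<Sigma> n \<times> words \<Sigma> n. \<exists>r. w = rotate r u \<or> w = rotate r (rev u)}"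

lemma equiv_bracelet_rel: "equiv (words \<Sigma> n) (bracelet_rel \<Sigma> n)"
proof (rule equivI)
  show "bracelet_rel \<Sigma> n \<subseteq> words \<Sigma> n \<times> words \<Sigma> n"
    by (auto simp: bracelet_rel_def)
  show "refl_on (words \<Sigma> n) (bracelet_rel \<Sigma> n)"
    by (auto simp: refl_on_def bracelet_rel_def intro: exI[of _ 0])
  have rev_rot: "\<exists>q. rev (rotate r u) = rotate q (rev u)" for r and u :: "'a list"
  proof -
    have "rotate (length u - r mod length u) (rev u)
        = rev (rotate (length u - (length u - r mod length u) mod length u) u)"
      by (rule rotate_rev)
    also have "rotate (length u - (length u - r mod length u) mod length u) u = rotate r u"
    proof (cases "r mod length u = 0 \<or> u = []")
      case True
      then show ?thesis by (auto simp: rotate_id)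
    next
      case False
      then have "r mod length u < length u" by simp
      with False have "(length u - (length u - r mod length u) mod length u) = r mod length u"
        by simp
      then show ?thesis by (metis rotate_conv_mod)
    qed
    finally show ?thesis by metis
  qed
  have inv: "\<exists>q. rotate q (rotate r u) = u" for r and u :: "'a list"
  proof (cases "u = []")
    case False
    then have "rotate ((length u - 1) * r) (rotate r u) = rotate (length u * r) u"
      by (cases u) (auto simp: rotate_rotate add.commute)
    also have "\<dots> = u" by (metis mod_mult_self1_is_0 rotate_id)
    finally show ?thesis by blast
  qed simp
  show "sym (bracelet_rel \<Sigma> n)"
    by (rule symI) (auto simp: bracelet_rel_def, (metis inv rev_rot rev_rev_ident)+)
  show "trans (bracelet_rel \<Sigma> n)"
    by (rule transI)
      (auto simp: bracelet_rel_def, (metis rotate_rotate rev_rot rev_rev_ident)+)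
qed

definition bracelets :: "'a set \<Rightarrow> nat \<Rightarrow> 'a list set set" where
  "bracelets \<Sigma> n = words \<Sigma> n // bracelet_rel \<Sigma> n"

definition representative :: "'a::linorder list set \<Rightarrow> 'a list" where
  "representative B = Min B"

definition RB :: "'a::linorder set \<Rightarrow> 'a list \<Rightarrow> nat" where
  "RB \<Sigma> v = card {B \<in> bracelets \<Sigma> (length v). representative B < v}"


section \<open>Machine model\<close>

text \<open>Structured programs for a unit-cost random access machine. The memory consists of named
  arrays of natural numbers; a program mentions only finitely many names, so interleaving its arrays
  into a single memory changes running times by a constant factor only. A scalar variable is cell
  \<open>0\<close> of an array. As in the random access machine of Cook and Reckhow, the only arithmetic
  operations are addition and subtraction (truncated at \<open>0\<close>), each charged one unit. There is no
  unit-cost multiplication or division, since with those a unit-cost machine over unbounded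
  numbers would not be a realistic model.\<close>

type_synonym state = "string \<Rightarrow> nat \<Rightarrow> nat"

datatype exp =
    Const nat
  | Read string exp
  | Plus exp exp
  | Minus exp exp

datatype com =
    Skip
  | Assign string exp exp  \<comment> \<open>\<open>Assign a i e\<close> stores the value of \<open>e\<close> in cell \<open>i\<close> of array \<open>a\<close>\<close>
  | Seq com com
  | Cond exp com com       \<comment> \<open>a test succeeds if the value of the expression is nonzero\<close>
  | While exp com

fun val :: "exp \<Rightarrow> state \<Rightarrow> nat" where
  "val (Const c) s = c"
| "val (Read a i) s = s a (val i s)"
| "val (Plus e f) s = val e s + val f s"
| "val (Minus e f) s = val e s - val f s"

text \<open>One unit for every constant, memory access and arithmetic operation in an expression.\<close>

fun cost :: "exp \<Rightarrow> nat" where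
  "cost (Const c) = 1"
| "cost (Read a i) = cost i + 1"
| "cost (Plus e f) = cost e + cost f + 1"
| "cost (Minus e f) = cost e + cost f + 1"

text \<open>\<open>exec c s t s'\<close>: started in state \<open>s\<close>, program \<open>c\<close> halts after time \<open>t\<close> in state \<open>s'\<close>.\<close>

inductive exec :: "com \<Rightarrow> state \<Rightarrow> nat \<Rightarrow> state \<Rightarrow> bool" where
  Skip: "exec Skip s 1 s"
| Assign: "exec (Assign a i e) s (cost i + cost e + 1) (s(a := (s a)(val i s := val e s)))"
| Seq: "exec c s t s' \<Longrightarrow> exec d s' t' s'' \<Longrightarrow> exec (Seq c d) s (t + t') s''"
| CondTrue: "val b s \<noteq> 0 \<Longrightarrow> exec c s t s' \<Longrightarrow> exec (Cond b c d) s (cost b + 1 + t) s'"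
| CondFalse: "val b s = 0 \<Longrightarrow> exec d s t s' \<Longrightarrow> exec (Cond b c d) s (cost b + 1 + t) s'"
| WhileFalse: "val b s = 0 \<Longrightarrow> exec (While b c) s (cost b + 1) s"
| WhileTrue: "val b s \<noteq> 0 \<Longrightarrow> exec c s t s' \<Longrightarrow> exec (While b c) s' t' s'' \<Longrightarrow>
    exec (While b c) s (cost b + 1 + t + t') s''"

inductive_cases exec_elims:
  "exec Skip s t s'"
  "exec (Assign a i e) s t s'"
  "exec (Seq c d) s t s'"
  "exec (Cond b c d) s t s'"
  "exec (While b c) s t s'"

lemma exec_deterministic:
  "exec c s t s' \<Longrightarrow> exec c s u s'' \<Longrightarrow> u = t \<and> s'' = s'"
proof (induction arbitrary: u s'' rule: exec.induct)
  case (Skip s)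
  then show ?case by (auto elim: exec_elims)
next
  case (Assign a i e s)
  then show ?case by (auto elim: exec_elims)
next
  case (Seq c s t s' d t' s3)
  from Seq.prems obtain t1 s1 t2 where "exec c s t1 s1" "exec d s1 t2 s''" "u = t1 + t2"
    by (auto elim: exec_elims)
  with Seq.IH show ?case by blast
next
  case (CondTrue b s c t s' d)
  from CondTrue.prems CondTrue.hyps(1) obtain t1 where "exec c s t1 s''" "u = cost b + 1 + t1"
    by (auto elim: exec_elims)
  with CondTrue.IH show ?case by blast
next
  case (CondFalse b s d t s' c)
  from CondFalse.prems CondFalse.hyps(1) obtain t1 where "exec d s t1 s''" "u = cost b + 1 + t1"
    by (auto elim: exec_elims)
  with CondFalse.IH show ?case by blast
next
  case (WhileFalse b s c)
  then show ?case by (auto elim: exec_elims(5))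
next
  case (WhileTrue b s c t s' t' s3)
  from WhileTrue.prems WhileTrue.hyps(1) obtain t1 s1 t2
    where "exec c s t1 s1" "exec (While b c) s1 t2 s''" "u = cost b + 1 + t1 + t2"
    by (auto elim: exec_elims(5))
  with WhileTrue.IH show ?case by blast
qed

text \<open>The letters of \<open>\<Sigma>\<close> are presented to the machine by their position \<open>0, \<dots>, k - 1\<close> in the order
  of \<open>\<Sigma>\<close>. All memory cells not holding the input are initially \<open>0\<close>.\<close>

definition letter_index :: "'a::linorder set \<Rightarrow> 'a \<Rightarrow> nat" where
  "letter_index \<Sigma> x = card {y \<in> \<Sigma>. y < x}"

definition input_state :: "'a::linorder set \<Rightarrow> 'a list \<Rightarrow> state" where
  "input_state \<Sigma> v = (\<lambda>_ _. 0)
     (''k'' := (\<lambda>_. 0)(0 := card \<Sigma>),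
      ''n'' := (\<lambda>_. 0)(0 := length v),
      ''v'' := (\<lambda>i. if i < length v then letter_index \<Sigma> (v ! i) else 0))"

definition result :: "state \<Rightarrow> nat" where
  "result s = s ''result'' 0"

end

theory Submission
  imports Defs "HOL-Library.FuncSet"
begin

text \<open>Let \<open>x\<close>, of length \<open>p\<close>, be the prefix of \<open>v\<close> that Duval's algorithm ends with. An infinite periodic
  word has all its windows of length \<open>n\<close> weakly above \<open>v\<close> iff all its suffixes are weakly above
  \<open>x x x \<dots>\<close>, and this is checked by an automaton with states \<open>0, \<dots>, p - 1\<close>: in state \<open>i\<close> a letter
  below \<open>x\<^sub>i\<close> is forbidden, the letter \<open>x\<^sub>i\<close> leads to \<open>i + 1\<close> (modulo \<open>p\<close>), a larger letter to \<open>0\<close>. As \<open>x\<close> is a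
  Lyndon word, runs from different states synchronise, so a cyclic word is good iff it labels a
  closed walk, which is then unique.

  By Burnside's lemma for the dihedral group, \<open>2 n\<close> times the number of bracelets whose
  representative is at least \<open>v\<close> is the sum over all rotations and reflections of the number of
  fixed words that are good in both reading directions. For the rotation by \<open>r\<close> these are the closed
  walks of length \<open>gcd r n\<close> in the product of the automaton with its reversal. This product has
  \<open>p\<^sup>2\<close> states and at most \<open>k p\<^sup>2\<close> edges, and as every closed walk passes through state \<open>0\<close> of the
  first component, only \<open>p\<close> of the states have to be tried as starting points; each costs \<open>n\<close> steps
  of the dynamic programme, which gives \<open>O(k n\<^sup>4)\<close>. For a reflection the second half of the word
  mirrors the first one, and a single run from the diagonal of the product suffices.

  Taking the word of \<open>n\<close> minimal letters for \<open>v\<close> yields the number of all bracelets, and the difference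
  of the two counts is the rank. The division by \<open>2 n\<close> is done by doubling.\<close>

section \<open>The automaton of a Lyndon prefix\<close>

text \<open>Counting closed walks in the product directly would need \<open>p * p\<close> starting
  pairs and time of order \<open>k n^5\<close>. Anchoring the forward component at state
  \<open>0\<close> saves a factor \<open>n\<close>, but closed walks that start in other states must
  still be counted. The weight \<open>overlaps\<close> does this, and maintaining it only means
  incrementing one row of the table at each of the first \<open>p - 1\<close> time steps. The second
  component follows the reversed word, which grows at its front while the word grows at its end. It
  is therefore run against time: a column index is the state in which the reversed word is started,
  and \<open>q\<close> is the state in which it ends. Reading off column \<open>q\<close> at the end
  closes the backward walk. One table per \<open>q\<close> serves all rotations at once: its entry
  at time \<open>d\<close> is the contribution of \<open>q\<close> to the words of length
  \<open>d\<close>, and afterwards only the lengths \<open>gcd r n\<close> are looked up. So there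
  are \<open>p\<close> tables, \<open>n\<close> steps for each, and at most \<open>k p^2\<close>
  edges for each step.\<close>

context
  fixes v :: "nat \<Rightarrow> nat" and p :: nat
begin

text \<open>String matching would continue in a border after a mismatch. Here a larger letter leads
  straight to \<open>0\<close>: if the matched part is a prefix of a Lyndon word and is followed by
  a letter larger than expected, every window starting inside it is already strictly above
  \<open>v\<close>.\<close>

definition nxt :: "nat \<Rightarrow> nat \<Rightarrow> nat" where
  "nxt i c = (if v i < c \<or> Suc i = p then 0 else Suc i)"

primrec run :: "nat list \<Rightarrow> nat \<Rightarrow> nat option" where
  "run [] i = Some i"
| "run (c # w) i = (if v i \<le> c then run w (nxt i c) else None)"

definition closed :: "nat list \<Rightarrow> bool" where
  "closed w \<longleftrightarrow> (\<exists>i<p. run w i = Some i)"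

text \<open>Each proper suffix of the word exceeds the prefix of the same length. The condition
  \<open>d + e < p\<close> puts the first difference inside the suffix, so the word has no proper
  border.\<close>

definition lyndon :: bool where
  "lyndon \<longleftrightarrow> 0 < p \<and> (\<forall>d. 0 < d \<longrightarrow> d < p \<longrightarrow>
     (\<exists>e. d + e < p \<and> v e < v (d + e) \<and> (\<forall>e'<e. v (d + e') = v e')))"

lemma run_append: "run (a @ b) i = (case run a i of None \<Rightarrow> None | Some j \<Rightarrow> run b j)"
  by (induction a arbitrary: i) auto

lemma nxt_less: "i < p \<Longrightarrow> nxt i c < p"
  by (auto simp: nxt_def)

lemma run_less: "run w i = Some j \<Longrightarrow> i < p \<Longrightarrow> j < p"
  by (induction w arbitrary: i) (auto split: if_splits dest: nxt_less)

lemma run_snoc: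
  "run (w @ [c]) i = (case run w i of None \<Rightarrow> None
     | Some j \<Rightarrow> if v j \<le> c then Some (nxt j c) else None)"
  by (auto simp: run_append split: option.splits)

text \<open>The smaller state \<open>a\<close> is a border of the prefix of length \<open>b\<close>.
  While the runs differ, \<open>b\<close> grows with every letter and \<open>a\<close> grows with it
  or falls to \<open>0\<close>, the empty border; so the runs must meet before \<open>b\<close>
  would pass \<open>p\<close>. At \<open>b + 1 = p\<close> equality of \<open>v a\<close> and
  \<open>v b\<close> would give a border of the whole Lyndon word; hence \<open>v a < v b\<close>
  and both runs go to \<open>0\<close>.\<close>

lemma run_sync_border:
  assumes L: lyndon
  shows "a < b \<Longrightarrow> b < p \<Longrightarrow> \<forall>e<a. v (b - a + e) = v e \<Longrightarrow> run w a = Some a' \<Longrightarrow>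
    run w b = Some b' \<Longrightarrow> p \<le> b + length w \<Longrightarrow> a' = b'"
proof (induction w arbitrary: a b)
  case Nil
  then show ?case by simp
next
  case (Cons c w)
  from Cons.prems have c: "v a \<le> c" "v b \<le> c" and
    r: "run w (nxt a c) = Some a'" "run w (nxt b c) = Some b'"
    by (auto split: if_splits)
  from L Cons.prems(1,2) obtain e where e: "b - a + e < p" "v e < v (b - a + e)"
    "\<forall>e'<e. v (b - a + e') = v e'"
    unfolding lyndon_def by (metis diff_less_mono2 less_imp_diff_less zero_less_diff)
  have ea: "a \<le> e"
    using e(2) Cons.prems(3) by (metis leI less_irrefl)
  have ab: "v a \<le> v b"
    using ea e Cons.prems(1) by (metis le_add_diff_inverse2 le_neq_implies_less less_imp_le order_refl)
  consider "v b < c" | "v b = c" "Suc b = p" | "v b = c" "Suc b < p" using c Cons.prems by linarith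
  then show ?case
  proof cases
    case 1
    with ab have "nxt a c = nxt b c" by (simp add: nxt_def)
    with r show ?thesis by simp
  next
    case 2
    with e(1) ea Cons.prems(1) have "e = a" by linarith
    with e(2) Cons.prems(1) have "v a < v b" by simp
    with 2 have "nxt a c = nxt b c" by (simp add: nxt_def)
    with r show ?thesis by simp
  next
    case 3
    then have nb: "nxt b c = Suc b" by (simp add: nxt_def)
    show ?thesis
    proof (cases "v a = v b")
      case True
      then have na: "nxt a c = Suc a" using 3 Cons.prems by (simp add: nxt_def)
      show ?thesis
      proof (rule Cons.IH)
        show "Suc a < Suc b" "Suc b < p" using Cons.prems 3 by auto
        show "\<forall>e<Suc a. v (Suc b - Suc a + e) = v e"
          using Cons.prems True by (auto simp: less_Suc_eq)
        show "run w (Suc a) = Some a'" "run w (Suc b) = Some b'" using r na nb by auto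
        show "p \<le> Suc b + length w" using Cons.prems by simp
      qed
    next
      case False
      then have na: "nxt a c = 0" using 3 ab by (simp add: nxt_def)
      show ?thesis
        by (rule Cons.IH[of 0 "Suc b"]) (use r na nb Cons.prems 3 in auto)
    qed
  qed
qed

lemma run_sync_zero:
  assumes lyndon "j < p" "run w 0 = Some a" "run w j = Some b" "p \<le> length w"
  shows "a = b"
proof (cases "j = 0")
  case False
  then show ?thesis using run_sync_border[of 0 j w a b] assms by auto
qed (use assms in auto)

text \<open>The bound \<open>2 * p\<close> has two halves: after at most \<open>p - i\<close>
  letters the first run is in state \<open>0\<close>, and from then on \<open>p\<close> letters are
  enough by \<open>run_sync_zero\<close>.\<close>

lemma run_sync:
  assumes L: lyndon
  shows "i < p \<Longrightarrow> j < p \<Longrightarrow> run w i = Some a \<Longrightarrow> run w j = Some b \<Longrightarrow> 2 * p \<le> i + length w \<Longrightarrow> a = b"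
proof (induction w arbitrary: i j)
  case Nil
  then show ?case by simp
next
  case (Cons c w)
  then have r: "run w (nxt i c) = Some a" "run w (nxt j c) = Some b"
    by (auto split: if_splits)
  have j: "nxt j c < p" using Cons.prems nxt_less by blast
  show ?case
  proof (cases "nxt i c = 0")
    case True
    then show ?thesis using run_sync_zero[OF L j] r Cons.prems by auto
  next
    case False
    then have "nxt i c = Suc i" "nxt i c < p" using nxt_less Cons.prems by (auto simp: nxt_def split: if_splits)
    then show ?thesis using Cons.IH[of "nxt i c" "nxt j c"] r j Cons.prems by auto
  qed
qed

end

section \<open>Periodic words and their windows\<close>

definition cyc :: "'a list \<Rightarrow> nat \<Rightarrow> 'a" where
  "cyc u t = u ! (t mod length u)"

definition win :: "(nat \<Rightarrow> 'a) \<Rightarrow> nat \<Rightarrow> nat \<Rightarrow> 'a list" where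
  "win f t m = map f [t..<t + m]"

lemma length_win[simp]: "length (win f t m) = m"
  by (simp add: win_def)

lemma nth_win[simp]: "i < m \<Longrightarrow> win f t m ! i = f (t + i)"
  by (simp add: win_def)

lemma win_0[simp]: "win f t 0 = []"
  by (simp add: win_def)

lemma win_add: "win f t (a + b) = win f t a @ win f (t + a) b"
  by (simp add: win_def upt_add_eq_append[of t "t + a" b, simplified] flip: add.assoc)

lemma win_Suc: "win f t (Suc m) = f t # win f (Suc t) m"
  by (simp add: win_def upt_conv_Cons del: upt_Suc)

lemma cyc_period[simp]: "cyc u (t + N * length u) = cyc u t" "cyc u (t + length u) = cyc u t"
  by (simp_all add: cyc_def)

lemma win_cyc_period[simp]: "win (cyc u) (t + N * length u) m = win (cyc u) t m"
proof (rule nth_equalityI)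
  fix i assume "i < length (win (cyc u) (t + N * length u) m)"
  moreover have "cyc u (t + N * length u + i) = cyc u (t + i)"
    using cyc_period(1)[of u "t + i" N] by (simp add: algebra_simps)
  ultimately show "win (cyc u) (t + N * length u) m ! i = win (cyc u) t m ! i" by simp
qed simp

lemma win_cyc_self: "win (cyc u) 0 (length u) = u"
  by (rule nth_equalityI) (auto simp: cyc_def)

lemma rotate_win: "rotate r u = win (cyc u) r (length u)"
  by (rule nth_equalityI) (auto simp: cyc_def nth_rotate)

lemma list_le_iff:
  fixes a b :: "'a::linorder list"
  assumes "length a = length b"
  shows "a \<le> b \<longleftrightarrow> (\<forall>m<length a. (\<forall>i<m. a ! i = b ! i) \<longrightarrow> a ! m \<le> b ! m)"
  using assms
proof (induction a b rule: list_induct2)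
  case Nil
  then show ?case by simp
next
  case (Cons x xs y ys)
  have *: "(\<forall>m<Suc l. P m) \<longleftrightarrow> P 0 \<and> (\<forall>m<l. P (Suc m))" for P and l :: nat
    by (auto simp: less_Suc_eq_0_disj)
  have "x # xs \<le> y # ys \<longleftrightarrow> x < y \<or> x = y \<and> xs \<le> ys" by auto
  also have "\<dots> \<longleftrightarrow> x \<le> y \<and> (x = y \<longrightarrow> xs \<le> ys)" by auto
  finally show ?case
    unfolding Cons.IH length_Cons * by auto
qed

lemma list_le_nthD:
  fixes a b :: "'a::linorder list"
  shows "a \<le> b \<Longrightarrow> length a = length b \<Longrightarrow> m < length b \<Longrightarrow> \<forall>i<m. a ! i = b ! i \<Longrightarrow> a ! m \<le> b ! m"
  using list_le_iff[of a b] by simp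

text \<open>The witness \<open>m\<close> is the position at which Duval's algorithm stops.\<close>

definition duval :: "(nat \<Rightarrow> nat) \<Rightarrow> nat \<Rightarrow> nat \<Rightarrow> bool" where
  "duval v n p \<longleftrightarrow> lyndon v p \<and> p \<le> n \<and>
     (\<exists>m\<le>n. (\<forall>i<m. v i = v (i mod p)) \<and> (m < n \<longrightarrow> v m < v (m mod p)))"

text \<open>The state \<open>j\<close> records that the window starting at \<open>t\<close> agrees
  with \<open>v\<close> so far. Since this window is at least \<open>v\<close>, its next letter is
  at least \<open>v j\<close>, so the run cannot die. At a return to \<open>0\<close> the comparison
  starts afresh with a later window.\<close>

lemma run_alive:
  assumes ge: "\<forall>t. win v 0 n \<le> win f t n" and "p \<le> n"
  shows "j < p \<Longrightarrow> win f t j = win v 0 j \<Longrightarrow> \<exists>i. run v p (win f (t + j) m) j = Some i"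
proof (induction m arbitrary: t j)
  case 0
  then show ?case by simp
next
  case (Suc m)
  let ?c = "f (t + j)"
  have eq: "f (t + i) = v i" if "i < j" for i
    using arg_cong[OF Suc.prems(2), of "\<lambda>l. l ! i"] that by simp
  have c: "v j \<le> ?c"
    using list_le_nthD[of "win v 0 n" "win f t n" j] ge Suc.prems assms(2) eq by auto
  show ?case
  proof (cases "nxt v p j ?c = 0")
    case True
    then show ?thesis
      using c Suc.IH[of 0 "Suc (t + j)"] Suc.prems by (auto simp: win_Suc)
  next
    case False
    then have *: "nxt v p j ?c = Suc j" "v j = ?c" "Suc j < p"
      using c Suc.prems by (auto simp: nxt_def split: if_splits)
    have "win f t (Suc j) = win v 0 (Suc j)"
      using win_add[of f t j 1] win_add[of v 0 j 1] Suc.prems * by (simp add: win_Suc)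
    then show ?thesis
      using c * Suc.IH[of "Suc j" t] by (auto simp: win_Suc)
  qed
qed

text \<open>As long as \<open>w\<close> agrees with the periodic continuation of the Lyndon prefix
  from offset \<open>i\<close>, the run is in state \<open>(i + l) mod p\<close>, where smaller
  letters are forbidden; the first difference is therefore upwards.\<close>

lemma run_ge:
  "run v p w i \<noteq> None \<Longrightarrow> i < p \<Longrightarrow> m < length w \<Longrightarrow>
    \<forall>l<m. w ! l = v ((i + l) mod p) \<Longrightarrow> v ((i + m) mod p) \<le> w ! m"
proof (induction w arbitrary: i m)
  case Nil
  then show ?case by simp
next
  case (Cons c w)
  show ?case
  proof (cases m)
    case 0
    then show ?thesis using Cons.prems by (auto split: if_splits)
  next
    case (Suc m')
    have c: "c = v i" using Cons.prems Suc by (auto dest: spec[of _ 0])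
    then have nx: "nxt v p i c = Suc i mod p" using Cons.prems by (auto simp: nxt_def)
    have "v ((Suc i mod p + m') mod p) \<le> w ! m'"
    proof (rule Cons.IH)
      show "run v p w (Suc i mod p) \<noteq> None" using Cons.prems c nx by auto
      show "\<forall>l<m'. w ! l = v ((Suc i mod p + l) mod p)"
      proof (intro allI impI)
        fix l assume "l < m'"
        then show "w ! l = v ((Suc i mod p + l) mod p)"
          using Cons.prems(4)[rule_format, of "Suc l"] Suc by (simp add: mod_simps)
      qed
    qed (use Cons.prems Suc in auto)
    then show ?thesis using Suc by (simp add: mod_simps)
  qed
qed

text \<open>A shift of the periodic word that is not a multiple of \<open>p\<close> begins with a
  proper suffix of the Lyndon word, and this suffix is strictly above the prefix before it
  ends.\<close>

lemma lyndon_shift_ge: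
  assumes "lyndon v p" "\<forall>l<m. v ((i + l) mod p) = v (l mod p)"
  shows "v (m mod p) \<le> v ((i + m) mod p)"
proof (cases "i mod p = 0")
  case True
  then have "(i + m) mod p = m mod p" by (metis mod_add_left_eq add_0)
  then show ?thesis by simp
next
  case False
  have p: "0 < p" using assms(1) by (simp add: lyndon_def)
  with assms(1) False obtain e where e: "i mod p + e < p" "v e < v (i mod p + e)"
    "\<forall>e'<e. v (i mod p + e') = v e'"
    unfolding lyndon_def by (metis mod_less_divisor gr0I)
  have red: "(i + l) mod p = i mod p + l" "l mod p = l" if "l \<le> e" for l
    using that e(1) by (metis mod_add_left_eq mod_less add_le_cancel_left le_less_trans, simp)
  show ?thesis
  proof (cases "e < m")
    case True
    then have "v ((i + e) mod p) = v (e mod p)" using assms(2) by blast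
    with e red[of e] show ?thesis by simp
  next
    case False
    then show ?thesis using red[of m] e by (metis le_neq_implies_less less_imp_le not_less order_refl)
  qed
qed

lemma run_win_ge:
  assumes d: "duval v n p" and r: "run v p w i \<noteq> None" and i: "i < p" and len: "length w = n"
  shows "win v 0 n \<le> w"
proof -
  from d have L: "lyndon v p" and "p \<le> n" by (auto simp: duval_def)
  from d obtain m0 where m0: "m0 \<le> n" "\<forall>i<m0. v i = v (i mod p)" "m0 < n \<longrightarrow> v m0 < v (m0 mod p)"
    by (auto simp: duval_def)
  let ?X = "\<lambda>t. v (t mod p)"
  \<comment> \<open>At its first deviation \<open>m0\<close> from the periodic word
    \<open>?X\<close>, \<open>v\<close> drops below it; so the letters of \<open>v\<close> after
    \<open>m0\<close> do not matter.\<close>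
  have 1: "win v 0 n \<le> win ?X 0 n"
  proof (subst list_le_iff, simp, intro allI impI)
    fix m assume m: "m < length (win v 0 n)" "\<forall>i<m. win v 0 n ! i = win ?X 0 n ! i"
    have "m \<le> m0"
    proof (rule ccontr)
      assume "\<not> m \<le> m0"
      with m have "v m0 = v (m0 mod p)" "m0 < n" by (auto dest: spec[of _ m0])
      with m0 show False by simp
    qed
    then show "win v 0 n ! m \<le> win ?X 0 n ! m" using m m0 by (cases "m = m0") auto
  qed
  have 2: "win ?X 0 n \<le> win ?X i n"
    by (subst list_le_iff, simp) (use lyndon_shift_ge[OF L] in auto)
  have 3: "win ?X i n \<le> w"
    by (subst list_le_iff) (use run_ge[OF r i] len in auto)
  from 1 2 3 show ?thesis by order
qed

lemma run_power:
  assumes "run v p u i = Some i"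
  shows "run v p (win (cyc u) 0 (N * length u)) i = Some i"
proof (induction N)
  case (Suc N)
  have "win (cyc u) 0 (Suc N * length u) = win (cyc u) 0 (length u) @ win (cyc u) (length u) (N * length u)"
    using win_add[of "cyc u" 0 "length u" "N * length u"] by simp
  also have "\<dots> = u @ win (cyc u) 0 (N * length u)"
    using win_cyc_period[of u 0 1] by (simp add: win_cyc_self)
  finally show ?case using assms Suc by (simp add: run_append)
qed simp

text \<open>Powers of \<open>u\<close> lead back to both states, and a power of length at least
  \<open>2 * p\<close> forces the two runs to agree.\<close>

lemma closed_unique:
  assumes "lyndon v p" "u \<noteq> []" "i < p" "j < p" "run v p u i = Some i" "run v p u j = Some j"
  shows "i = j"
proof (rule run_sync[OF assms(1,3,4)])
  show "run v p (win (cyc u) 0 (2 * p * length u)) i = Some i"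
    "run v p (win (cyc u) 0 (2 * p * length u)) j = Some j"
    using run_power assms by blast+
  show "2 * p \<le> i + length (win (cyc u) 0 (2 * p * length u))"
    using assms(2) by (cases u) auto
qed

lemma closed_iff_windows:
  assumes d: "duval v n p" and u: "u \<noteq> []"
  shows "closed v p u \<longleftrightarrow> (\<forall>t. win v 0 n \<le> win (cyc u) t n)"
proof
  assume "closed v p u"
  then obtain i where i: "i < p" "run v p u i = Some i" by (auto simp: closed_def)
  show "\<forall>t. win v 0 n \<le> win (cyc u) t n"
  proof
    fix t
    let ?l = "length u"
    \<comment> \<open>The power of \<open>u\<close> with exponent \<open>t + n\<close> is long
      enough to contain the window at \<open>t\<close>, so a closed run also reads this
      window.\<close>
    have "t + n \<le> (t + n) * ?l" using u by (cases u) auto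
    then obtain r where "(t + n) * ?l = t + n + r" using le_Suc_ex by blast
    then have "(t + n) * ?l = t + (n + r)" by simp
    then have "win (cyc u) 0 ((t + n) * ?l) = win (cyc u) 0 t @ win (cyc u) t n @ win (cyc u) (t + n) r"
      using win_add[of "cyc u" 0 t "n + r"] win_add[of "cyc u" t n r] by simp
    then have "run v p (win (cyc u) 0 t @ win (cyc u) t n @ win (cyc u) (t + n) r) i = Some i"
      using run_power[OF i(2), of "t + n"] by simp
    then obtain j where "run v p (win (cyc u) 0 t) i = Some j" "run v p (win (cyc u) t n) j \<noteq> None"
      by (auto simp: run_append split: option.splits)
    then show "win v 0 n \<le> win (cyc u) t n"
      using run_win_ge[OF d] run_less i(1) by (metis length_win)
  qed
next
  assume ge: "\<forall>t. win v 0 n \<le> win (cyc u) t n"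
  from d have L: "lyndon v p" and pn: "p \<le> n" and p: "0 < p" by (auto simp: duval_def lyndon_def)
  let ?l = "length u" and ?w = "win (cyc u) 0 (p * length u)"
  have al: "\<exists>i. run v p (win (cyc u) t m) 0 = Some i" for t m
    using run_alive[OF ge pn, of 0 t m] p by simp
  obtain i where i: "run v p ?w 0 = Some i" using al by blast
  obtain y where y: "run v p u 0 = Some y" using al[of 0 ?l] by (auto simp: win_cyc_self)
  have uw: "win (cyc u) 0 (?l + p * ?l) = u @ ?w"
    using win_add[of "cyc u" 0 ?l "p * ?l"] win_cyc_period[of u 0 1] by (simp add: win_cyc_self)
  have wu: "win (cyc u) 0 (p * ?l + ?l) = ?w @ u"
    using win_add[of "cyc u" 0 "p * ?l" ?l] win_cyc_period[of u 0 p] by (simp add: win_cyc_self)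
  \<comment> \<open>The state \<open>i\<close> reached from \<open>0\<close> by the power
    \<open>?w\<close> is the closing state. Reading \<open>u\<close> from \<open>i\<close> gives the
    state \<open>j\<close> reached by \<open>?w @ u = u @ ?w\<close>, which is also reached by
    \<open>?w\<close> from \<open>y\<close>. As \<open>?w\<close> has length at least
    \<open>p\<close>, synchronisation gives \<open>i = j\<close>.\<close>
  from uw wu have com: "u @ ?w = ?w @ u" by (simp add: add.commute)
  obtain j where j: "run v p (u @ ?w) 0 = Some j" using al[of 0 "?l + p * ?l"] uw by auto
  have "run v p ?w y = Some j" using j y by (simp add: run_append)
  moreover have "y < p" using y p run_less by blast
  moreover have "p \<le> length ?w" using u by (cases u) auto
  ultimately have "i = j" using run_sync_zero[OF L _ i] by blast
  moreover have "run v p u i = Some j" using j com i by (simp add: run_append)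
  moreover have "i < p" using i p run_less by blast
  ultimately show "closed v p u" by (auto simp: closed_def)
qed

section \<open>Words fixed by rotations and reflections\<close>

lemma finite_words[simp]: "finite \<Sigma> \<Longrightarrow> finite (words \<Sigma> n)"
  unfolding words_def by (rule finite_lists_length_eq)

lemma words_Suc: "words \<Sigma> (Suc n) = (\<lambda>(h, c). h @ [c]) ` (words \<Sigma> n \<times> \<Sigma>)"
proof
  show "words \<Sigma> (Suc n) \<subseteq> (\<lambda>(h, c). h @ [c]) ` (words \<Sigma> n \<times> \<Sigma>)"
  proof
    fix w assume "w \<in> words \<Sigma> (Suc n)"
    then have "w \<noteq> []" "set w \<subseteq> \<Sigma>" "length w = Suc n" by (auto simp: words_def)
    then have "w = butlast w @ [last w]" "butlast w \<in> words \<Sigma> n" "last w \<in> \<Sigma>"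
      by (auto simp: words_def dest!: in_set_butlastD)
    then show "w \<in> (\<lambda>(h, c). h @ [c]) ` (words \<Sigma> n \<times> \<Sigma>)" by (metis (lifting) SigmaI case_prod_conv rev_image_eqI)
  qed
qed (auto simp: words_def)

lemma sum_words_Suc: "(\<Sum>w\<in>words \<Sigma> (Suc n). f w) = (\<Sum>h\<in>words \<Sigma> n. \<Sum>c\<in>\<Sigma>. f (h @ [c]))"
proof -
  have "inj_on (\<lambda>(h, c). h @ [c]) (words \<Sigma> n \<times> \<Sigma>)" by (auto simp: inj_on_def)
  then show ?thesis
    by (simp add: words_Suc sum.reindex sum.cartesian_product case_prod_unfold)
qed

lemma words_rotate[simp]: "rotate r w \<in> words \<Sigma> n \<longleftrightarrow> w \<in> words \<Sigma> n"
  and words_rev[simp]: "rev w \<in> words \<Sigma> n \<longleftrightarrow> w \<in> words \<Sigma> n"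
  by (auto simp: words_def)

lemma cyc_rotate: "u \<noteq> [] \<Longrightarrow> cyc (rotate r u) t = cyc u (t + r)"
  by (simp add: cyc_def nth_rotate mod_simps add.commute)

lemma win_cyc_rotate: "u \<noteq> [] \<Longrightarrow> win (cyc (rotate r u)) t n = win (cyc u) (t + r) n"
  by (rule nth_equalityI) (auto simp: cyc_rotate algebra_simps)

lemma closed_rotate:
  assumes "duval v n p" "u \<noteq> []"
  shows "closed v p (rotate r u) \<longleftrightarrow> closed v p u"
proof -
  have "(\<forall>t. P (win (cyc u) (t + r) n)) \<longleftrightarrow> (\<forall>t. P (win (cyc u) t n))" for P
  proof (intro iffI allI)
    fix t assume "\<forall>t. P (win (cyc u) (t + r) n)"
    \<comment> \<open>The shift by \<open>r\<close> is undone by \<open>length u - 1\<close> further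
      shifts, which complete a multiple of the period.\<close>
    then have "P (win (cyc u) (t + r * (length u - 1) + r) n)" by blast
    moreover have "t + r * (length u - 1) + r = t + r * length u"
      using assms(2) by (cases u) (auto simp: algebra_simps)
    ultimately show "P (win (cyc u) t n)" by (metis win_cyc_period)
  qed auto
  then show ?thesis using assms by (simp add: closed_iff_windows win_cyc_rotate)
qed

lemma closed_iff_rotations:
  assumes "duval v n p" "length w = n"
  shows "closed v p w \<longleftrightarrow> (\<forall>r. win v 0 n \<le> rotate r w)"
proof -
  have "w \<noteq> []" using assms by (auto simp: duval_def lyndon_def)
  then show ?thesis using closed_iff_windows[OF assms(1), of w] assms(2) by (simp add: rotate_win)
qed

lemma closed_cong_cyc:
  assumes "duval v n p" "u \<noteq> []" "w \<noteq> []" "cyc u = cyc w"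
  shows "closed v p u \<longleftrightarrow> closed v p w"
  using assms by (simp add: closed_iff_windows)

text \<open>Needed to pass from \<open>rev w\<close> to the reversal of the root \<open>u\<close> of
  \<open>w\<close>. Reversal maps position \<open>s\<close> to \<open>length w - 1 - s\<close>,
  which is congruent to \<open>length u - 1 - s mod length u\<close> because \<open>length u\<close>
  divides \<open>length w\<close>.\<close>

lemma cyc_rev_cong:
  assumes "cyc w = cyc u" "length w = length u * q" "w \<noteq> []"
  shows "cyc (rev w) = cyc (rev u)"
proof
  fix t
  let ?g = "length u" and ?n = "length w"
  have n: "0 < ?n" using assms(3) by simp
  then have "0 < ?g * q" unfolding assms(2) .
  then have g: "0 < ?g" "0 < ?n" using n by simp_all
  define s where "s = t mod ?n"
  have s: "s < ?n" using g unfolding s_def by (intro mod_less_divisor)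
  have sm: "s mod ?g = t mod ?g" unfolding s_def by (rule mod_mod_cancel) (simp add: assms(2))
  define a b where "a = s div ?g" and "b = s mod ?g"
  have sab: "s = ?g * a + b" "b < ?g" using g by (auto simp: a_def b_def)
  then have "a < q" using s assms(2) by (metis add_lessD1 mult_less_cancel1)
  then obtain q' where q': "q = a + 1 + q'" by (metis less_iff_Suc_add add.commute add_Suc_right plus_1_eq_Suc add.assoc)
  have "?n - 1 - s = ?g * q' + (?g - 1 - b)"
    using sab assms(2) unfolding q' by (simp add: algebra_simps)
  moreover have "?g - 1 - b < ?g" using g by simp
  ultimately have m: "(?n - 1 - s) mod ?g = ?g - 1 - t mod ?g"
    using sm b_def by (metis mod_mult_self4 mod_less)
  have "cyc (rev w) t = w ! (?n - 1 - s)" using g s by (simp add: cyc_def rev_nth s_def)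
  also have "\<dots> = cyc w (?n - 1 - s)" using g by (simp add: cyc_def)
  also have "\<dots> = cyc u (?n - 1 - s)" using assms by simp
  also have "\<dots> = u ! (?g - 1 - t mod ?g)" unfolding cyc_def m ..
  also have "\<dots> = cyc (rev u) t" using g by (simp add: cyc_def rev_nth)
  finally show "cyc (rev w) t = cyc (rev u) t" .
qed

section \<open>Words fixed by a rotation\<close>

lemma period_gcd:
  fixes r n :: nat
  assumes "\<And>t. f (t + r) = f t" "\<And>t. f (t + n) = f t" "r \<noteq> 0"
  shows "f (t + gcd r n) = f t"
proof -
  have mult: "f (t + x * m) = f t" if "\<And>t. f (t + m) = f t" for x m t
    by (induction x arbitrary: t) (auto simp: that, metis add.assoc add.commute that)
  from bezout_nat[OF assms(3), of n] obtain x y where xy: "r * x = n * y + gcd r n" by blast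
  have "f (t + gcd r n) = f (t + gcd r n + y * n)" using mult[of n] assms(2) by metis
  also have "t + gcd r n + y * n = t + x * r" using xy by (simp add: algebra_simps)
  also have "f \<dots> = f t" using mult[of r] assms(1) by metis
  finally show ?thesis .
qed

lemma period_mod:
  fixes g :: nat
  assumes "\<And>t. f (t + g) = f t"
  shows "f t = f (t mod g)"
proof -
  have "f (t mod g + x * g) = f (t mod g)" for x
    by (induction x) (auto, metis add.assoc add.commute assms)
  from this[of "t div g"] show ?thesis by simp
qed

text \<open>A word fixed by \<open>rotate r\<close> has periods \<open>r\<close> and
  \<open>n\<close>, hence \<open>gcd r n\<close>, and is a power of its prefix of that length. Word
  and prefix generate the same periodic word, on which alone goodness depends.\<close>

lemma card_rotate_fixed:
  assumes d: "duval v n p" and r: "0 < r"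
  shows "card {w \<in> words {..<k} n. closed v p w \<and> closed v p (rev w) \<and> rotate r w = w}
    = card {u \<in> words {..<k} (gcd r n). closed v p u \<and> closed v p (rev u)}"
    (is "card ?A = card ?B")
proof -
  have n: "0 < n" using d by (auto simp: duval_def lyndon_def)
  define g where "g = gcd r n"
  have g: "0 < g" "g dvd r" "g dvd n" "g \<le> n" using n by (auto simp: g_def)
  then obtain q where q: "n = g * q" by blast
  have cl: "closed v p w = closed v p u" "closed v p (rev w) = closed v p (rev u)"
    if "cyc w = cyc u" "length w = n" "length u = g" for u w
  proof -
    have ne: "w \<noteq> []" "u \<noteq> []" using that n g by auto
    then show "closed v p w = closed v p u" using closed_cong_cyc[OF d] that by blast
    show "closed v p (rev w) = closed v p (rev u)"
      using closed_cong_cyc[OF d] cyc_rev_cong[of w u q] that q ne by simp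
  qed
  have AB: "cyc (take g w) = cyc w" if "rotate r w = w" "length w = n" for w
  proof
    fix t
    have "w \<noteq> []" using that n by auto
    then have "cyc w (t + r) = cyc w t" for t using that cyc_rotate[of w r t] by simp
    then have "cyc w (t + g) = cyc w t" for t
      unfolding g_def using period_gcd[of "cyc w" r n] r that by auto
    then have "cyc w t = cyc w (t mod g)" by (rule period_mod)
    then show "cyc (take g w) t = cyc w t"
      using g that by (simp add: cyc_def min_def less_le_trans[of _ g])
  qed
  have BA: "cyc (win (cyc u) 0 n) = cyc u" if "length u = g" for u :: "nat list"
    using that n q by (auto simp: cyc_def fun_eq_iff mod_mod_cancel)
  have "bij_betw (take g) ?A ?B"
  proof (rule bij_betwI[where g = "\<lambda>u. win (cyc u) 0 n"])
    show "take g \<in> ?A \<rightarrow> ?B"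
    proof
      fix w assume w: "w \<in> ?A"
      then have l: "length w = n" "length (take g w) = g" "set (take g w) \<subseteq> {..<k}"
        using g by (auto simp: words_def dest: in_set_takeD)
      with w AB[of w] cl[of w "take g w"] show "take g w \<in> ?B"
        by (auto simp: words_def g_def)
    qed
    show "(\<lambda>u. win (cyc u) 0 n) \<in> ?B \<rightarrow> ?A"
    proof
      fix u assume u: "u \<in> ?B"
      then have l: "length u = g" by (auto simp: words_def g_def)
      have s: "set (win (cyc u) 0 n) \<subseteq> {..<k}"
      proof
        fix x assume "x \<in> set (win (cyc u) 0 n)"
        then obtain t where "x = u ! (t mod g)" using l by (auto simp: win_def cyc_def)
        then have "x \<in> set u" using l g by simp
        then show "x \<in> {..<k}" using u by (auto simp: words_def)
      qed
      obtain r' where r': "r = r' * g" using g(2) by (metis dvd_div_mult_self)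
      have "rotate r (win (cyc u) 0 n) = win (cyc u) 0 n"
        unfolding rotate_win BA[OF l] length_win r'
        using win_cyc_period[of u 0 r' n] l by simp
      with s u BA[OF l] l cl[of "win (cyc u) 0 n" u] show "win (cyc u) 0 n \<in> ?A"
        by (simp add: words_def)
    qed
    show "win (cyc (take g w)) 0 n = w" if "w \<in> ?A" for w
      using AB[of w] that win_cyc_self[of w] by (auto simp: words_def)
    show "take g (win (cyc u) 0 n) = u" if "u \<in> ?B" for u
      by (rule nth_equalityI) (use that g in \<open>auto simp: words_def g_def cyc_def\<close>)
  qed
  then show ?thesis by (rule bij_betw_same_card)
qed

lemma rev_rotate1: "w \<noteq> [] \<Longrightarrow> rev (rotate 1 w) = rotate (length w - 1) (rev w)"
proof (cases w)
  case (Cons c w')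
  have "rotate (length (rev w')) (rev w' @ [c]) = [c] @ rev w'" by (rule rotate_append)
  with Cons show ?thesis by simp
qed simp

lemma closed_rev_rotate:
  assumes "duval v n p" "u \<noteq> []"
  shows "closed v p (rev (rotate r u)) \<longleftrightarrow> closed v p (rev u)"
proof (induction r)
  case (Suc r)
  have "rev (rotate (Suc r) u) = rotate (length u - 1) (rev (rotate r u))"
    using rev_rotate1[of "rotate r u"] assms by simp
  then show ?case using Suc closed_rotate[OF assms(1)] assms(2) by simp
qed simp

section \<open>Words fixed by a reflection, up to conjugation\<close>

definition reflected :: "(nat \<Rightarrow> nat) \<Rightarrow> nat \<Rightarrow> nat \<Rightarrow> nat \<Rightarrow> nat \<Rightarrow> nat list set" where
  "reflected v p k n r = {w \<in> words {..<k} n. closed v p w \<and> rotate r (rev w) = w}"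

text \<open>Conjugating a reflection by one rotation changes its index by \<open>2\<close>, so
  \<open>rotate 1\<close> is an injection that gives one inequality. As the indices count modulo
  \<open>n\<close>, continuing in steps of \<open>2\<close> leads from \<open>r + 2 * i\<close> back
  to \<open>r\<close>, which gives the other one.\<close>

lemma card_reflected_add2:
  assumes d: "duval v n p"
  shows "card (reflected v p k n (r + 2 * i)) = card (reflected v p k n r)"
proof -
  have n: "0 < n" using d by (auto simp: duval_def lyndon_def)
  have le: "card (reflected v p k n r) \<le> card (reflected v p k n (r + 2))" for r
  proof (rule card_inj_on_le)
    show "inj_on (rotate 1) (reflected v p k n r)"
      by (auto simp: inj_on_def inj_eq[OF inj_rotate1])
    show "rotate 1 ` reflected v p k n r \<subseteq> reflected v p k n (r + 2)"
    proof (safe)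
      fix w assume w: "w \<in> reflected v p k n r"
      then have l: "length w = n" "w \<noteq> []" using n by (auto simp: reflected_def words_def)
      have "rotate (r + 2) (rev (rotate 1 w)) = rotate (1 + r + n) (rev w)"
        using l n rev_rotate1[of w] by (simp add: rotate_rotate)
      also have "\<dots> = rotate 1 (rotate r (rotate n (rev w)))" by (simp add: rotate_rotate)
      also have "\<dots> = rotate 1 w" using w l by (simp add: reflected_def)
      finally show "rotate 1 w \<in> reflected v p k n (r + 2)"
        using w closed_rotate[OF d l(2), of 1] by (simp add: reflected_def words_def)
    qed
    show "finite (reflected v p k n (r + 2))" by (auto simp: reflected_def)
  qed
  have mono: "card (reflected v p k n r) \<le> card (reflected v p k n (r + 2 * i))" for r i
  proof (induction i)
    case (Suc i)
    then show ?case using le[of "r + 2 * i"] by simp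
  qed simp
  have per: "reflected v p k n (r + n * 2 * i) = reflected v p k n r"
  proof -
    have "rotate (r + n * 2 * i) (rev w) = rotate r (rev w)" if "length w = n" for w :: "nat list"
      using that rotate_conv_mod[of "r + n * 2 * i" "rev w"] rotate_conv_mod[of r "rev w"]
      by (simp add: mult.assoc)
    then show ?thesis by (auto simp: reflected_def words_def)
  qed
  obtain m where "n * 2 * i = 2 * i + 2 * m"
    using n by (metis One_nat_def Suc_leI add_mult_distrib2 le_add_diff_inverse mult.assoc mult.commute mult_le_mono1 nat_mult_1)
  then show ?thesis using mono[of r i] mono[of "r + 2 * i" m] per
    by (metis add.assoc antisym)
qed

text \<open>The indices \<open>r\<close> and \<open>r + n\<close> denote the same reflection and
  have different parity when \<open>n\<close> is odd, so all reflections are conjugate.\<close>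

lemma sum_card_reflected_odd:
  assumes d: "duval v n p" and "odd n"
  shows "(\<Sum>r<n. card (reflected v p k n r)) = n * card (reflected v p k n 0)"
proof -
  have per: "reflected v p k n (r + n) = reflected v p k n r" for r
  proof -
    have "rotate (r + n) (rev w) = rotate r (rev w)" if "length w = n" for w :: "nat list"
      using that rotate_conv_mod[of "r + n" "rev w"] rotate_conv_mod[of r "rev w"] by simp
    then show ?thesis by (auto simp: reflected_def words_def)
  qed
  have "card (reflected v p k n r) = card (reflected v p k n 0)" for r
  proof (cases "even r")
    case True
    then show ?thesis using card_reflected_add2[OF d, of k 0] by (metis add_0 evenE)
  next
    case False
    then have "even (r + n)" using assms by simp
    then have "card (reflected v p k n (r + n)) = card (reflected v p k n 0)"
      using card_reflected_add2[OF d, of k 0] by (metis add_0 evenE)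
    then show ?thesis by (simp add: per)
  qed
  then have "(\<Sum>r<n. card (reflected v p k n r)) = (\<Sum>r<n. card (reflected v p k n 0))"
    by (intro sum.cong) auto
  then show ?thesis by simp
qed

lemma sum_card_reflected_even:
  assumes d: "duval v (2 * m) p"
  shows "(\<Sum>r<2*m. card (reflected v p k (2 * m) r))
    = m * (card (reflected v p k (2 * m) 0) + card (reflected v p k (2 * m) 1))"
proof -
  have "(\<Sum>r<2*l. card (reflected v p k (2 * m) r))
    = l * (card (reflected v p k (2 * m) 0) + card (reflected v p k (2 * m) 1))" for l
  proof (induction l)
    case (Suc l)
    then show ?case
      using card_reflected_add2[OF d, of k 0 l] card_reflected_add2[OF d, of k 1 l] by simp
  qed simp
  then show ?thesis .
qed

section \<open>Counting closed walks\<close>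

text \<open>The letter \<open>c\<close> is appended to the word and thus put in front of the
  reversed word: the row moves from \<open>i\<close> to \<open>nxt v p i c\<close>, while a reversed
  word started in \<open>j'\<close> continues in column \<open>nxt v p j' c\<close> of the old
  table.\<close>

definition step :: "(nat \<Rightarrow> nat) \<Rightarrow> nat \<Rightarrow> nat \<Rightarrow> (nat \<Rightarrow> nat \<Rightarrow> nat) \<Rightarrow> nat \<Rightarrow> nat \<Rightarrow> nat" where
  "step v p k w i' j' = (\<Sum>i<p. \<Sum>c<k.
     if v i \<le> c \<and> v j' \<le> c \<and> nxt v p i c = i' then w i (nxt v p j' c) else 0)"

text \<open>A step extends every word by one letter but carries its weight along unchanged, whence
  \<open>butlast h\<close> on the right. The weight \<open>g\<close> is left general in order to
  cover both \<open>step_power\<close>, where it ignores the word, and \<open>hub\<close>, where it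
  is \<open>overlaps\<close>.\<close>

lemma step_sum_words:
  assumes g: "\<And>h i. g h i None = 0"
  shows "step v p k (\<lambda>i j. \<Sum>h\<in>words {..<k} m. \<Sum>a<p.
        if run v p h a = Some i then g h a (run v p (rev h) j) else 0) i' j'
    = (\<Sum>h\<in>words {..<k} (Suc m). \<Sum>a<p.
        if run v p h a = Some i' then g (butlast h) a (run v p (rev h) j') else 0)"
proof -
  have *: "(\<Sum>i<p. if v i \<le> c \<and> v j' \<le> c \<and> nxt v p i c = i' then
        if run v p h a = Some i then g h a (run v p (rev h) (nxt v p j' c)) else 0 else 0)
    = (if run v p (h @ [c]) a = Some i' then g h a (run v p (rev (h @ [c])) j') else 0)"
    if a: "a < p" for h c a
  proof (cases "run v p h a")
    case None
    then show ?thesis by (simp add: run_snoc)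
  next
    case (Some i1)
    then have "i1 < p" using a run_less by blast
    have "(\<Sum>i<p. if v i \<le> c \<and> v j' \<le> c \<and> nxt v p i c = i' then
        if run v p h a = Some i then g h a (run v p (rev h) (nxt v p j' c)) else 0 else 0)
      = (\<Sum>i<p. if i = i1 then if v i1 \<le> c \<and> v j' \<le> c \<and> nxt v p i1 c = i' then
          g h a (run v p (rev h) (nxt v p j' c)) else 0 else 0)"
      by (rule sum.cong) (auto simp: Some)
    also have "\<dots> = (if v i1 \<le> c \<and> v j' \<le> c \<and> nxt v p i1 c = i' then
          g h a (run v p (rev h) (nxt v p j' c)) else 0)"
      using \<open>i1 < p\<close> by simp
    also have "\<dots> = (if run v p (h @ [c]) a = Some i' then g h a (run v p (rev (h @ [c])) j') else 0)"
      by (simp add: run_snoc Some g)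
    finally show ?thesis .
  qed
  let ?G = "\<lambda>i c h a. if v i \<le> c \<and> v j' \<le> c \<and> nxt v p i c = i' then
        if run v p h a = Some i then g h a (run v p (rev h) (nxt v p j' c)) else 0 else 0"
  have "step v p k (\<lambda>i j. \<Sum>h\<in>words {..<k} m. \<Sum>a<p.
        if run v p h a = Some i then g h a (run v p (rev h) j) else 0) i' j'
    = (\<Sum>i<p. \<Sum>c<k. \<Sum>h\<in>words {..<k} m. \<Sum>a<p. ?G i c h a)"
    unfolding step_def by (intro sum.cong refl) auto
  also have "\<dots> = (\<Sum>c<k. \<Sum>i<p. \<Sum>h\<in>words {..<k} m. \<Sum>a<p. ?G i c h a)"
    by (rule sum.swap)
  also have "\<dots> = (\<Sum>c<k. \<Sum>h\<in>words {..<k} m. \<Sum>i<p. \<Sum>a<p. ?G i c h a)"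
    by (intro sum.cong refl sum.swap)
  also have "\<dots> = (\<Sum>h\<in>words {..<k} m. \<Sum>c<k. \<Sum>i<p. \<Sum>a<p. ?G i c h a)"
    by (rule sum.swap)
  also have "\<dots> = (\<Sum>h\<in>words {..<k} m. \<Sum>c<k. \<Sum>a<p. \<Sum>i<p. ?G i c h a)"
    by (intro sum.cong refl sum.swap)
  also have "\<dots> = (\<Sum>h\<in>words {..<k} m. \<Sum>c<k. \<Sum>a<p.
      if run v p (h @ [c]) a = Some i' then g h a (run v p (rev (h @ [c])) j') else 0)"
    by (intro sum.cong refl *) simp
  finally show ?thesis unfolding sum_words_Suc butlast_snoc .
qed

lemma step_cong:
  assumes "\<And>i j. i < p \<Longrightarrow> w i j = w' i j"
  shows "step v p k w i' j' = step v p k w' i' j'"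
  unfolding step_def by (intro sum.cong refl) (simp add: assms)

lemma words_0[simp]: "words \<Sigma> 0 = {[]}"
  by (auto simp: words_def)

lemma step_power:
  assumes "i < p"
  shows "(step v p k ^^ m) w i j = (\<Sum>h\<in>words {..<k} m. \<Sum>a<p.
    if run v p h a = Some i then case run v p (rev h) j of None \<Rightarrow> 0 | Some b \<Rightarrow> w a b else 0)"
  using assms
proof (induction m arbitrary: i j)
  case 0
  then show ?case by simp
next
  case (Suc m)
  let ?W = "\<lambda>i j. (\<Sum>h\<in>words {..<k} m. \<Sum>a<p.
    if run v p h a = Some i then case run v p (rev h) j of None \<Rightarrow> 0 | Some b \<Rightarrow> w a b else 0)"
  have "(step v p k ^^ Suc m) w i j = step v p k ((step v p k ^^ m) w) i j" by simp
  also have "\<dots> = step v p k ?W i j"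
    by (intro step_cong Suc.IH)
  also have "\<dots> = (\<Sum>h\<in>words {..<k} (Suc m). \<Sum>a<p.
    if run v p h a = Some i then case run v p (rev h) j of None \<Rightarrow> 0 | Some b \<Rightarrow> w a b else 0)"
    by (rule step_sum_words) simp
  finally show ?case .
qed

text \<open>A closing state is unique if it exists, so counting words together with a closing state
  counts each closed word once.\<close>

lemma card_closed:
  assumes "lyndon v p" "finite A" "\<And>x. x \<in> A \<Longrightarrow> f x \<noteq> []"
  shows "card {x \<in> A. closed v p (f x)} = (\<Sum>x\<in>A. \<Sum>i<p. of_bool (run v p (f x) i = Some i))"
proof -
  have "(\<Sum>i<p. of_bool (run v p (f x) i = Some i)) = (of_bool (closed v p (f x)) :: nat)"
    if "x \<in> A" for x
  proof (cases "closed v p (f x)")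
    case True
    then obtain i where i: "i < p" "run v p (f x) i = Some i" by (auto simp: closed_def)
    have "(\<Sum>j<p. of_bool (run v p (f x) j = Some j)) = (\<Sum>j<p. of_bool (j = i) :: nat)"
    proof (intro sum.cong refl)
      fix j assume "j \<in> {..<p}"
      then have "run v p (f x) j = Some j \<longleftrightarrow> j = i"
        using closed_unique[OF assms(1) assms(3)[OF that], of j i] i by auto
      then show "of_bool (run v p (f x) j = Some j) = (of_bool (j = i) :: nat)" by simp
    qed
    then show ?thesis using i True by (simp add: sum.delta of_bool_def)
  next
    case False
    then show ?thesis by (auto simp: closed_def intro!: sum.neutral)
  qed
  then have "(\<Sum>x\<in>A. \<Sum>i<p. of_bool (run v p (f x) i = Some i)) = (\<Sum>x\<in>A. of_bool (closed v p (f x)) :: nat)"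
    by (intro sum.cong refl)
  also have "\<dots> = card {x \<in> A. closed v p (f x)}"
    using assms(2) by (simp add: sum.If_cases of_bool_def Int_def)
  finally show ?thesis by simp
qed

section \<open>Walks anchored at state 0\<close>

definition overlaps :: "(nat \<Rightarrow> nat) \<Rightarrow> nat \<Rightarrow> nat list \<Rightarrow> nat" where
  "overlaps v p h = card {l. l < p \<and> l \<le> length h \<and> take l h = win v 0 l}"

text \<open>Row \<open>t\<close> of the table at time \<open>t\<close> can only be reached by reading the first \<open>t\<close> letters of \<open>v\<close>, so
  a nonzero entry belongs to a single word, and \<open>Suc\<close> accounts for its overlap of length \<open>t\<close>.\<close>

primrec hub :: "(nat \<Rightarrow> nat) \<Rightarrow> nat \<Rightarrow> nat \<Rightarrow> nat \<Rightarrow> nat \<Rightarrow> nat \<Rightarrow> nat \<Rightarrow> nat" where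
  "hub v p k q 0 = (\<lambda>i j. if i = 0 \<and> j = q then 1 else 0)"
| "hub v p k q (Suc t) = (\<lambda>i j. let x = step v p k (hub v p k q t) i j
     in if Suc t < p \<and> i = Suc t \<and> x \<noteq> 0 then Suc x else x)"

lemma win_snoc: "win f t (Suc m) = win f t m @ [f (t + m)]"
  using win_add[of f t m 1] by (simp add: win_Suc)

lemma run_win: "l < p \<Longrightarrow> run v p (win v 0 l) 0 = Some l"
  by (induction l) (auto simp: win_snoc run_snoc nxt_def)

text \<open>A letter raises the state by at most one, so reaching a state equal to the number of
  letters read forces every letter to match \<open>v\<close>.\<close>

lemma run_0_full:
  "run v p h 0 = Some (length h) \<Longrightarrow> length h < p \<Longrightarrow> h = win v 0 (length h)"
proof (induction h rule: rev_induct)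
  case (snoc c h)
  then obtain j where j: "run v p h 0 = Some j" "v j \<le> c" "nxt v p j c = Suc (length h)"
    by (auto simp: run_snoc split: option.splits if_splits)
  then have "j = length h" "v j = c" by (auto simp: nxt_def split: if_splits)
  then show ?case using snoc j by (auto simp: win_snoc)
qed simp

lemma overlaps_snoc:
  "overlaps v p (h @ [c]) = overlaps v p h
    + of_bool (Suc (length h) < p \<and> h @ [c] = win v 0 (Suc (length h)))"
proof -
  let ?b = "Suc (length h) < p \<and> h @ [c] = win v 0 (Suc (length h))"
  have "{l. l < p \<and> l \<le> length (h @ [c]) \<and> take l (h @ [c]) = win v 0 l}
    = {l. l < p \<and> l \<le> length h \<and> take l h = win v 0 l} \<union> (if ?b then {Suc (length h)} else {})"
    by (auto simp: le_Suc_eq)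
  then show ?thesis by (auto simp: overlaps_def)
qed

lemma overlaps_pos: "0 < p \<Longrightarrow> 0 < overlaps v p h"
  unfolding overlaps_def by (subst card_gt_0_iff) (auto intro: exI[of _ 0])

text \<open>A plain step would keep counting the overlaps of the word without its last letter. The
  correction concerns the single word \<open>?W\<close>, the prefix of \<open>v\<close> of length
  \<open>Suc t\<close>, and \<open>v l < k\<close> makes sure that this word is among those
  counted.\<close>

lemma hub_eq:
  assumes "i < p" "\<And>l. l < p \<Longrightarrow> v l < k"
  shows "hub v p k q t i j = (\<Sum>h\<in>words {..<k} t.
    if run v p h 0 = Some i \<and> run v p (rev h) j = Some q then overlaps v p h else 0)"
  using assms(1)
proof (induction t arbitrary: i j)
  case 0
  have "{l. l < p \<and> l = 0 \<and> [] = win v 0 l} = {0}" using 0 by auto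
  then show ?case by (auto simp: overlaps_def)
next
  case (Suc t)
  let ?g = "\<lambda>h a b. if a = 0 \<and> b = Some q then overlaps v p h else 0"
  have del: "(\<Sum>a<p. if run v p h a = Some i then ?g h' a b else 0)
    = (if run v p h 0 = Some i \<and> b = Some q then overlaps v p h' else 0)" for h h' i b
  proof -
    have "(\<Sum>a<p. if run v p h a = Some i then ?g h' a b else 0)
      = (\<Sum>a<p. if a = 0 then (if run v p h 0 = Some i \<and> b = Some q then overlaps v p h' else 0) else 0)"
      by (intro sum.cong refl) auto
    then show ?thesis using Suc.prems by simp
  qed
  have s: "step v p k (hub v p k q t) i j = (\<Sum>h\<in>words {..<k} (Suc t).
    if run v p h 0 = Some i \<and> run v p (rev h) j = Some q then overlaps v p (butlast h) else 0)"
  proof -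
    have "step v p k (hub v p k q t) i j = step v p k (\<lambda>i j. \<Sum>h\<in>words {..<k} t. \<Sum>a<p.
        if run v p h a = Some i then ?g h a (run v p (rev h) j) else 0) i j"
      unfolding del by (intro step_cong Suc.IH)
    also have "\<dots> = (\<Sum>h\<in>words {..<k} (Suc t). \<Sum>a<p.
        if run v p h a = Some i then ?g (butlast h) a (run v p (rev h) j) else 0)"
      by (rule step_sum_words) simp
    finally show ?thesis unfolding del .
  qed
  let ?x = "step v p k (hub v p k q t) i j"
  let ?W = "win v 0 (Suc t)"
  \<comment> \<open>Only the full length \<open>Suc t\<close> can be a new overlap.\<close>
  have split: "overlaps v p h = overlaps v p (butlast h) + of_bool (Suc t < p \<and> h = ?W)"
    if "h \<in> words {..<k} (Suc t)" for h
  proof -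
    have "h \<noteq> []" "length h = Suc t" using that by (auto simp: words_def)
    then show ?thesis using overlaps_snoc[of v p "butlast h" "last h"] by simp
  qed
  have "(\<Sum>h\<in>words {..<k} (Suc t).
      if run v p h 0 = Some i \<and> run v p (rev h) j = Some q then overlaps v p h else 0)
    = ?x + (\<Sum>h\<in>words {..<k} (Suc t).
      of_bool (Suc t < p \<and> h = ?W \<and> run v p h 0 = Some i \<and> run v p (rev h) j = Some q))"
    unfolding s sum.distrib[symmetric] by (intro sum.cong refl) (simp add: split)
  also have "(\<Sum>h\<in>words {..<k} (Suc t).
      of_bool (Suc t < p \<and> h = ?W \<and> run v p h 0 = Some i \<and> run v p (rev h) j = Some q))
    = (of_bool (Suc t < p \<and> i = Suc t \<and> ?x \<noteq> 0) :: nat)"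
  proof (cases "Suc t < p")
    case True
    then have "set ?W \<subseteq> {..<k}" using assms(2) by (auto simp: win_def)
    then have W: "?W \<in> words {..<k} (Suc t)" "run v p ?W 0 = Some (Suc t)"
      using run_win[OF True] by (auto simp: words_def)
    have "(\<Sum>h\<in>words {..<k} (Suc t).
        of_bool (Suc t < p \<and> h = ?W \<and> run v p h 0 = Some i \<and> run v p (rev h) j = Some q))
      = (\<Sum>h\<in>words {..<k} (Suc t). if h = ?W then
        of_bool (i = Suc t \<and> run v p (rev ?W) j = Some q) else (0::nat))"
      using True W by (intro sum.cong refl) auto
    also have "\<dots> = of_bool (i = Suc t \<and> run v p (rev ?W) j = Some q)"
      using W by simp
    also have "\<dots> = of_bool (i = Suc t \<and> ?x \<noteq> 0)"
    proof (cases "i = Suc t")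
      case i: True
      have uniq: "h = ?W" if "h \<in> words {..<k} (Suc t)" "run v p h 0 = Some (Suc t)" for h
        using that run_0_full[of v p h] True by (simp add: words_def)
      have "?x = (\<Sum>h\<in>words {..<k} (Suc t). if h = ?W then
        (if run v p (rev ?W) j = Some q then overlaps v p (butlast ?W) else 0) else 0)"
        unfolding s
      proof (intro sum.cong refl)
        fix h assume h: "h \<in> words {..<k} (Suc t)"
        show "(if run v p h 0 = Some i \<and> run v p (rev h) j = Some q then overlaps v p (butlast h) else 0)
          = (if h = ?W then if run v p (rev ?W) j = Some q then overlaps v p (butlast ?W) else 0 else 0)"
        proof (cases "h = ?W")
          case True
          then show ?thesis using W(2) i by (simp only: simp_thms if_True)
        next
          case False
          with uniq[OF h] i have "run v p h 0 \<noteq> Some i" by blast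
          with False show ?thesis by (simp only: simp_thms if_False)
        qed
      qed
      also have "\<dots> = (if run v p (rev ?W) j = Some q then overlaps v p (butlast ?W) else 0)"
        using W by simp
      finally have x: "?x = (if run v p (rev ?W) j = Some q then overlaps v p (butlast ?W) else 0)" .
      \<comment> \<open>Length \<open>0\<close> always counts as an overlap, so weights are
        positive. This makes \<open>?x \<noteq> 0\<close> an exact test for whether the reversal of
        \<open>?W\<close> leads from \<open>j\<close> to \<open>q\<close>.\<close>
      have "0 < overlaps v p (butlast ?W)" using True by (intro overlaps_pos) simp
      then show ?thesis unfolding x using i by (simp del: win_snoc)
    qed simp
    finally show ?thesis using True by simp
  qed simp
  finally show ?case by (simp add: Let_def)
qed

text \<open>Cut \<open>w\<close> at the last visit of state \<open>0\<close>: from there on every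
  letter matches, so what follows is the prefix of \<open>v\<close> of length \<open>i\<close>. The
  second alternative is a run that never falls back.\<close>

lemma run_tail:
  "run v p w a = Some i \<Longrightarrow> (\<exists>u. w = u @ win v 0 i \<and> run v p u a = Some 0) \<or> i = a + length w"
proof (induction w arbitrary: i rule: rev_induct)
  case (snoc c h)
  then obtain j where j: "run v p h a = Some j" "v j \<le> c" "nxt v p j c = i"
    by (auto simp: run_snoc split: option.splits if_splits)
  show ?case
  proof (cases "i = 0")
    case True
    then show ?thesis using snoc.prems by (auto intro: exI[of _ "h @ [c]"])
  next
    case False
    then have "i = Suc j" "v j = c" using j by (auto simp: nxt_def split: if_splits)
    then show ?thesis using snoc.IH[OF j(1)] by (auto simp: win_snoc)
  qed
qed simp

text \<open>Every closed walk passes through state \<open>0\<close>. A walk that starts in state \<open>l\<close> becomes, after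
  rotating it back to its last visit of \<open>0\<close>, a walk from \<open>0\<close> that begins by reading the first
  \<open>l\<close> letters of \<open>v\<close>; this is why \<open>overlaps\<close> is the right weight.\<close>

lemma card_closed_at:
  assumes d: "duval v n p" and k: "\<And>l. l < p \<Longrightarrow> v l < k" and l: "l < p" and m: "0 < m"
  shows "card {u \<in> words {..<k} m. run v p u l = Some l \<and> closed v p (rev u)}
    = card {u \<in> words {..<k} m. run v p u 0 = Some 0 \<and> closed v p (rev u) \<and>
        l \<le> m \<and> take l u = win v 0 l}" (is "card ?A = card ?B")
proof -
  have "rotate l ` ?B = ?A"
  proof (intro equalityI subsetI)
    fix w assume "w \<in> rotate l ` ?B"
    then obtain u where u: "u \<in> ?B" "w = rotate l u" by blast
    define x where "x = drop l u"
    have ne: "u \<noteq> []" using u m by (auto simp: words_def)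
    have ux: "u = win v 0 l @ x" using u(1) unfolding x_def by (metis (mono_tags, lifting) append_take_drop_id mem_Collect_eq)
    then have "w = x @ win v 0 l" using u(2) rotate_append[of "win v 0 l" x] by simp
    moreover have "run v p x l = Some 0" using u(1) ux run_win[OF l] by (simp add: run_append)
    ultimately have "run v p w l = Some l" using run_win[OF l] by (simp add: run_append)
    then show "w \<in> ?A" using u closed_rev_rotate[OF d ne] by auto
  next
    fix w assume w: "w \<in> ?A"
    then have lw: "length w = m" "w \<noteq> []" using m by (auto simp: words_def)
    from w have cw: "closed v p (rev w)" "run v p w l = Some l" by simp_all
    \<comment> \<open>A closed run of positive length must fall back: otherwise its state would have
      grown from \<open>l\<close> to \<open>l + m\<close>.\<close>
    from cw(2) lw obtain u where u: "w = u @ win v 0 l" "run v p u l = Some 0"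
      using run_tail[of v p w l l] by auto
    let ?u = "win v 0 l @ u"
    have r: "w = rotate l ?u" using rotate_append[of "win v 0 l" u] u by simp
    have "run v p ?u 0 = Some 0" using run_win[OF l] u by (simp add: run_append)
    moreover have "?u \<noteq> []" using u(1) lw by auto
    then have "closed v p (rev ?u)" using cw(1) closed_rev_rotate[OF d, of ?u l] unfolding r by blast
    ultimately have "?u \<in> ?B" using w u lw by (auto simp: words_def)
    then show "w \<in> rotate l ` ?B" using r by blast
  qed
  moreover have "inj_on (rotate l) ?B"
  proof (rule inj_onI)
    fix x y :: "nat list" assume "rotate l x = rotate l y"
    then show "x = y" by (induction l) (auto simp: inj_eq[OF inj_rotate1])
  qed
  then have "card (rotate l ` ?B) = card ?B" by (rule card_image)
  ultimately show ?thesis by simp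
qed

text \<open>Summing over \<open>q\<close> turns closing states of the reversed word into the single
  condition \<open>closed v p (rev h)\<close>. The weight \<open>overlaps\<close> is then split into
  its lengths \<open>l\<close>, and each \<open>l\<close> accounts for the words whose forward run
  closes at state \<open>l\<close>.\<close>

lemma card_closed_both:
  assumes d: "duval v n p" and k: "\<And>l. l < p \<Longrightarrow> v l < k" and m: "0 < m"
  shows "card {u \<in> words {..<k} m. closed v p u \<and> closed v p (rev u)} = (\<Sum>q<p. hub v p k q m 0 q)"
proof -
  have L: "lyndon v p" and p: "0 < p" using d by (auto simp: duval_def lyndon_def)
  let ?C = "{u \<in> words {..<k} m. closed v p (rev u)}"
  have ne: "u \<noteq> []" if "u \<in> words {..<k} m" for u using that m by (auto simp: words_def)
  have q: "(\<Sum>q<p. of_bool (run v p (rev u) q = Some q) :: nat) = of_bool (closed v p (rev u))"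
    if "u \<in> words {..<k} m" for u
  proof -
    have "card {x \<in> {u}. closed v p (rev x)} = (\<Sum>q<p. of_bool (run v p (rev u) q = Some q))"
      using card_closed[OF L, of "{u}" rev] ne[OF that] by simp
    moreover have "{x \<in> {u}. closed v p (rev x)} = (if closed v p (rev u) then {u} else {})" by auto
    ultimately show ?thesis by (auto split: if_splits)
  qed
  have "(\<Sum>q<p. hub v p k q m 0 q) = (\<Sum>q<p. \<Sum>h\<in>words {..<k} m.
    if run v p h 0 = Some 0 \<and> run v p (rev h) q = Some q then overlaps v p h else 0)"
    using hub_eq[OF p k] by simp
  also have "\<dots> = (\<Sum>h\<in>words {..<k} m. \<Sum>q<p.
    if run v p h 0 = Some 0 \<and> run v p (rev h) q = Some q then overlaps v p h else 0)"
    by (rule sum.swap)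
  also have "\<dots> = (\<Sum>h\<in>words {..<k} m. of_bool (run v p h 0 = Some 0 \<and> closed v p (rev h)) * overlaps v p h)"
  proof (intro sum.cong refl)
    fix h assume h: "h \<in> words {..<k} m"
    have "(\<Sum>q<p. if run v p h 0 = Some 0 \<and> run v p (rev h) q = Some q then overlaps v p h else 0)
      = (\<Sum>q<p. of_bool (run v p h 0 = Some 0) * of_bool (run v p (rev h) q = Some q) * overlaps v p h)"
      by (intro sum.cong refl) auto
    also have "\<dots> = of_bool (run v p h 0 = Some 0) * of_bool (closed v p (rev h)) * overlaps v p h"
      unfolding q[OF h, symmetric] by (simp add: sum_distrib_left sum_distrib_right)
    finally show "(\<Sum>q<p. if run v p h 0 = Some 0 \<and> run v p (rev h) q = Some q then overlaps v p h else 0)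
      = of_bool (run v p h 0 = Some 0 \<and> closed v p (rev h)) * overlaps v p h" by simp
  qed
  also have "\<dots> = (\<Sum>h\<in>words {..<k} m. \<Sum>l<p.
      of_bool (run v p h 0 = Some 0 \<and> closed v p (rev h) \<and> l \<le> m \<and> take l h = win v 0 l))"
  proof (intro sum.cong refl)
    fix h assume h: "h \<in> words {..<k} m"
    have ov: "overlaps v p h = (\<Sum>l<p. of_bool (l \<le> m \<and> take l h = win v 0 l))"
      using h by (auto simp: overlaps_def words_def sum.If_cases of_bool_def Int_def intro!: arg_cong[of _ _ card])
    show "of_bool (run v p h 0 = Some 0 \<and> closed v p (rev h)) * overlaps v p h = (\<Sum>l<p.
      of_bool (run v p h 0 = Some 0 \<and> closed v p (rev h) \<and> l \<le> m \<and> take l h = win v 0 l))"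
      unfolding ov sum_distrib_left by (intro sum.cong refl) (simp add: of_bool_def)
  qed
  also have "\<dots> = (\<Sum>l<p. \<Sum>h\<in>words {..<k} m.
      of_bool (run v p h 0 = Some 0 \<and> closed v p (rev h) \<and> l \<le> m \<and> take l h = win v 0 l))"
    by (rule sum.swap)
  also have "\<dots> = (\<Sum>l<p. card {u \<in> words {..<k} m. run v p u 0 = Some 0 \<and> closed v p (rev u) \<and>
        l \<le> m \<and> take l u = win v 0 l})"
    by (simp add: sum.If_cases of_bool_def Int_def)
  also have "\<dots> = (\<Sum>l<p. card {u \<in> words {..<k} m. run v p u l = Some l \<and> closed v p (rev u)})"
    using card_closed_at[OF d k _ m] by (intro sum.cong refl) auto
  also have "\<dots> = (\<Sum>l<p. \<Sum>u\<in>?C. of_bool (run v p u l = Some l))"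
    by (intro sum.cong refl)
      (auto simp: sum.If_cases of_bool_def Int_def intro!: arg_cong[of _ _ card])
  also have "\<dots> = (\<Sum>u\<in>?C. \<Sum>l<p. of_bool (run v p u l = Some l))"
    by (rule sum.swap)
  also have "\<dots> = card {u \<in> ?C. closed v p u}"
    using card_closed[OF L, of ?C "\<lambda>u. u"] ne by simp
  also have "{u \<in> ?C. closed v p u} = {u \<in> words {..<k} m. closed v p u \<and> closed v p (rev u)}" by auto
  finally show ?thesis by simp
qed

subsection \<open>Reflections\<close>

text \<open>The axis of a reflection meets the cyclic word in gaps between letters or in letters. A pair of
  states consists of the state of the run that reads the word forwards and of the one that reads it
  backwards; by symmetry the two agree at a gap on the axis, and are one letter apart at a
  letter on the axis.\<close>

definition start_gap :: "nat \<Rightarrow> nat \<Rightarrow> nat" where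
  "start_gap i j = of_bool (i = j)"

text \<open>This is a number of letters and not a truth value, since all letters above
  \<open>v j\<close> lead from \<open>j\<close> to \<open>0\<close>.\<close>

definition start_letter :: "(nat \<Rightarrow> nat) \<Rightarrow> nat \<Rightarrow> nat \<Rightarrow> nat \<Rightarrow> nat \<Rightarrow> nat" where
  "start_letter v p k i j = (\<Sum>c<k. of_bool (v j \<le> c \<and> nxt v p j c = i))"

definition end_gap :: "nat \<Rightarrow> (nat \<Rightarrow> nat \<Rightarrow> nat) \<Rightarrow> nat" where
  "end_gap p w = (\<Sum>i<p. w i i)"

definition end_letter :: "(nat \<Rightarrow> nat) \<Rightarrow> nat \<Rightarrow> nat \<Rightarrow> (nat \<Rightarrow> nat \<Rightarrow> nat) \<Rightarrow> nat" where
  "end_letter v p k w = (\<Sum>i<p. \<Sum>c<k. if v i \<le> c then w i (nxt v p i c) else 0)"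

lemma sum_option_delta:
  fixes x :: "nat option"
  assumes "\<And>i. x = Some i \<Longrightarrow> i < p"
  shows "(\<Sum>i<p. if x = Some i then f i else 0) = (case x of None \<Rightarrow> 0 | Some i \<Rightarrow> f i)"
proof (cases x)
  case (Some i)
  then have "(\<Sum>i<p. if x = Some i then f i else 0) = (\<Sum>j<p. if j = i then f i else 0)"
    by (intro sum.cong refl) auto
  also have "\<dots> = f i" using assms[OF Some] by (simp add: sum.delta)
  finally show ?thesis using Some by simp
qed simp

text \<open>On the diagonal the state after \<open>h\<close> is the state in which
  \<open>rev h\<close> is started, so the forward and the backward run join to one run over
  \<open>h @ rev h\<close>.\<close>

lemma end_gap_step:
  "end_gap p ((step v p k ^^ m) w) = (\<Sum>h\<in>words {..<k} m. \<Sum>a<p.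
    case run v p (h @ rev h) a of None \<Rightarrow> 0 | Some b \<Rightarrow> w a b)"
proof -
  have "end_gap p ((step v p k ^^ m) w) = (\<Sum>i<p. \<Sum>h\<in>words {..<k} m. \<Sum>a<p.
    if run v p h a = Some i then case run v p (rev h) i of None \<Rightarrow> 0 | Some b \<Rightarrow> w a b else 0)"
    unfolding end_gap_def by (intro sum.cong refl step_power) simp
  also have "\<dots> = (\<Sum>h\<in>words {..<k} m. \<Sum>i<p. \<Sum>a<p.
    if run v p h a = Some i then case run v p (rev h) i of None \<Rightarrow> 0 | Some b \<Rightarrow> w a b else 0)"
    by (rule sum.swap)
  also have "\<dots> = (\<Sum>h\<in>words {..<k} m. \<Sum>a<p. \<Sum>i<p.
    if run v p h a = Some i then case run v p (rev h) i of None \<Rightarrow> 0 | Some b \<Rightarrow> w a b else 0)"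
    by (intro sum.cong refl sum.swap)
  also have "\<dots> = (\<Sum>h\<in>words {..<k} m. \<Sum>a<p. case run v p h a of None \<Rightarrow> 0 | Some i \<Rightarrow>
    case run v p (rev h) i of None \<Rightarrow> 0 | Some b \<Rightarrow> w a b)"
    by (intro sum.cong refl sum_option_delta) (auto dest: run_less)
  also have "\<dots> = (\<Sum>h\<in>words {..<k} m. \<Sum>a<p.
    case run v p (h @ rev h) a of None \<Rightarrow> 0 | Some b \<Rightarrow> w a b)"
    by (intro sum.cong refl) (auto simp: run_append split: option.splits)
  finally show ?thesis .
qed

lemma end_letter_step:
  "end_letter v p k ((step v p k ^^ m) w) = (\<Sum>h\<in>words {..<k} m. \<Sum>c<k. \<Sum>a<p.
    case run v p (h @ c # rev h) a of None \<Rightarrow> 0 | Some b \<Rightarrow> w a b)"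
proof -
  let ?F = "\<lambda>h a i c. if run v p h a = Some i then
    (if v i \<le> c then case run v p (rev h) (nxt v p i c) of None \<Rightarrow> 0 | Some b \<Rightarrow> w a b else 0) else 0"
  have "end_letter v p k ((step v p k ^^ m) w) = (\<Sum>i<p. \<Sum>c<k. \<Sum>h\<in>words {..<k} m. \<Sum>a<p. ?F h a i c)"
    unfolding end_letter_def by (intro sum.cong refl) (auto simp: step_power intro!: sum.cong)
  also have "\<dots> = (\<Sum>i<p. \<Sum>h\<in>words {..<k} m. \<Sum>c<k. \<Sum>a<p. ?F h a i c)"
    by (intro sum.cong refl sum.swap)
  also have "\<dots> = (\<Sum>h\<in>words {..<k} m. \<Sum>i<p. \<Sum>c<k. \<Sum>a<p. ?F h a i c)"
    by (rule sum.swap)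
  also have "\<dots> = (\<Sum>h\<in>words {..<k} m. \<Sum>c<k. \<Sum>i<p. \<Sum>a<p. ?F h a i c)"
    by (intro sum.cong refl sum.swap)
  also have "\<dots> = (\<Sum>h\<in>words {..<k} m. \<Sum>c<k. \<Sum>a<p. \<Sum>i<p. ?F h a i c)"
    by (intro sum.cong refl sum.swap)
  also have "\<dots> = (\<Sum>h\<in>words {..<k} m. \<Sum>c<k. \<Sum>a<p. case run v p h a of None \<Rightarrow> 0 | Some i \<Rightarrow>
    if v i \<le> c then case run v p (rev h) (nxt v p i c) of None \<Rightarrow> 0 | Some b \<Rightarrow> w a b else 0)"
    by (intro sum.cong refl sum_option_delta) (auto dest: run_less)
  also have "\<dots> = (\<Sum>h\<in>words {..<k} m. \<Sum>c<k. \<Sum>a<p.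
    case run v p (h @ c # rev h) a of None \<Rightarrow> 0 | Some b \<Rightarrow> w a b)"
    by (intro sum.cong refl) (auto simp: run_append split: option.splits)
  finally show ?thesis .
qed

lemma palindrome_even:
  assumes "length w = 2 * m"
  shows "rev w = w \<longleftrightarrow> w = take m w @ rev (take m w)"
proof
  assume r: "rev w = w"
  have "take m w @ drop m w = rev (take m w @ drop m w)"
    by (simp only: append_take_drop_id r)
  then have "take m w @ drop m w = rev (drop m w) @ rev (take m w)"
    unfolding rev_append .
  moreover have "length (take m w) = length (rev (drop m w))" using assms by simp
  ultimately have "drop m w = rev (take m w)" by (metis append_eq_append_conv)
  then show "w = take m w @ rev (take m w)" by (metis append_take_drop_id)
next
  assume *: "w = take m w @ rev (take m w)"
  have "rev (take m w @ rev (take m w)) = take m w @ rev (take m w)" by simp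
  then show "rev w = w" unfolding *[symmetric] .
qed

lemma palindrome_odd:
  assumes "length w = Suc (2 * m)"
  shows "rev w = w \<longleftrightarrow> w = take m w @ w ! m # rev (take m w)"
proof
  assume r: "rev w = w"
  have w: "w = take m w @ w ! m # drop (Suc m) w" using assms by (simp add: id_take_nth_drop)
  have "rev (take m w @ w ! m # drop (Suc m) w) = rev (drop (Suc m) w) @ w ! m # rev (take m w)"
    by simp
  then have "rev w = rev (drop (Suc m) w) @ w ! m # rev (take m w)"
    unfolding w[symmetric] .
  with w r have "take m w @ w ! m # drop (Suc m) w = rev (drop (Suc m) w) @ w ! m # rev (take m w)"
    by (rule_tac trans[OF sym trans[OF sym]])
  moreover have "length (take m w) = length (rev (drop (Suc m) w))" using assms by simp
  ultimately have "w ! m # drop (Suc m) w = w ! m # rev (take m w)" by (metis append_eq_append_conv)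
  then have "drop (Suc m) w = rev (take m w)" by simp
  with w show "w = take m w @ w ! m # rev (take m w)" by (simp only:)
next
  assume *: "w = take m w @ w ! m # rev (take m w)"
  have "rev (take m w @ w ! m # rev (take m w)) = take m w @ w ! m # rev (take m w)" by simp
  then show "rev w = w" unfolding *[symmetric] .
qed

lemma take_words: "w \<in> words \<Sigma> n \<Longrightarrow> m \<le> n \<Longrightarrow> take m w \<in> words \<Sigma> m"
  by (auto simp: words_def dest: in_set_takeD)

lemma nth_words: "w \<in> words \<Sigma> n \<Longrightarrow> i < n \<Longrightarrow> w ! i \<in> \<Sigma>"
  by (auto simp: words_def)

text \<open>The axis meets the cyclic word in the gap at the end of \<open>h\<close> and in the gap
  where the word closes up. The latter demands equal first and last states, which is the initial
  weight \<open>start_gap\<close>.\<close>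

lemma card_reflected_gap_gap:
  assumes d: "duval v (2 * m) p"
  shows "card (reflected v p k (2 * m) 0) = end_gap p ((step v p k ^^ m) start_gap)"
proof -
  have L: "lyndon v p" and m: "0 < m" using d by (auto simp: duval_def lyndon_def)
  let ?f = "\<lambda>h. h @ rev h"
  let ?H = "{h \<in> words {..<k} m. closed v p (?f h)}"
  have "reflected v p k (2 * m) 0 = ?f ` ?H"
  proof (intro equalityI subsetI)
    fix w assume "w \<in> reflected v p k (2 * m) 0"
    then have w: "w \<in> words {..<k} (2 * m)" "closed v p w" "w = ?f (take m w)"
      using palindrome_even[of w m] by (auto simp: reflected_def words_def)
    moreover have "take m w \<in> words {..<k} m" using take_words[OF w(1)] by simp
    ultimately show "w \<in> ?f ` ?H" by (metis (mono_tags, lifting) mem_Collect_eq rev_image_eqI)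
  qed (auto simp: reflected_def words_def)
  moreover have "inj_on ?f ?H" by (auto simp: inj_on_def words_def)
  ultimately have "card (reflected v p k (2 * m) 0) = card ?H" by (simp add: card_image)
  also have "\<dots> = (\<Sum>h\<in>words {..<k} m. \<Sum>a<p. of_bool (run v p (?f h) a = Some a))"
    using m by (intro card_closed[OF L]) (simp, force simp: words_def)
  also have "\<dots> = end_gap p ((step v p k ^^ m) start_gap)"
    unfolding end_gap_step
    by (intro sum.cong refl) (auto simp: start_gap_def split: option.splits)
  finally show ?thesis .
qed

lemma card_reflected_gap_letter:
  assumes d: "duval v (Suc (2 * m)) p"
  shows "card (reflected v p k (Suc (2 * m)) 0) = end_letter v p k ((step v p k ^^ m) start_gap)"
proof -
  have L: "lyndon v p" using d by (auto simp: duval_def lyndon_def)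
  let ?f = "\<lambda>(h, c). h @ c # rev h"
  let ?A = "words {..<k} m \<times> {..<k}"
  let ?H = "{x \<in> ?A. closed v p (?f x)}"
  have "reflected v p k (Suc (2 * m)) 0 = ?f ` ?H"
  proof (intro equalityI subsetI)
    fix w assume "w \<in> reflected v p k (Suc (2 * m)) 0"
    then have w: "w \<in> words {..<k} (Suc (2 * m))" "closed v p w" "w = ?f (take m w, w ! m)"
      using palindrome_odd[of w m] by (auto simp: reflected_def words_def)
    moreover have "take m w \<in> words {..<k} m" using take_words[OF w(1)] by simp
    moreover have "w ! m \<in> {..<k}" using nth_words[OF w(1)] by simp
    ultimately have "(take m w, w ! m) \<in> ?H" by (metis (mono_tags, lifting) mem_Collect_eq mem_Sigma_iff)
    with w(3) show "w \<in> ?f ` ?H" by (rule image_eqI)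
  qed (auto simp: reflected_def words_def)
  moreover have "inj_on ?f ?H" by (auto simp: inj_on_def words_def)
  ultimately have "card (reflected v p k (Suc (2 * m)) 0) = card ?H" by (simp add: card_image)
  also have "\<dots> = (\<Sum>x\<in>?A. \<Sum>a<p. of_bool (run v p (?f x) a = Some a))"
    by (intro card_closed[OF L]) auto
  also have "\<dots> = (\<Sum>h\<in>words {..<k} m. \<Sum>c<k. \<Sum>a<p. of_bool (run v p (h @ c # rev h) a = Some a))"
    by (simp add: sum.cartesian_product case_prod_unfold)
  also have "\<dots> = end_letter v p k ((step v p k ^^ m) start_gap)"
    unfolding end_letter_step
    by (intro sum.cong refl) (auto simp: start_gap_def split: option.splits)
  finally show ?thesis .
qed

text \<open>\<open>rotate 1 \<circ> rev\<close> fixes the last letter and reverses the rest, which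
  must thus be a palindrome of odd length. The axis passes through its middle letter and the last
  letter; the last letter leads from the final state back to the first one and becomes part of the
  initial weight.\<close>

lemma card_reflected_letter_letter:
  assumes d: "duval v (2 * Suc m) p"
  shows "card (reflected v p k (2 * Suc m) 1)
    = end_letter v p k ((step v p k ^^ m) (start_letter v p k))"
proof -
  have L: "lyndon v p" using d by (auto simp: duval_def lyndon_def)
  let ?f = "\<lambda>(h, c, c'). (h @ c # rev h) @ [c']"
  let ?A = "words {..<k} m \<times> {..<k} \<times> {..<k}"
  let ?H = "{x \<in> ?A. closed v p (?f x)}"
  have rot: "rotate 1 (rev (y @ [c])) = rev y @ [c]" for y and c :: nat by simp
  have "reflected v p k (2 * Suc m) 1 = ?f ` ?H"
  proof (intro equalityI subsetI)
    fix w assume w: "w \<in> reflected v p k (2 * Suc m) 1"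
    then have "w \<noteq> []" by (auto simp: reflected_def words_def)
    then obtain y c' where y: "w = y @ [c']" by (metis append_butlast_last_id)
    have ly: "y \<in> words {..<k} (Suc (2 * m))" "c' < k" "closed v p w" "rev y = y"
      using w rot[of y c'] by (auto simp: reflected_def words_def y simp del: rotate1.simps)
    then have "y = take m y @ y ! m # rev (take m y)"
      using palindrome_odd[of y m] by (auto simp: words_def)
    then have wf: "w = ?f (take m y, y ! m, c')" using y by simp
    moreover have "take m y \<in> words {..<k} m" using take_words[OF ly(1)] by simp
    moreover have "y ! m \<in> {..<k}" using nth_words[OF ly(1)] by simp
    ultimately have "(take m y, y ! m, c') \<in> ?H" using ly by simp
    with wf show "w \<in> ?f ` ?H" by (rule image_eqI)
  next
    fix w assume "w \<in> ?f ` ?H"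
    then obtain h c c' where w: "w = (h @ c # rev h) @ [c']" "h \<in> words {..<k} m" "c < k" "c' < k" "closed v p w"
      by auto
    have "rotate 1 (rev w) = w" unfolding w(1) rot by simp
    then show "w \<in> reflected v p k (2 * Suc m) 1" using w by (auto simp: reflected_def words_def)
  qed
  moreover have "inj_on ?f ?H" by (auto simp: inj_on_def words_def)
  ultimately have "card (reflected v p k (2 * Suc m) 1) = card ?H" by (simp add: card_image)
  also have "\<dots> = (\<Sum>x\<in>?A. \<Sum>a<p. of_bool (run v p (?f x) a = Some a))"
    by (intro card_closed[OF L]) auto
  also have "\<dots> = (\<Sum>h\<in>words {..<k} m. \<Sum>c<k. \<Sum>c'<k. \<Sum>a<p.
      of_bool (run v p ((h @ c # rev h) @ [c']) a = Some a))"
    by (simp add: sum.cartesian_product case_prod_unfold)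
  also have "\<dots> = (\<Sum>h\<in>words {..<k} m. \<Sum>c<k. \<Sum>a<p. \<Sum>c'<k.
      of_bool (run v p ((h @ c # rev h) @ [c']) a = Some a))"
    by (intro sum.cong refl sum.swap)
  also have "\<dots> = end_letter v p k ((step v p k ^^ m) (start_letter v p k))"
    unfolding end_letter_step
    by (intro sum.cong refl)
      (auto simp: start_letter_def run_append split: option.splits intro!: arg_cong[of _ _ card])
  finally show ?thesis .
qed

section \<open>The Burnside sum as an expression in tables\<close>

definition fixed_sum :: "(nat \<Rightarrow> nat) \<Rightarrow> nat \<Rightarrow> nat \<Rightarrow> nat" where
  "fixed_sum v n k =
    (let G = {w \<in> words {..<k} n. \<forall>r. win v 0 n \<le> rotate r w \<and> win v 0 n \<le> rotate r (rev w)}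
     in (\<Sum>r<n. card {w \<in> G. rotate r w = w}) + (\<Sum>r<n. card {w \<in> G. rotate r (rev w) = w}))"

lemma fixed_sum_eq:
  assumes d: "duval v n p" and k: "\<And>l. l < n \<Longrightarrow> v l < k"
  shows "fixed_sum v n k = (\<Sum>r<n. \<Sum>q<p. hub v p k q (gcd (Suc r) n) 0 q) +
    (if odd n then n * end_letter v p k ((step v p k ^^ (n div 2)) start_gap)
     else n div 2 * (end_gap p ((step v p k ^^ (n div 2)) start_gap) +
        end_letter v p k ((step v p k ^^ (n div 2 - 1)) (start_letter v p k))))"
proof -
  have n: "0 < n" and pn: "p \<le> n" using d by (auto simp: duval_def lyndon_def)
  define G where "G = {w \<in> words {..<k} n. \<forall>r. win v 0 n \<le> rotate r w \<and> win v 0 n \<le> rotate r (rev w)}"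
  have G: "G = {w \<in> words {..<k} n. closed v p w \<and> closed v p (rev w)}"
    unfolding G_def by (auto simp: closed_iff_rotations[OF d] words_def)
  \<comment> \<open>The identity is replaced by the rotation by \<open>n\<close>, so that all
    indices are positive, as \<open>card_rotate_fixed\<close> requires.\<close>
  have "(\<Sum>r<n. card {w \<in> G. rotate r w = w}) = (\<Sum>r<n. card {w \<in> G. rotate (Suc r) w = w})"
  proof -
    have "rotate n w = w" if "w \<in> G" for w using that by (auto simp: G_def words_def)
    then have "{w \<in> G. rotate n w = w} = {w \<in> G. rotate 0 w = w}" by auto
    then have "card {w \<in> G. rotate n w = w} = card {w \<in> G. rotate 0 w = w}" by simp
    then show ?thesis
      using sum.lessThan_Suc[of "\<lambda>r. card {w \<in> G. rotate r w = w}" n]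
        sum.lessThan_Suc_shift[of "\<lambda>r. card {w \<in> G. rotate r w = w}" n] by linarith
  qed
  also have "\<dots> = (\<Sum>r<n. \<Sum>q<p. hub v p k q (gcd (Suc r) n) 0 q)"
  proof (intro sum.cong refl)
    fix r
    have "card {w \<in> G. rotate (Suc r) w = w}
      = card {u \<in> words {..<k} (gcd (Suc r) n). closed v p u \<and> closed v p (rev u)}"
      using card_rotate_fixed[OF d, of "Suc r" k] by (simp add: G conj_assoc del: rotate_Suc)
    also have "\<dots> = (\<Sum>q<p. hub v p k q (gcd (Suc r) n) 0 q)"
      using k pn by (intro card_closed_both[OF d]) (auto simp: gcd_pos_nat)
    finally show "card {w \<in> G. rotate (Suc r) w = w} = (\<Sum>q<p. hub v p k q (gcd (Suc r) n) 0 q)" .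
  qed
  finally have rot: "(\<Sum>r<n. card {w \<in> G. rotate r w = w})
    = (\<Sum>r<n. \<Sum>q<p. hub v p k q (gcd (Suc r) n) 0 q)" .
  have ref: "{w \<in> G. rotate r (rev w) = w} = reflected v p k n r" for r
  proof -
    \<comment> \<open>A word fixed by a reflection is a rotation of its reversal, so goodness in one
      reading direction gives the other.\<close>
    have "closed v p (rev w)" if "rotate r (rev w) = w" "closed v p w" "w \<in> words {..<k} n" for w
    proof -
      have "rev w \<noteq> []" using that n by (auto simp: words_def)
      then show ?thesis using closed_rotate[OF d, of "rev w" r] that by simp
    qed
    then show ?thesis by (auto simp: G reflected_def)
  qed
  have "(\<Sum>r<n. card (reflected v p k n r)) = (if odd n
     then n * end_letter v p k ((step v p k ^^ (n div 2)) start_gap)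
     else n div 2 * (end_gap p ((step v p k ^^ (n div 2)) start_gap) +
        end_letter v p k ((step v p k ^^ (n div 2 - 1)) (start_letter v p k))))"
  proof (cases "odd n")
    case True
    then obtain m where m: "n = Suc (2 * m)" by (auto elim: oddE)
    show ?thesis using sum_card_reflected_odd[OF d True, of k] card_reflected_gap_letter[of v m p k] d
      unfolding m by simp
  next
    case False
    then obtain m' where "n = 2 * m'" by auto
    with n obtain m where m: "n = 2 * Suc m" by (cases m') auto
    show ?thesis using sum_card_reflected_even[of v "Suc m" p k] card_reflected_gap_gap[of v "Suc m" p k]
        card_reflected_letter_letter[of v m p k] d
      unfolding m by (simp del: mult_Suc_right funpow.simps)
  qed
  then show ?thesis unfolding fixed_sum_def G_def[symmetric] Let_def rot ref by simp
qed

section \<open>Orbits under the dihedral group\<close>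

definition dih :: "nat \<times> bool \<Rightarrow> 'a list \<Rightarrow> 'a list" where
  "dih g w = rotate (fst g) (if snd g then rev w else w)"

text \<open>Group elements are pairs, not permutations of words. For \<open>n \<le> 2\<close>
  different pairs act alike, but with \<open>2 * n\<close> pairs the counting formula is the same
  for every positive \<open>n\<close>.\<close>

definition dih_group :: "nat \<Rightarrow> (nat \<times> bool) set" where
  "dih_group n = {..<n} \<times> UNIV"

definition dih_mult :: "nat \<Rightarrow> nat \<times> bool \<Rightarrow> nat \<times> bool \<Rightarrow> nat \<times> bool" where
  "dih_mult n g h = ((fst g + (if snd g then n - fst h else fst h)) mod n, snd g \<noteq> snd h)"

lemma finite_dih_group[simp]: "finite (dih_group n)"
  and card_dih_group[simp]: "card (dih_group n) = 2 * n"
  by (auto simp: dih_group_def)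

lemma rev_rotate: "s < length u \<Longrightarrow> rev (rotate s u) = rotate (length u - s) (rev u)"
  by (cases "s = 0") (simp_all add: rotate_rev)

lemma dih_mult:
  assumes "length w = n" "g \<in> dih_group n" "h \<in> dih_group n"
  shows "dih (dih_mult n g h) w = dih g (dih h w)"
proof -
  have r: "rotate (a mod n) u = rotate a u" if "length u = n" for a and u :: "'a list"
    using that rotate_conv_mod by metis
  show ?thesis
    using assms by (auto simp: dih_def dih_mult_def dih_group_def r rotate_rotate rev_rotate)
qed

lemma inj_on_dih_mult: "inj_on (dih_mult n g) (dih_group n)"
proof -
  \<comment> \<open>The bounds are relative because the inverse rotations \<open>n - fst h\<close>
    range over \<open>{1..n}\<close> instead of \<open>{0..<n}\<close>.\<close>
  have eq: "x = y" if "(a + x) mod n = (a + y) mod n" "x \<le> y" "y < x + n" for a x y :: nat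
  proof -
    have "n dvd (a + y) - (a + x)" using that mod_eq_dvd_iff_nat[of "a + x" "a + y" n] by simp
    then have "n dvd y - x" by simp
    moreover have "y - x < n" using that by simp
    ultimately show ?thesis using that(2) by (metis dvd_imp_mod_0 mod_less diff_is_0_eq antisym)
  qed
  have eq2: "x = y" if "(a + x) mod n = (a + y) mod n" "x < y + n" "y < x + n" for a x y :: nat
    using eq[of a x y] eq[of a y x] that by (metis nle_le)
  show ?thesis
  proof (rule inj_onI)
    fix h h' assume h: "h \<in> dih_group n" "h' \<in> dih_group n" "dih_mult n g h = dih_mult n g h'"
    then have lt: "fst h < n" "fst h' < n" by (auto simp: dih_group_def)
    have "(fst g + (if snd g then n - fst h else fst h)) mod n
      = (fst g + (if snd g then n - fst h' else fst h')) mod n"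
      using h(3) unfolding dih_mult_def prod.inject by blast
    then have "(if snd g then n - fst h else fst h) = (if snd g then n - fst h' else fst h')"
      by (rule eq2) (use lt in auto)
    then have "fst h = fst h'" using lt by (auto split: if_splits)
    then show "h = h'" using h by (auto simp: dih_mult_def prod_eq_iff)
  qed
qed

lemma dih_mult_mem: "g \<in> dih_group n \<Longrightarrow> dih_mult n g h \<in> dih_group n"
  by (auto simp: dih_group_def dih_mult_def)

definition orbit :: "nat \<Rightarrow> 'a list \<Rightarrow> 'a list set" where
  "orbit n w = (\<lambda>g. dih g w) ` dih_group n"

lemma bracelet_class:
  assumes "w \<in> words \<Sigma> n" "0 < n"
  shows "bracelet_rel \<Sigma> n `` {w} = orbit n w"
proof (intro equalityI subsetI)
  fix u assume "u \<in> bracelet_rel \<Sigma> n `` {w}"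
  then obtain r where "u = rotate r w \<or> u = rotate r (rev w)" by (auto simp: bracelet_rel_def)
  then have "u = dih (r mod n, False) w \<or> u = dih (r mod n, True) w"
    using assms rotate_conv_mod[of r w] rotate_conv_mod[of r "rev w"] by (auto simp: dih_def words_def)
  then show "u \<in> orbit n w" using assms by (auto simp: orbit_def dih_group_def)
next
  fix u assume "u \<in> orbit n w"
  then show "u \<in> bracelet_rel \<Sigma> n `` {w}"
    using assms by (auto simp: orbit_def dih_group_def dih_def bracelet_rel_def split: if_splits)
qed

lemma dih_words: "w \<in> words \<Sigma> n \<Longrightarrow> dih g w \<in> words \<Sigma> n"
  by (auto simp: dih_def)

lemma orbit_self: "0 < n \<Longrightarrow> w \<in> orbit n w"
  unfolding orbit_def by (rule image_eqI[of _ _ "(0, False)"]) (auto simp: dih_def dih_group_def)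

definition stab :: "nat \<Rightarrow> 'a list \<Rightarrow> nat" where
  "stab n w = card {g \<in> dih_group n. dih g w = w}"

text \<open>Left multiplication by \<open>g\<close> embeds the fibre over \<open>x\<close> into the
  fibre over \<open>y\<close>. Used in both directions, it shows that all fibres over an orbit are
  as large as the stabiliser.\<close>

lemma card_fibre_le:
  assumes "length w = n" "length x = n" "g \<in> dih_group n" "dih g x = y"
  shows "card {h \<in> dih_group n. dih h w = x} \<le> card {h \<in> dih_group n. dih h w = y}"
proof (rule card_inj_on_le)
  show "inj_on (dih_mult n g) {h \<in> dih_group n. dih h w = x}"
    by (rule inj_on_subset[OF inj_on_dih_mult]) auto
  show "dih_mult n g ` {h \<in> dih_group n. dih h w = x} \<subseteq> {h \<in> dih_group n. dih h w = y}"
    using assms by (auto simp: dih_mult dih_mult_mem)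
qed simp

lemma orbit_stab:
  assumes w: "w \<in> words \<Sigma> n" and n: "0 < n"
  shows "card (orbit n w) * stab n w = 2 * n"
proof -
  have len: "length x = n" if "x \<in> orbit n w" for x
    using that w dih_words[OF w] by (auto simp: orbit_def words_def)
  have self: "w \<in> orbit n w" using n by (rule orbit_self)
  have eq: "card {h \<in> dih_group n. dih h w = x} = stab n w" if x: "x \<in> orbit n w" for x
  proof -
    from x obtain g where g: "g \<in> dih_group n" "dih g w = x" by (auto simp: orbit_def)
    have "(w, x) \<in> bracelet_rel \<Sigma> n" using x bracelet_class[OF w n] by auto
    then have "(x, w) \<in> bracelet_rel \<Sigma> n" using equiv_bracelet_rel by (meson equivE symE)
    moreover from this have xw: "x \<in> words \<Sigma> n" by (auto simp: bracelet_rel_def)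
    ultimately have "w \<in> orbit n x" using bracelet_class[OF xw n] by auto
    then obtain g' where g': "g' \<in> dih_group n" "dih g' x = w" by (auto simp: orbit_def)
    show ?thesis
      using card_fibre_le[OF len[OF self] len[OF self] g] card_fibre_le[OF len[OF self] len[OF x] g']
      by (simp add: stab_def)
  qed
  have "2 * n = (\<Sum>x\<in>orbit n w. card {h \<in> dih_group n. dih h w = x})"
    using sum.image_gen[of "dih_group n" "\<lambda>_. 1::nat" "\<lambda>g. dih g w"] by (simp add: orbit_def)
  also have "\<dots> = card (orbit n w) * stab n w" using eq by simp
  finally show ?thesis by simp
qed

lemma sum_stab_orbit:
  assumes w: "w \<in> words \<Sigma> n" and n: "0 < n"
  shows "(\<Sum>x\<in>orbit n w. stab n x) = 2 * n"
proof -
  have ne: "orbit n w \<noteq> {}" using n by (auto simp: orbit_def dih_group_def)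
  have fin: "finite (orbit n w)" by (simp add: orbit_def)
  have "card (orbit n w) * stab n x = 2 * n" if x: "x \<in> orbit n w" for x
  proof -
    have "(w, x) \<in> bracelet_rel \<Sigma> n" using x bracelet_class[OF w n] by auto
    then have eq: "bracelet_rel \<Sigma> n `` {w} = bracelet_rel \<Sigma> n `` {x}" and xw: "x \<in> words \<Sigma> n"
      by (rule equiv_class_eq[OF equiv_bracelet_rel], auto simp: bracelet_rel_def)
    from eq have "orbit n w = orbit n x" unfolding bracelet_class[OF w n] bracelet_class[OF xw n] .
    then show ?thesis using orbit_stab[OF xw n] by simp
  qed
  then have "card (orbit n w) * (\<Sum>x\<in>orbit n w. stab n x) = card (orbit n w) * (2 * n)"
    by (simp add: sum_distrib_left)
  then show ?thesis using ne fin by auto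
qed

text \<open>Double counting of the pairs with \<open>dih g w = w\<close> gives the sum of all
  stabiliser sizes over \<open>X\<close>. As \<open>X\<close> is a disjoint union of bracelets, each
  of them contributes \<open>2 * n\<close>.\<close>

lemma burnside:
  assumes fin: "finite \<Sigma>" and n: "0 < n" and X: "X \<subseteq> words \<Sigma> n" "\<And>w. w \<in> X \<Longrightarrow> orbit n w \<subseteq> X"
  shows "(\<Sum>g\<in>dih_group n. card {w \<in> X. dih g w = w}) = 2 * n * card {B \<in> bracelets \<Sigma> n. B \<subseteq> X}"
proof -
  let ?C = "{B \<in> bracelets \<Sigma> n. B \<subseteq> X}"
  have finX: "finite X" using finite_subset[OF X(1)] fin by simp
  have B: "B \<in> bracelets \<Sigma> n \<longleftrightarrow> (\<exists>w\<in>words \<Sigma> n. B = orbit n w)" for B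
    unfolding bracelets_def quotient_def using bracelet_class[OF _ n] by blast
  have cov: "X = \<Union>?C"
  proof (intro equalityI subsetI)
    fix w assume w: "w \<in> X"
    then have ww: "w \<in> words \<Sigma> n" using X by blast
    have "w \<in> orbit n w" using n by (rule orbit_self)
    then show "w \<in> \<Union>?C" using X(2)[OF w] B ww by blast
  qed auto
  have "(\<Sum>g\<in>dih_group n. card {w \<in> X. dih g w = w})
    = (\<Sum>g\<in>dih_group n. \<Sum>w\<in>X. of_bool (dih g w = w))"
    using finX by (simp add: sum.If_cases of_bool_def Int_def)
  also have "\<dots> = (\<Sum>w\<in>X. \<Sum>g\<in>dih_group n. of_bool (dih g w = w))" by (rule sum.swap)
  also have "\<dots> = (\<Sum>w\<in>X. stab n w)"
    by (simp add: stab_def sum.If_cases of_bool_def Int_def)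
  also have "\<dots> = (\<Sum>B\<in>?C. \<Sum>w\<in>B. stab n w)"
  proof -
    have "sum (stab n) (\<Union>?C) = (sum \<circ> sum) (stab n) ?C"
    proof (rule sum.Union_disjoint)
      show "\<forall>A\<in>?C. finite A" using finX finite_subset by auto
      show "\<forall>A\<in>?C. \<forall>B\<in>?C. A \<noteq> B \<longrightarrow> A \<inter> B = {}"
        using quotient_disj[OF equiv_bracelet_rel] unfolding bracelets_def by blast
    qed
    then show ?thesis using cov by simp
  qed
  also have "\<dots> = (\<Sum>B\<in>?C. 2 * n)"
    by (intro sum.cong refl) (use B sum_stab_orbit n in auto)
  finally show ?thesis by simp
qed

section \<open>From orbit counts to the rank\<close>

lemma dih_ge_iff:
  assumes "length w = n" "0 < n"
  shows "(\<forall>u\<in>orbit n w. P u) \<longleftrightarrow> (\<forall>r. P (rotate r w) \<and> P (rotate r (rev w)))"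
proof -
  have "w \<in> words UNIV n" using assms by (simp add: words_def)
  then have "orbit n w = bracelet_rel UNIV n `` {w}" using assms(2) by (simp only: bracelet_class)
  also have "\<dots> = {u. \<exists>r. u = rotate r w \<or> u = rotate r (rev w)}"
    using assms by (auto simp: bracelet_rel_def words_def)
  finally have "orbit n w = {u. \<exists>r. u = rotate r w \<or> u = rotate r (rev w)}" .
  then show ?thesis by auto
qed

text \<open>A bracelet lies in \<open>?X\<close> iff its representative is not below
  \<open>v\<close>, so Burnside for \<open>?X\<close> and for all words counts the complement and
  the total. The equation is additive to avoid truncated subtraction. The crude second bound later
  limits the number of binary digits of the rank.\<close>

lemma RB_burnside:
  fixes v :: "'a::linorder list"
  assumes fin: "finite \<Sigma>" and n: "0 < n" and v: "v \<in> words \<Sigma> n"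
  shows "2 * n * RB \<Sigma> v
      + (\<Sum>g\<in>dih_group n. card {w \<in> words \<Sigma> n. (\<forall>u\<in>orbit n w. v \<le> u) \<and> dih g w = w})
    = (\<Sum>g\<in>dih_group n. card {w \<in> words \<Sigma> n. dih g w = w})"
    and "RB \<Sigma> v \<le> card (words \<Sigma> n)"
proof -
  let ?X = "{w \<in> words \<Sigma> n. \<forall>u\<in>orbit n w. v \<le> u}"
  have orb: "orbit n w = bracelet_rel \<Sigma> n `` {w}" if "w \<in> words \<Sigma> n" for w
    using bracelet_class[OF that n] by simp
  have orbX: "orbit n u = orbit n w" "u \<in> words \<Sigma> n" if "w \<in> words \<Sigma> n" "u \<in> orbit n w" for u w
  proof -
    have "(w, u) \<in> bracelet_rel \<Sigma> n" using that orb by auto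
    then show "u \<in> words \<Sigma> n" by (auto simp: bracelet_rel_def)
    with \<open>(w, u) \<in> _\<close> show "orbit n u = orbit n w"
      using orb that(1) equiv_class_eq[OF equiv_bracelet_rel] by metis
  qed
  have inX: "orbit n w \<subseteq> ?X" if "w \<in> ?X" for w
  proof
    fix u assume u: "u \<in> orbit n w"
    from that have w: "w \<in> words \<Sigma> n" by simp
    from that show "u \<in> ?X" using orbX[OF w u] by simp
  qed
  have br: "bracelets \<Sigma> n = orbit n ` words \<Sigma> n"
    unfolding bracelets_def quotient_def using orb by auto
  have finb: "finite (bracelets \<Sigma> n)" using fin by (simp add: br)
  have sub: "B \<subseteq> words \<Sigma> n" if "B \<in> bracelets \<Sigma> n" for B
    using that orbX(2) by (auto simp: br)
  have e1: "{B \<in> bracelets \<Sigma> n. B \<subseteq> ?X} = {B \<in> bracelets \<Sigma> n. \<not> representative B < v}"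
  proof (rule Collect_cong, rule conj_cong[OF refl])
    fix B assume "B \<in> bracelets \<Sigma> n"
    then obtain w where w: "w \<in> words \<Sigma> n" "B = orbit n w" by (auto simp: br)
    have fb: "finite B" "B \<noteq> {}" using w n by (auto simp: orbit_def dih_group_def)
    have "B \<subseteq> ?X \<longleftrightarrow> (\<forall>u\<in>B. v \<le> u)"
      using orbX[OF w(1)] w fb by auto
    also have "\<dots> \<longleftrightarrow> \<not> representative B < v"
      using fb by (simp add: representative_def not_less)
    finally show "B \<subseteq> ?X \<longleftrightarrow> \<not> representative B < v" .
  qed
  have e2: "card {B \<in> bracelets \<Sigma> n. representative B < v} + card {B \<in> bracelets \<Sigma> n. \<not> representative B < v}
    = card (bracelets \<Sigma> n)"
    by (subst card_Un_disjoint[symmetric]) (use finb in \<open>auto intro: arg_cong[of _ _ card]\<close>)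
  have e3: "{B \<in> bracelets \<Sigma> n. B \<subseteq> words \<Sigma> n} = bracelets \<Sigma> n" using sub by auto
  have e4: "RB \<Sigma> v = card {B \<in> bracelets \<Sigma> n. representative B < v}"
    using v by (simp add: RB_def words_def)
  have e5: "(\<Sum>g\<in>dih_group n. card {w \<in> words \<Sigma> n. dih g w = w})
      = 2 * n * card {B \<in> bracelets \<Sigma> n. B \<subseteq> words \<Sigma> n}"
    by (rule burnside[OF fin n order_refl]) (use orbX(2) in blast)
  have e6: "(\<Sum>g\<in>dih_group n. card {w \<in> ?X. dih g w = w}) = 2 * n * card {B \<in> bracelets \<Sigma> n. B \<subseteq> ?X}"
    by (rule burnside[OF fin n _ inX]) auto
  have e7: "{w \<in> ?X. dih g w = w} = {w \<in> words \<Sigma> n. (\<forall>u\<in>orbit n w. v \<le> u) \<and> dih g w = w}" for g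
    by auto
  have "2 * n * RB \<Sigma> v + 2 * n * card {B \<in> bracelets \<Sigma> n. \<not> representative B < v}
      = 2 * n * card (bracelets \<Sigma> n)"
    unfolding e4 e2[symmetric] by (simp only: add_mult_distrib2)
  then show "2 * n * RB \<Sigma> v
      + (\<Sum>g\<in>dih_group n. card {w \<in> words \<Sigma> n. (\<forall>u\<in>orbit n w. v \<le> u) \<and> dih g w = w})
    = (\<Sum>g\<in>dih_group n. card {w \<in> words \<Sigma> n. dih g w = w})"
    unfolding e5 e3 e6[unfolded e7 e1] .
  have "RB \<Sigma> v \<le> card (bracelets \<Sigma> n)"
    using v finb by (auto simp: RB_def words_def intro!: card_mono)
  also have "\<dots> \<le> card (words \<Sigma> n)" unfolding br using fin by (simp add: card_image_le)
  finally show "RB \<Sigma> v \<le> card (words \<Sigma> n)" .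
qed

lemma map_le_map_iff:
  fixes f :: "'a::linorder \<Rightarrow> 'b::linorder"
  assumes "\<And>x y. x \<in> \<Sigma> \<Longrightarrow> y \<in> \<Sigma> \<Longrightarrow> f x < f y \<longleftrightarrow> x < y" "set u \<subseteq> \<Sigma>" "set w \<subseteq> \<Sigma>"
    "inj_on f \<Sigma>"
  shows "map f u \<le> map f w \<longleftrightarrow> u \<le> w"
  using assms(2,3)
proof (induction u arbitrary: w)
  case (Cons a u)
  then show ?case
    using assms(1,4) by (cases w) (auto simp: inj_on_eq_iff)
qed simp

lemma sum_dih_group: "(\<Sum>g\<in>dih_group n. f g) = (\<Sum>r<n. f (r, False)) + (\<Sum>r<n. f (r, True))"
proof -
  have "(\<Sum>g\<in>dih_group n. f g) = (\<Sum>r<n. \<Sum>b\<in>UNIV. f (r, b))"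
    by (simp add: dih_group_def sum.cartesian_product)
  then show ?thesis by (simp add: UNIV_bool sum.distrib add.commute)
qed

text \<open>\<open>letter_index\<close> is an order isomorphism onto
  \<open>{..<card \<Sigma>}\<close> and commutes with the dihedral action, so all counts can be made
  over letter positions. Against the word of zeros every word is good, which makes the right-hand
  side the sum for all bracelets.\<close>

lemma RB_fixed_sum:
  fixes v :: "'a::linorder list"
  assumes fin: "finite \<Sigma>" and n: "0 < n" and v: "v \<in> words \<Sigma> n"
    and f: "\<And>i. i < n \<Longrightarrow> f i = letter_index \<Sigma> (v ! i)"
  shows "2 * n * RB \<Sigma> v + fixed_sum f n (card \<Sigma>) = fixed_sum (\<lambda>_. 0) n (card \<Sigma>)"
    and "\<And>i. i < n \<Longrightarrow> f i < card \<Sigma>"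
    and "RB \<Sigma> v \<le> card \<Sigma> ^ n"
proof -
  let ?i = "letter_index \<Sigma>" and ?k = "card \<Sigma>"
  have less: "?i x < ?i y" if "x \<in> \<Sigma>" "x < y" for x y
    unfolding letter_index_def by (rule psubset_card_mono) (use fin that in auto)
  then have lt: "?i x < ?i y \<longleftrightarrow> x < y" if "x \<in> \<Sigma>" "y \<in> \<Sigma>" for x y
    using that by (metis less_asym less_linear order.irrefl)
  then have inj: "inj_on ?i \<Sigma>" by (metis inj_onI less_linear order.irrefl)
  have bound: "?i x < ?k" if "x \<in> \<Sigma>" for x
    unfolding letter_index_def by (rule psubset_card_mono) (use fin that in auto)
  have img: "?i ` \<Sigma> = {..<?k}"
    by (rule card_subset_eq) (use bound in \<open>auto simp: card_image[OF inj]\<close>)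
  have set_v: "set v \<subseteq> \<Sigma>" "length v = n" using v by (auto simp: words_def)
  then show "f i < card \<Sigma>" if "i < n" for i using bound f that by (metis nth_mem subsetD)
  have fv: "win f 0 n = map ?i v"
    by (rule nth_equalityI) (use f set_v in auto)
  have bij: "bij_betw (map ?i) (words \<Sigma> n) (words {..<?k} n)"
  proof (rule bij_betw_imageI)
    show inj_map: "inj_on (map ?i) (words \<Sigma> n)"
      by (rule inj_onI) (use inj in \<open>auto simp: words_def intro: map_inj_on inj_on_subset\<close>)
    show "map ?i ` words \<Sigma> n = words {..<?k} n"
    proof (intro equalityI subsetI)
      fix w assume w: "w \<in> words {..<?k} n"
      then have "set w \<subseteq> ?i ` \<Sigma>" by (auto simp: words_def img)
      then have "w \<in> lists (?i ` \<Sigma>)" by (simp add: lists_eq_set)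
      then have "w \<in> map ?i ` lists \<Sigma>" by (simp only: lists_image)
      then obtain u where "w = map ?i u" "set u \<subseteq> \<Sigma>" by (auto simp: lists_eq_set)
      then show "w \<in> map ?i ` words \<Sigma> n" using w by (auto simp: words_def)
    qed (use bound in \<open>auto simp: words_def subset_iff\<close>)
  qed
  have dih_map: "dih g (map ?i w) = map ?i (dih g w)" for g w
    by (simp add: dih_def rotate_map rev_map)
  have tr: "card {w \<in> words \<Sigma> n. P w \<and> dih g w = w} = card {w \<in> words {..<?k} n. Q w \<and> dih g w = w}"
    if PQ: "\<And>w. w \<in> words \<Sigma> n \<Longrightarrow> Q (map ?i w) = P w" for P Q g
  proof -
    have inj: "inj_on (map ?i) {w \<in> words \<Sigma> n. P w \<and> dih g w = w}"
      by (rule inj_on_subset[OF bij_betw_imp_inj_on[OF bij]]) auto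
    have e: "dih g (map ?i w) = map ?i w \<longleftrightarrow> dih g w = w" if "w \<in> words \<Sigma> n" for w
      unfolding dih_map using bij that dih_words[OF that] by (metis bij_betw_def inj_on_eq_iff)
    have "map ?i ` {w \<in> words \<Sigma> n. P w \<and> dih g w = w} = {w \<in> words {..<?k} n. Q w \<and> dih g w = w}"
    proof (intro equalityI subsetI)
      fix w assume w: "w \<in> {w \<in> words {..<?k} n. Q w \<and> dih g w = w}"
      then obtain u where "u \<in> words \<Sigma> n" "w = map ?i u" using bij unfolding bij_betw_def by blast
      then show "w \<in> map ?i ` {w \<in> words \<Sigma> n. P w \<and> dih g w = w}" using w e PQ by auto
    qed (use e PQ bij in \<open>auto simp: bij_betw_def\<close>)
    then show ?thesis using card_image[OF inj] by simp
  qed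
  have le: "map ?i v \<le> map ?i w \<longleftrightarrow> v \<le> w" if "w \<in> words \<Sigma> n" for w
    by (rule map_le_map_iff[OF lt]) (use that set_v inj in \<open>auto simp: words_def\<close>)
  have fs: "fixed_sum f' n ?k = (\<Sum>g\<in>dih_group n.
      card {w \<in> words {..<?k} n. (\<forall>u\<in>orbit n w. win f' 0 n \<le> u) \<and> dih g w = w})" for f'
  proof -
    have "{w \<in> words {..<?k} n. \<forall>r. win f' 0 n \<le> rotate r w \<and> win f' 0 n \<le> rotate r (rev w)}
      = {w \<in> words {..<?k} n. \<forall>u\<in>orbit n w. win f' 0 n \<le> u}"
      by (rule Collect_cong, rule conj_cong[OF refl], rule dih_ge_iff[OF _ n, symmetric])
        (simp add: words_def)
    then show ?thesis
      unfolding fixed_sum_def Let_def sum_dih_group by (simp add: dih_def conj_assoc)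
  qed
  have P1: "(\<forall>u\<in>orbit n (map ?i w). map ?i v \<le> u) = (\<forall>u\<in>orbit n w. v \<le> u)"
    if "w \<in> words \<Sigma> n" for w
    unfolding orbit_def using le dih_words[OF that] by (auto simp: dih_map)
  have zero: "win (\<lambda>_. 0) 0 n \<le> u" if "length u = n" for u :: "nat list"
    using that by (subst list_le_iff) auto
  have P2: "(\<forall>u\<in>orbit n (map ?i w). win (\<lambda>_. 0) 0 n \<le> u) = True" if "w \<in> words \<Sigma> n" for w
    using zero that dih_words[OF that] by (auto simp: orbit_def dih_map words_def)
  have "fixed_sum f n ?k = (\<Sum>g\<in>dih_group n. card {w \<in> words \<Sigma> n. (\<forall>u\<in>orbit n w. v \<le> u) \<and> dih g w = w})"
    unfolding fs fv by (intro sum.cong refl tr[symmetric] P1)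
  moreover have "fixed_sum (\<lambda>_. 0) n ?k = (\<Sum>g\<in>dih_group n. card {w \<in> words \<Sigma> n. True \<and> dih g w = w})"
    unfolding fs by (intro sum.cong refl tr[symmetric] P2)
  ultimately show "2 * n * RB \<Sigma> v + fixed_sum f n ?k = fixed_sum (\<lambda>_. 0) n ?k"
    using RB_burnside(1)[OF fin n v] by simp
  have "card (words \<Sigma> n) = ?k ^ n"
    unfolding words_def using card_lists_length_eq[OF fin] by simp
  then show "RB \<Sigma> v \<le> ?k ^ n" using RB_burnside(2)[OF fin n v] by simp
qed

section \<open>Running times of programs\<close>

fun mods :: "com \<Rightarrow> string set" where
  "mods Skip = {}"
| "mods (Assign a i e) = {a}"
| "mods (Seq c d) = mods c \<union> mods d"
| "mods (Cond b c d) = mods c \<union> mods d"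
| "mods (While b c) = mods c"

lemma exec_frame: "exec c s t s' \<Longrightarrow> a \<notin> mods c \<Longrightarrow> s' a = s a"
  by (induction rule: exec.induct) auto

abbreviation same :: "string set \<Rightarrow> state \<Rightarrow> state \<Rightarrow> bool" where
  "same V s s' \<equiv> \<forall>a. a \<notin> V \<longrightarrow> s' a = s a"

definition wp :: "com \<Rightarrow> nat \<Rightarrow> (state \<Rightarrow> bool) \<Rightarrow> state \<Rightarrow> bool" where
  "wp c T Q s \<longleftrightarrow> (\<exists>t s'. exec c s t s' \<and> t \<le> T \<and> Q s')"

lemma wp_conseq:
  assumes "wp c T Q s" "T \<le> T'" "\<And>s'. Q s' \<Longrightarrow> same (mods c) s s' \<Longrightarrow> Q' s'"
  shows "wp c T' Q' s"
  using assms exec_frame unfolding wp_def by (meson order_trans)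

lemma wp_time: "wp c T Q s \<Longrightarrow> T \<le> T' \<Longrightarrow> wp c T' Q s"
  by (auto elim: wp_conseq)

lemma wp_seq:
  assumes "wp c U R s" "\<And>s'. R s' \<Longrightarrow> same (mods c) s s' \<Longrightarrow> wp d U' Q s'" "U + U' \<le> T"
  shows "wp (Seq c d) T Q s"
proof -
  from assms(1) obtain t s' where 1: "exec c s t s'" "t \<le> U" "R s'" by (auto simp: wp_def)
  then obtain t' s'' where "exec d s' t' s''" "t' \<le> U'" "Q s''"
    using assms(2)[OF 1(3)] exec_frame[OF 1(1)] by (auto simp: wp_def)
  with 1 assms(3) show ?thesis unfolding wp_def by (intro exI[of _ "t + t'"] exI[of _ s'']) (auto intro: exec.Seq)
qed

lemma wp_cond:
  assumes "val b s \<noteq> 0 \<Longrightarrow> wp c U Q s" "val b s = 0 \<Longrightarrow> wp d U Q s" "cost b + 1 + U \<le> T"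
  shows "wp (Cond b c d) T Q s"
proof (cases "val b s = 0")
  case True
  then obtain t s' where "exec d s t s'" "t \<le> U" "Q s'" using assms(2) by (auto simp: wp_def)
  with True assms(3) show ?thesis unfolding wp_def
    by (intro exI[of _ "cost b + 1 + t"] exI[of _ s'] conjI exec.CondFalse) auto
next
  case False
  then obtain t s' where "exec c s t s'" "t \<le> U" "Q s'" using assms(1) by (auto simp: wp_def)
  with False assms(3) show ?thesis unfolding wp_def
    by (intro exI[of _ "cost b + 1 + t"] exI[of _ s'] conjI exec.CondTrue) auto
qed

fun straight :: "com \<Rightarrow> bool" where
  "straight (Seq c d) = (straight c \<and> straight d)"
| "straight (Cond b c d) = (straight c \<and> straight d)"
| "straight (While b c) = False"
| "straight c = True"

fun post :: "com \<Rightarrow> state \<Rightarrow> state" where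
  "post (Assign a i e) s = s(a := (s a)(val i s := val e s))"
| "post (Seq c d) s = post d (post c s)"
| "post (Cond b c d) s = (if val b s \<noteq> 0 then post c s else post d s)"
| "post c s = s"

fun straight_time :: "com \<Rightarrow> nat" where
  "straight_time (Assign a i e) = cost i + cost e + 1"
| "straight_time (Seq c d) = straight_time c + straight_time d"
| "straight_time (Cond b c d) = cost b + 1 + max (straight_time c) (straight_time d)"
| "straight_time c = 1"

text \<open>Loop-free code is handled by symbolic evaluation with \<open>post\<close>, and
  \<open>straight_time\<close> takes the more expensive branch of each test.\<close>

lemma wp_straight:
  assumes "straight c" "straight_time c \<le> T" "Q (post c s)"
  shows "wp c T Q s"
proof -
  have "wp c (straight_time c) (\<lambda>s'. s' = post c s) s"
    using assms(1)
  proof (induction c arbitrary: s)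
    case Skip
    then show ?case by (auto simp: wp_def intro: exec.Skip)
  next
    case (Assign a i e)
    show ?case unfolding wp_def
      by (intro exI conjI, rule exec.Assign) simp_all
  next
    case (Seq c d)
    then show ?case by (auto intro!: wp_seq[where R = "\<lambda>s'. s' = post c s"])
  next
    case (Cond b c d)
    have "wp c (max (straight_time c) (straight_time d)) (\<lambda>s'. s' = post c s) s"
      by (rule wp_time[OF Cond.IH(1)]) (use Cond.prems in auto)
    moreover have "wp d (max (straight_time c) (straight_time d)) (\<lambda>s'. s' = post d s) s"
      by (rule wp_time[OF Cond.IH(2)]) (use Cond.prems in auto)
    ultimately show ?case
      by (auto intro!: wp_cond[where U = "max (straight_time c) (straight_time d)"])
  next
    case (While b c)
    then show ?case by simp
  qed
  then show ?thesis by (rule wp_conseq) (use assms in auto)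
qed

definition For :: "string \<Rightarrow> string \<Rightarrow> com \<Rightarrow> com" where
  "For x y c = Seq (Assign x (Const 0) (Const 0))
     (While (Minus (Read y (Const 0)) (Read x (Const 0)))
        (Seq c (Assign x (Const 0) (Plus (Read x (Const 0)) (Const 1)))))"

lemma mods_For[simp]: "mods (For x y c) = insert x (mods c)"
  by (auto simp: For_def)

text \<open>The body bound is split into a numeral \<open>A\<close> and a symbolic size
  \<open>X\<close>, so that nested loops multiply sizes and only add \<open>21\<close> to the
  numeral. The overhead is \<open>12\<close> for each round (test and increment), \<open>3\<close>
  for the initial assignment and \<open>6\<close> for the last test; \<open>0 < M\<close> and
  \<open>0 < X\<close> let the product absorb the last two.\<close>

lemma wp_for:
  assumes xy: "x \<noteq> y" "y \<notin> mods c" "x \<notin> mods c"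
    and indep: "\<And>i s f. I i (s(x := f)) = I i s"
    and init: "I 0 s"
    and body: "\<And>i s'. i < s y 0 \<Longrightarrow> s' x 0 = i \<Longrightarrow> same (insert x (mods c)) s s' \<Longrightarrow> I i s' \<Longrightarrow>
      wp c (A * X) (I (Suc i)) s'"
    and time: "s y 0 \<le> M" "0 < M" "0 < X" "(A + 21) * (M * X) \<le> T"
    and fin: "\<And>s'. I (s y 0) s' \<Longrightarrow> same (insert x (mods c)) s s' \<Longrightarrow> Q s'"
  shows "wp (For x y c) T Q s"
proof -
  let ?N = "s y 0"
  let ?b = "Minus (Read y (Const 0)) (Read x (Const 0))"
  let ?c = "Seq c (Assign x (Const 0) (Plus (Read x (Const 0)) (Const 1)))"
  have loop: "wp (While ?b ?c) (m * (A * X + 12) + 6)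
      (\<lambda>s'. I ?N s' \<and> same (insert x (mods c)) s s') s1"
    if "I i s1" "s1 x 0 = i" "same (insert x (mods c)) s s1" "i + m = ?N" for m i s1
    using that
  proof (induction m arbitrary: i s1)
    case 0
    then have "exec (While ?b ?c) s1 (cost ?b + 1) s1"
      using xy by (intro exec.WhileFalse) auto
    with 0 show ?case unfolding wp_def by (intro exI[of _ "cost ?b + 1"] exI[of _ s1]) auto
  next
    case (Suc m)
    from Suc.prems xy have y: "s1 y = s y" by auto
    from Suc.prems have "wp c (A * X) (I (Suc i)) s1" by (intro body) auto
    then obtain t2 s2 where s2: "exec c s1 t2 s2" "t2 \<le> A * X" "I (Suc i) s2" by (auto simp: wp_def)
    define s3 where "s3 = s2(x := (s2 x)(0 := Suc i))"
    have "s2 x = s1 x" using exec_frame[OF s2(1)] xy by auto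
    then have "post (Assign x (Const 0) (Plus (Read x (Const 0)) (Const 1))) s2 = s3"
      using Suc.prems by (simp add: s3_def)
    then have "exec (Assign x (Const 0) (Plus (Read x (Const 0)) (Const 1))) s2 6 s3"
      using exec.Assign[of x "Const 0" "Plus (Read x (Const 0)) (Const 1)" s2]
      by (simp add: eval_nat_numeral)
    then have e: "exec ?c s1 (t2 + 6) s3" by (rule exec.Seq[OF s2(1)])
    have "wp (While ?b ?c) (m * (A * X + 12) + 6) (\<lambda>s'. I ?N s' \<and> same (insert x (mods c)) s s') s3"
    proof (rule Suc.IH)
      show "I (Suc i) s3" using s2 indep by (simp add: s3_def)
      show "s3 x 0 = Suc i" by (simp add: s3_def)
      show "same (insert x (mods c)) s s3"
        using Suc.prems exec_frame[OF s2(1)] by (auto simp: s3_def)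
    qed (use Suc.prems in simp)
    then obtain t4 s4 where s4: "exec (While ?b ?c) s3 t4 s4" "t4 \<le> m * (A * X + 12) + 6"
      "I ?N s4" "same (insert x (mods c)) s s4" by (auto simp: wp_def)
    have "exec (While ?b ?c) s1 (cost ?b + 1 + (t2 + 6) + t4) s4"
      using Suc.prems y by (intro exec.WhileTrue[OF _ e s4(1)]) auto
    then show ?case unfolding wp_def
      using s2 s4 by (intro exI[of _ "cost ?b + 1 + (t2 + 6) + t4"] exI[of _ s4]) auto
  qed
  have "wp (For x y c) (3 + (?N * (A * X + 12) + 6)) (\<lambda>s'. I ?N s' \<and> same (insert x (mods c)) s s') s"
    unfolding For_def
  proof (rule wp_seq[where R = "\<lambda>s'. s' = s(x := (s x)(0 := 0))"])
    show "wp (Assign x (Const 0) (Const 0)) 3 (\<lambda>s'. s' = s(x := (s x)(0 := 0))) s"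
      by (rule wp_straight) auto
    fix s' assume "s' = s(x := (s x)(0 := 0))"
    then show "wp (While ?b ?c) (?N * (A * X + 12) + 6) (\<lambda>s'. I ?N s' \<and> same (insert x (mods c)) s s') s'"
      using init indep by (intro loop[of 0]) auto
  qed simp
  moreover have "3 + (?N * (A * X + 12) + 6) \<le> T"
  proof -
    have "1 \<le> M * X" "M * 1 \<le> M * X" using time by (auto simp: Suc_le_eq)
    moreover have "?N * (A * X + 12) \<le> M * (A * X + 12)" using time by simp
    moreover have "M * (A * X + 12) = A * (M * X) + 12 * M" by (simp add: algebra_simps)
    moreover have "(A + 21) * (M * X) = A * (M * X) + 21 * (M * X)" by (simp add: algebra_simps)
    ultimately show ?thesis using time(4) by linarith
  qed
  ultimately show ?thesis by (rule wp_conseq) (use fin in auto)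
qed

lemma wp_for_add:
  assumes xy: "x \<noteq> y" "y \<notin> mods c" "x \<notin> mods c" "x \<noteq> B"
    and body: "\<And>i s'. i < s y 0 \<Longrightarrow> s' x 0 = i \<Longrightarrow> same (insert x (mods c)) s s' \<Longrightarrow>
      wp c (A * X) (\<lambda>s''. s'' B = (\<lambda>m. s' B m + g i m)) s'"
    and time: "s y 0 \<le> M" "0 < M" "0 < X" "(A + 21) * (M * X) \<le> T"
    and fin: "\<And>s'. s' B = (\<lambda>m. s B m + (\<Sum>i<s y 0. g i m)) \<Longrightarrow> same (insert x (mods c)) s s' \<Longrightarrow> Q s'"
  shows "wp (For x y c) T Q s"
proof (rule wp_for[where I = "\<lambda>N s'. s' B = (\<lambda>m. s B m + (\<Sum>i<N. g i m))" and A = A and X = X and M = M])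
  fix i s' assume *: "i < s y 0" "s' x 0 = i" "same (insert x (mods c)) s s'"
    "s' B = (\<lambda>m. s B m + (\<Sum>i<i. g i m))"
  show "wp c (A * X) (\<lambda>s'. s' B = (\<lambda>m. s B m + (\<Sum>i<Suc i. g i m))) s'"
    by (rule wp_conseq[OF body[OF *(1-3)] order_refl]) (simp add: *(4) add.assoc)
qed (use xy time fin in auto)

section \<open>The ranking program\<close>

abbreviation (input) V :: "string \<Rightarrow> exp" where
  "V a \<equiv> Read a (Const 0)"

abbreviation (input) set_var :: "string \<Rightarrow> exp \<Rightarrow> com" where
  "set_var a e \<equiv> Assign a (Const 0) e"

text \<open>Truncated subtraction serves as comparison: \<open>Minus e f\<close> is nonzero exactly
  if the value of \<open>f\<close> is below that of \<open>e\<close>. The same idiom is used in all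
  later programs.\<close>

definition delta :: "string \<Rightarrow> string \<Rightarrow> com" where
  "delta x i = Cond (Minus (V ''c'') (Read ''v'' (V i))) (set_var x (Const 0))
     (Cond (Minus (V ''p'') (Plus (V i) (Const 1))) (set_var x (Plus (V i) (Const 1)))
       (set_var x (Const 0)))"

text \<open>Tables indexed by pairs of states are stored row by row in the arrays \<open>W\<close> (current) and \<open>U\<close>
  (next, zero between the steps). As there is no multiplication, \<open>b\<close> holds the row offsets.\<close>

definition cell :: "string \<Rightarrow> string \<Rightarrow> exp" where
  "cell i j = Plus (Read ''b'' (V i)) (V j)"

text \<open>Rows have length \<open>n\<close>, not \<open>p\<close>. The offsets in \<open>b\<close>
  are then independent of \<open>p\<close> and remain valid for both counts, which in general have
  different values of \<open>p\<close>.\<close>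

definition ctx :: "nat \<Rightarrow> nat \<Rightarrow> nat \<Rightarrow> (nat \<Rightarrow> nat) \<Rightarrow> state \<Rightarrow> bool" where
  "ctx n k p v s \<longleftrightarrow> s ''n'' 0 = n \<and> s ''nn'' 0 = n * n \<and> s ''k'' 0 = k \<and> s ''p'' 0 = p \<and> s ''v'' = v \<and>
     (\<forall>i<n. s ''b'' i = i * n)"

lemma ctx_same:
  "same A s s' \<Longrightarrow> ctx n k p v s \<Longrightarrow> \<forall>a\<in>{''n'', ''nn'', ''k'', ''p'', ''v'', ''b''}. a \<notin> A \<Longrightarrow> ctx n k p v s'"
  by (simp add: ctx_def)

lemma straight_delta[simp]: "straight (delta x i)" "mods (delta x i) = {x}" "straight_time (delta x i) = 21"
  by (auto simp: delta_def)

lemma post_delta: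
  assumes "ctx n k p v s" "s i 0 < p"
  shows "post (delta x i) s = s(x := (s x)(0 := nxt v p (s i 0) (s ''c'' 0)))"
  using assms by (auto simp: delta_def ctx_def nxt_def fun_eq_iff)

subsection \<open>One step of the dynamic programme\<close>

text \<open>Values are pushed along the first component and pulled along the second one, so a pair
  of states and a letter cause a single addition.\<close>

definition step_body :: com where
  "step_body = Cond (Minus (Read ''v'' (V ''i'')) (V ''c'')) Skip
     (Cond (Minus (Read ''v'' (V ''j'')) (V ''c'')) Skip
       (Seq (delta ''x'' ''i'') (Seq (delta ''y'' ''j'')
         (Assign ''U'' (cell ''x'' ''j'') (Plus (Read ''U'' (cell ''x'' ''j'')) (Read ''W'' (cell ''i'' ''y'')))))))"

definition step_loop :: com where
  "step_loop = For ''i'' ''p'' (For ''j'' ''p'' (For ''c'' ''k'' step_body))"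

definition copy_loop :: com where
  "copy_loop = For ''i'' ''nn'' (Seq (Assign ''W'' (V ''i'') (Read ''U'' (V ''i''))) (Assign ''U'' (V ''i'') (Const 0)))"

definition step_com :: com where
  "step_com = Seq step_loop copy_loop"

lemma mods_step_body[simp]: "mods step_body = {''x'', ''y'', ''U''}"
  by (auto simp: step_body_def)

lemma mods_step_com[simp]: "mods step_com = {''x'', ''y'', ''U'', ''W'', ''i'', ''j'', ''c''}"
  by (auto simp: step_com_def step_loop_def copy_loop_def)

lemma straight_step_body[simp]: "straight step_body" "straight_time step_body = 78"
  by (auto simp: step_body_def cell_def)

lemma post_step_body:
  assumes c: "ctx n k p v s" and i: "s ''i'' 0 = i" "i < p" and j: "s ''j'' 0 = j" "j < p"
    and "s ''c'' 0 = a" and p: "p \<le> n"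
  shows "post step_body s ''U'' = (\<lambda>m. s ''U'' m +
    (if v i \<le> a \<and> v j \<le> a \<and> nxt v p i a * n + j = m then s ''W'' (i * n + nxt v p j a) else 0))"
proof -
  have b: "\<forall>i<n. s ''b'' i = i * n" "s ''v'' = v" using c by (auto simp: ctx_def)
  have x: "nxt v p i a < p" using nxt_less i by blast
  let ?s = "s(''x'' := (s ''x'')(0 := nxt v p i a))"
  have c': "ctx n k p v ?s" using c by (auto simp: ctx_def)
  have e: "post (delta ''y'' ''j'') (post (delta ''x'' ''i'') s)
    = ?s(''y'' := (s ''y'')(0 := nxt v p j a))"
    using assms post_delta[OF c, of "''i''" "''x''"] post_delta[OF c', of "''j''" "''y''"]
    by (simp add: fun_upd_def)
  show ?thesis
    using assms b x by (auto simp: step_body_def cell_def e fun_eq_iff)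
qed

lemma wp_step_loop:
  assumes c: "ctx n k p v s" and p: "p \<le> n" and k: "0 < k" and n: "0 < n"
  shows "wp step_loop (150 * (n * (n * k))) (\<lambda>s'. s' ''U'' = (\<lambda>m. s ''U'' m +
    (\<Sum>i<p. \<Sum>j<p. \<Sum>a<k. if v i \<le> a \<and> v j \<le> a \<and> nxt v p i a * n + j = m
      then s ''W'' (i * n + nxt v p j a) else 0))) s"
proof -
  have kp: "s ''k'' 0 = k" "s ''p'' 0 = p" using c by (auto simp: ctx_def)
  let ?g = "\<lambda>i j a m. if v i \<le> a \<and> v j \<le> a \<and> nxt v p i a * n + j = m
      then s ''W'' (i * n + nxt v p j a) else 0"
  have c_loop: "wp (For ''c'' ''k'' step_body) (99 * k)
      (\<lambda>s''. s'' ''U'' = (\<lambda>m. s' ''U'' m + (\<Sum>a<k. ?g i j a m))) s'"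
    if s': "same {''i'', ''j'', ''c'', ''x'', ''y'', ''U''} s s'"
      and ij: "s' ''i'' 0 = i" "i < p" "s' ''j'' 0 = j" "j < p" for i j s'
  proof (rule wp_for_add[where B = "''U''" and A = 78 and X = 1 and M = k and g = "?g i j"])
    fix a s'' assume a: "same (insert ''c'' (mods step_body)) s' s''" "s'' ''c'' 0 = a"
    have "ctx n k p v s''"
      by (rule ctx_same[OF _ c, of "{''i'', ''j'', ''c'', ''x'', ''y'', ''U''}"]) (use a s' in auto)
    then have "post step_body s'' ''U'' = (\<lambda>m. s'' ''U'' m +
      (if v i \<le> a \<and> v j \<le> a \<and> nxt v p i a * n + j = m then s'' ''W'' (i * n + nxt v p j a) else 0))"
      by (rule post_step_body) (use a ij p in auto)
    moreover have "s'' ''W'' = s ''W''" using a s' by simp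
    ultimately show "wp step_body (78 * 1) (\<lambda>z. z ''U'' = (\<lambda>m. s'' ''U'' m + ?g i j a m)) s''"
      by (intro wp_straight) (simp_all cong: if_cong)
  qed (use s' kp k in auto)
  have j_loop: "wp (For ''j'' ''p'' (For ''c'' ''k'' step_body)) (120 * (n * k))
      (\<lambda>s''. s'' ''U'' = (\<lambda>m. s' ''U'' m + (\<Sum>j<p. \<Sum>a<k. ?g i j a m))) s'"
    if s': "same {''i'', ''j'', ''c'', ''x'', ''y'', ''U''} s s'"
      and i: "s' ''i'' 0 = i" "i < p" for i s'
  proof (rule wp_for_add[where B = "''U''" and A = 99 and X = k and M = n and g = "\<lambda>j m. \<Sum>a<k. ?g i j a m"])
    fix j s'' assume a: "j < s' ''p'' 0" "s'' ''j'' 0 = j"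
      "same (insert ''j'' (mods (For ''c'' ''k'' step_body))) s' s''"
    show "wp (For ''c'' ''k'' step_body) (99 * k) (\<lambda>z. z ''U'' = (\<lambda>m. s'' ''U'' m + (\<Sum>a<k. ?g i j a m))) s''"
      by (rule c_loop) (use a s' i kp in auto)
  qed (use s' kp k p n in auto)
  show ?thesis unfolding step_loop_def
  proof (rule wp_for_add[where B = "''U''" and A = 120 and X = "n * k" and M = n and g = "\<lambda>i m. \<Sum>j<p. \<Sum>a<k. ?g i j a m"])
    fix i s'' assume a: "i < s ''p'' 0" "s'' ''i'' 0 = i"
      "same (insert ''i'' (mods (For ''j'' ''p'' (For ''c'' ''k'' step_body)))) s s''"
    show "wp (For ''j'' ''p'' (For ''c'' ''k'' step_body)) (120 * (n * k))
      (\<lambda>z. z ''U'' = (\<lambda>m. s'' ''U'' m + (\<Sum>j<p. \<Sum>a<k. ?g i j a m))) s''"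
      by (rule j_loop) (use a kp in auto)
  qed (use kp k p n in auto)
qed

definition table :: "nat \<Rightarrow> nat \<Rightarrow> (nat \<Rightarrow> nat \<Rightarrow> nat) \<Rightarrow> state \<Rightarrow> bool" where
  "table n p w s \<longleftrightarrow> (\<forall>i<p. \<forall>j<p. s ''W'' (i * n + j) = w i j) \<and> (\<forall>m<n * n. s ''U'' m = 0)"

lemma pair_eq:
  fixes n :: nat
  assumes "j < n" "j' < n"
  shows "i * n + j = i' * n + j' \<longleftrightarrow> i = i' \<and> j = j'"
proof
  assume e: "i * n + j = i' * n + j'"
  then have "(i * n + j) div n = (i' * n + j') div n" "(i * n + j) mod n = (i' * n + j') mod n" by simp_all
  then show "i = i' \<and> j = j'" using assms by simp
qed simp

lemma pair_less: "i < n \<Longrightarrow> j < n \<Longrightarrow> i * n + j < n * (n::nat)"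
  by (metis add_less_cancel_left less_le_trans mult_Suc add.commute mult_le_mono1 Suc_leI)

lemma wp_copy_loop:
  assumes c: "ctx n k p v s" and n: "0 < n"
  shows "wp copy_loop (40 * (n * n)) (\<lambda>s'. \<forall>m<n * n. s' ''W'' m = s ''U'' m \<and> s' ''U'' m = 0) s"
proof -
  have nn: "s ''nn'' 0 = n * n" using c by (simp add: ctx_def)
  show ?thesis unfolding copy_loop_def
  proof (rule wp_for[where A = 10 and X = 1 and M = "n * n" and
      I = "\<lambda>N s'. (\<forall>m<N. s' ''W'' m = s ''U'' m \<and> s' ''U'' m = 0) \<and> (\<forall>m\<ge>N. s' ''U'' m = s ''U'' m)"], goal_cases)
    case (6 i s')
    from 6(4) have *: "\<forall>m<i. s' ''W'' m = s ''U'' m \<and> s' ''U'' m = 0" "\<forall>m\<ge>i. s' ''U'' m = s ''U'' m"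
      by blast+
    show ?case by (rule wp_straight) (simp_all add: 6(2) * less_Suc_eq)
  next
    case 7
    show ?case by (simp add: nn)
  next
    case (11 s')
    then show ?case by (simp add: nn)
  qed (use n in simp_all)
qed

lemma wp_step_com:
  assumes c: "ctx n k p v s" and p: "p \<le> n" and k: "0 < k" and n: "0 < n" and t: "table n p w s"
  shows "wp step_com (190 * (n * (n * k))) (table n p (step v p k w)) s"
  unfolding step_com_def
proof (rule wp_seq[OF wp_step_loop[OF c p k n]])
  fix s' assume s': "s' ''U'' = (\<lambda>m. s ''U'' m +
    (\<Sum>i<p. \<Sum>j<p. \<Sum>a<k. if v i \<le> a \<and> v j \<le> a \<and> nxt v p i a * n + j = m
      then s ''W'' (i * n + nxt v p j a) else 0))" "same (mods step_loop) s s'"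
  have c': "ctx n k p v s'" by (rule ctx_same[OF s'(2) c]) (simp add: step_loop_def)
  have U: "s' ''U'' (x * n + y) = step v p k w x y" if "x < p" "y < p" for x y
  proof -
    have "x * n + y < n * n" using that p by (intro pair_less) auto
    then have "s' ''U'' (x * n + y) = (\<Sum>i<p. \<Sum>j<p. \<Sum>a<k. if v i \<le> a \<and> v j \<le> a \<and>
      nxt v p i a * n + j = x * n + y then s ''W'' (i * n + nxt v p j a) else 0)"
      using t by (simp add: s'(1) table_def)
    also have "\<dots> = (\<Sum>i<p. \<Sum>j<p. if j = y then (\<Sum>a<k. if v i \<le> a \<and> v y \<le> a \<and>
      nxt v p i a = x then w i (nxt v p y a) else 0) else 0)"
    proof (intro sum.cong refl)
      fix i j assume ij: "i \<in> {..<p}" "j \<in> {..<p}"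
      then have *: "j < n" "y < n" using p that by auto
      have W: "s ''W'' (i * n + nxt v p j a) = w i (nxt v p j a)" for a
        using t ij nxt_less[of j p v a] by (simp add: table_def)
      show "(\<Sum>a<k. if v i \<le> a \<and> v j \<le> a \<and>
        nxt v p i a * n + j = x * n + y then s ''W'' (i * n + nxt v p j a) else 0)
        = (if j = y then (\<Sum>a<k. if v i \<le> a \<and> v y \<le> a \<and> nxt v p i a = x then w i (nxt v p y a) else 0) else 0)"
        unfolding pair_eq[OF *] W by (cases "j = y") (simp_all cong: if_cong)
    qed
    also have "\<dots> = step v p k w x y"
      using that by (simp add: step_def)
    finally show ?thesis .
  qed
  show "wp copy_loop (40 * (n * n)) (table n p (step v p k w)) s'"
  proof (rule wp_conseq[OF wp_copy_loop[OF c' n] order_refl])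
    fix s'' assume "\<forall>m<n * n. s'' ''W'' m = s' ''U'' m \<and> s'' ''U'' m = 0"
    then show "table n p (step v p k w) s''"
      using U p pair_less[of _ n] by (simp add: table_def)
  qed
next
  have "n * n \<le> n * (n * k)" using k by simp
  then show "150 * (n * (n * k)) + 40 * (n * n) \<le> 190 * (n * (n * k))" by linarith
qed

lemma ctxD:
  assumes "ctx n k p v s"
  shows "s ''n'' 0 = n" "s ''nn'' 0 = n * n" "s ''k'' 0 = k" "s ''p'' 0 = p" "s ''v'' = v"
    "i < n \<Longrightarrow> s ''b'' i = i * n"
  using assms by (auto simp: ctx_def)

subsection \<open>Duval's algorithm\<close>

text \<open>The flag \<open>e\<close> is raised when \<open>v\<close> falls below its periodic
  continuation; from then on \<open>p\<close> is frozen. In the first round, with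
  \<open>i = 0\<close> and \<open>p = 1\<close>, the truncated \<open>i - p\<close> is
  \<open>0\<close>, so \<open>v 0\<close> is compared with itself and nothing changes.\<close>

definition duval_body :: com where
  "duval_body = Cond (V ''e'') Skip
     (Cond (Minus (Read ''v'' (Minus (V ''i'') (V ''p''))) (Read ''v'' (V ''i'')))
       (set_var ''e'' (Const 1))
       (Cond (Minus (Read ''v'' (V ''i'')) (Read ''v'' (Minus (V ''i'') (V ''p''))))
         (set_var ''p'' (Plus (V ''i'') (Const 1))) Skip))"

definition duval_com :: com where
  "duval_com = Seq (Seq (set_var ''e'' (Const 0)) (set_var ''p'' (Const 1)))
     (For ''i'' ''n'' duval_body)"

lemma mods_duval_com[simp]: "mods duval_com = {''e'', ''p'', ''i''}"
  by (auto simp: duval_com_def duval_body_def)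

lemma mods_duval_body[simp]: "mods duval_body = {''e'', ''p''}"
  by (auto simp: duval_body_def)

text \<open>\<open>max 1 j\<close> allows for the initial state, where \<open>p = 1\<close> although
  no letter has been read. For \<open>e \<noteq> 0\<close> the witness \<open>m\<close> is the
  position of the descent, as in \<open>duval\<close>.\<close>

definition duval_inv :: "(nat \<Rightarrow> nat) \<Rightarrow> nat \<Rightarrow> nat \<Rightarrow> nat \<Rightarrow> nat \<Rightarrow> bool" where
  "duval_inv v n p e j \<longleftrightarrow> lyndon v p \<and> p \<le> max 1 j \<and>
     (if e = 0 then \<forall>i<j. v i = v (i mod p)
      else \<exists>m<n. p \<le> m \<and> (\<forall>i<m. v i = v (i mod p)) \<and> v m < v (m mod p))"

text \<open>The key fact behind Duval's algorithm: a periodic continuation of a Lyndon word followed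
  by a letter above the expected one is again a Lyndon word.\<close>

lemma lyndon_extend:
  assumes L: "lyndon v p" and per: "\<forall>i<j. v i = v (i mod p)" and gt: "v (j mod p) < v j"
  shows "lyndon v (Suc j)"
  unfolding lyndon_def
proof (intro conjI allI impI)
  fix d assume d: "0 < d" "d < Suc j"
  have p: "0 < p" using L by (simp add: lyndon_def)
  show "\<exists>e. d + e < Suc j \<and> v e < v (d + e) \<and> (\<forall>e'<e. v (d + e') = v e')"
  \<comment> \<open>Either the suffix at \<open>d\<close> exceeds the prefix before position
    \<open>j\<close>, or it agrees with the prefix up to there, as it is never smaller; then the new
    letter at \<open>j\<close> decides.\<close>
  proof (cases "\<exists>e. d + e < j \<and> v e < v ((d + e) mod p) \<and> (\<forall>e'<e. v ((d + e') mod p) = v e')")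
    case True
    then obtain e where "d + e < j" "v e < v ((d + e) mod p)" "\<forall>e'<e. v ((d + e') mod p) = v e'" by blast
    then show ?thesis using per by (intro exI[of _ e]) auto
  next
    case False
    have ge: "v (m mod p) \<le> v ((d + m) mod p)" if "\<forall>l<m. v ((d + l) mod p) = v (l mod p)" for m
      using lyndon_shift_ge[OF L that] .
    have eq: "d + l < j \<Longrightarrow> v ((d + l) mod p) = v (l mod p)" for l
    proof (induction l rule: less_induct)
      case (less l)
      then have *: "\<forall>e'<l. v ((d + e') mod p) = v (e' mod p)" by auto
      have "v e' = v (e' mod p)" if "e' \<le> l" for e' using per less.prems that by simp
      then have "\<forall>e'<l. v ((d + e') mod p) = v e'" using * by auto
      then have "\<not> v l < v ((d + l) mod p)" using False less.prems by blast
      moreover have "v l = v (l mod p)" using per less.prems by simp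
      ultimately show ?case using ge[OF *] by simp
    qed
    have "v ((j - d) mod p) \<le> v ((d + (j - d)) mod p)"
      by (rule ge) (use eq d in auto)
    also have "(d + (j - d)) mod p = j mod p" using d by simp
    also note gt
    also have "v ((j - d) mod p) = v (j - d)" using per d by simp
    finally have "v (j - d) < v (d + (j - d))" using d by simp
    then show ?thesis using eq per d by (intro exI[of _ "j - d"]) auto
  qed
qed simp

lemma duval_inv_step:
  assumes inv: "duval_inv v n p e j" and j: "j < n"
  shows "e \<noteq> 0 \<Longrightarrow> duval_inv v n p e (Suc j)"
    and "e = 0 \<Longrightarrow> v j < v (j - p) \<Longrightarrow> duval_inv v n p 1 (Suc j)"
    and "e = 0 \<Longrightarrow> v (j - p) < v j \<Longrightarrow> duval_inv v n (Suc j) e (Suc j)"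
    and "e = 0 \<Longrightarrow> v (j - p) = v j \<Longrightarrow> duval_inv v n p e (Suc j)"
proof -
  have L: "lyndon v p" "0 < p" "p \<le> max 1 j" using inv by (auto simp: duval_inv_def lyndon_def)
  have red: "v (j - p) = v (j mod p)" if "e = 0"
  proof (cases "j < p")
    case True
    then show ?thesis using L by (cases j) auto
  next
    case False
    then have "v (j - p) = v ((j - p) mod p)" using inv that L by (auto simp: duval_inv_def)
    also have "(j - p) mod p = j mod p" using False by (simp add: le_mod_geq)
    finally show ?thesis .
  qed
  show "e \<noteq> 0 \<Longrightarrow> duval_inv v n p e (Suc j)" using inv by (auto simp: duval_inv_def)
  show "duval_inv v n p 1 (Suc j)" if "e = 0" "v j < v (j - p)"
  proof -
    have "j \<noteq> 0" using that(2) by (cases j) auto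
    then show ?thesis using inv j L red that by (auto simp: duval_inv_def)
  qed
  show "duval_inv v n (Suc j) e (Suc j)" if "e = 0" "v (j - p) < v j"
    using that lyndon_extend[of v p j] inv red by (auto simp: duval_inv_def)
  show "duval_inv v n p e (Suc j)" if "e = 0" "v (j - p) = v j"
    using that inv red by (auto simp: duval_inv_def less_Suc_eq)
qed

lemma wp_duval_com:
  assumes "s ''n'' 0 = n" "0 < n"
  shows "wp duval_com (100 * n) (\<lambda>s'. duval (s ''v'') n (s' ''p'' 0)) s"
  unfolding duval_com_def
proof (rule wp_seq[where U = 20 and U' = "70 * n" and R = "\<lambda>s'. s' ''e'' 0 = 0 \<and> s' ''p'' 0 = 1"])
  let ?v = "s ''v''"
  fix s1 assume s1: "s1 ''e'' 0 = 0 \<and> s1 ''p'' 0 = 1"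
    "same (mods (Seq (set_var ''e'' (Const 0)) (set_var ''p'' (Const 1)))) s s1"
  have v1: "s1 ''v'' = ?v" "s1 ''n'' 0 = n" using s1(2) assms by auto
  show "wp (For ''i'' ''n'' duval_body) (70 * n) (\<lambda>s'. duval ?v n (s' ''p'' 0)) s1"
  proof (rule wp_for[where A = 45 and X = 1 and M = n and
      I = "\<lambda>j s'. duval_inv ?v n (s' ''p'' 0) (s' ''e'' 0) j"], goal_cases)
    case 5
    show ?case using s1 by (simp add: duval_inv_def lyndon_def)
  next
    case (6 j s')
    have v: "s' ''v'' = ?v" using 6(3) v1 by simp
    have "j < n" using 6 v1 by simp
    note st = duval_inv_step[OF 6(4) this]
    show ?case
      by (rule wp_straight) (use st in \<open>auto simp: duval_body_def 6(2) v\<close>)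
  next
    case (11 s')
    then have *: "duval_inv ?v n (s' ''p'' 0) (s' ''e'' 0) n" using v1 by simp
    let ?p = "s' ''p'' 0"
    have "lyndon ?v ?p" "?p \<le> n" using * assms by (auto simp: duval_inv_def)
    moreover have "\<exists>m\<le>n. (\<forall>i<m. ?v i = ?v (i mod ?p)) \<and> (m < n \<longrightarrow> ?v m < ?v (m mod ?p))"
      using * unfolding duval_inv_def by (metis (no_types, lifting) less_imp_le less_irrefl order_refl)
    ultimately show ?case by (simp add: duval_def)
  qed (use v1 assms in simp_all)
next
  show "wp (Seq (set_var ''e'' (Const 0)) (set_var ''p'' (Const 1))) 20 (\<lambda>s'. s' ''e'' 0 = 0 \<and> s' ''p'' 0 = 1) s"
    by (rule wp_straight) auto
  show "20 + 70 * n \<le> 100 * n" using assms by simp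
qed

subsection \<open>Rotations\<close>

definition zero_com :: com where
  "zero_com = For ''i'' ''nn'' (Assign ''W'' (V ''i'') (Const 0))"

lemma mods_zero_com[simp]: "mods zero_com = {''i'', ''W''}"
  by (auto simp: zero_com_def)

lemma wp_zero_com:
  assumes c: "ctx n k p v s" and n: "0 < n"
  shows "wp zero_com (40 * (n * n)) (\<lambda>s'. \<forall>m<n * n. s' ''W'' m = 0) s"
  unfolding zero_com_def
proof (rule wp_for[where A = 10 and X = 1 and M = "n * n" and I = "\<lambda>N s'. \<forall>m<N. s' ''W'' m = 0"], goal_cases)
  case (6 i s')
  from 6(4) have *: "\<forall>m<i. s' ''W'' m = 0" .
  show ?case by (rule wp_straight) (simp_all add: 6(2) * less_Suc_eq)
next
  case 7
  show ?case by (simp add: ctxD[OF c])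
next
  case (11 s')
  then show ?case by (simp add: ctxD[OF c])
qed (use n in simp_all)

definition mark_com :: com where
  "mark_com = For ''i'' ''p'' (Cond (Read ''W'' (Plus (Read ''b'' (V ''d'')) (V ''i'')))
     (Assign ''W'' (Plus (Read ''b'' (V ''d'')) (V ''i''))
       (Plus (Read ''W'' (Plus (Read ''b'' (V ''d'')) (V ''i''))) (Const 1))) Skip)"

definition hub_body :: com where
  "hub_body = Seq step_com (Seq (set_var ''d'' (Plus (V ''t'') (Const 1)))
     (Seq (Cond (Minus (V ''p'') (V ''d'')) mark_com Skip)
       (Assign ''T'' (V ''d'') (Plus (Read ''T'' (V ''d'')) (Read ''W'' (V ''q''))))))"

lemma mods_mark_com[simp]: "mods mark_com = {''i'', ''W''}"
  by (auto simp: mark_com_def)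

lemma mods_hub_body[simp]: "mods hub_body = {''x'', ''y'', ''U'', ''W'', ''i'', ''j'', ''c'', ''d'', ''T''}"
  by (auto simp: hub_body_def)

lemma wp_mark_com:
  assumes c: "ctx n k p v s" and n: "0 < n" and p: "p \<le> n" and d: "s ''d'' 0 = d" "d < p"
    and t: "table n p w s"
  shows "wp mark_com (60 * n) (table n p (\<lambda>i j. if i = d \<and> w i j \<noteq> 0 then Suc (w i j) else w i j)) s"
  unfolding mark_com_def
proof (rule wp_for[where A = 30 and X = 1 and M = n and
    I = "\<lambda>N. table n p (\<lambda>i j. if i = d \<and> j < N \<and> w i j \<noteq> 0 then Suc (w i j) else w i j)"], goal_cases)
  case (4 i s f)
  show ?case by (simp add: table_def)
next
  case 5
  show ?case using t by simp
next
  case (6 l s')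
  have l: "l < p" using 6(1) by (simp add: ctxD[OF c])
  have b: "s' ''b'' d = d * n" "s' ''d'' 0 = d" using 6(3) d p by (simp_all add: ctxD[OF c])
  have W: "s' ''W'' (i * n + j) = (if i = d \<and> j < l \<and> w i j \<noteq> 0 then Suc (w i j) else w i j)"
    if "i < p" "j < p" for i j using 6(4) that by (simp add: table_def)
  have U: "\<forall>m<n * n. s' ''U'' m = 0" using 6(4) by (simp add: table_def)
  have Wd: "s' ''W'' (d * n + l) = w d l" using W[OF d(2) l] by simp
  have pe: "i * n + j = d * n + l \<longleftrightarrow> i = d \<and> j = l" if "j < p" for i j
    using pair_eq[of j n l i d] that l p by simp
  show ?case
  proof (rule wp_straight, goal_cases)
    case 3
    show ?case unfolding table_def
      using U by (auto simp: 6(2) b Wd W pe less_Suc_eq)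
  qed simp_all
next
  case (11 s')
  then show ?case by (simp add: table_def ctxD[OF c])
qed (use n p in \<open>simp_all add: ctxD[OF c]\<close>)

lemma wp_hub_body:
  assumes c: "ctx n k p v s" and n: "0 < n" and k: "0 < k" and p: "p \<le> n"
    and t: "s ''t'' 0 = t" and q: "s ''q'' 0 = q" "q < p" and tab: "table n p (hub v p k q t) s"
  shows "wp hub_body (300 * (n * (n * k))) (\<lambda>s'. table n p (hub v p k q (Suc t)) s' \<and>
    s' ''T'' = (s ''T'')(Suc t := s ''T'' (Suc t) + hub v p k q (Suc t) 0 q)) s"
  unfolding hub_body_def
proof (rule wp_seq[OF wp_step_com[OF c p k n tab], where U' = "110 * n"], goal_cases)
  case (1 s1)
  let ?w = "step v p k (hub v p k q t)"
  have c1: "ctx n k p v s1" by (rule ctx_same[OF 1(2) c]) simp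
  have s1: "s1 ''t'' 0 = t" "s1 ''q'' 0 = q" "s1 ''T'' = s ''T''" using 1(2) t q by simp_all
  have hub: "hub v p k q (Suc t) = (if Suc t < p
    then \<lambda>i j. if i = Suc t \<and> ?w i j \<noteq> 0 then Suc (?w i j) else ?w i j else ?w)"
    by (auto simp: Let_def fun_eq_iff)
  show ?case
  proof (rule wp_seq[where U = 20 and U' = "90 * n" and R = "\<lambda>s'. s' = s1(''d'' := (s1 ''d'')(0 := Suc t))"], goal_cases)
    case 1
    show ?case by (rule wp_straight) (auto simp: s1)
  next
    case (2 s2)
    have c2: "ctx n k p v s2" by (rule ctx_same[OF 2(2) c1]) simp
    have s2: "s2 ''d'' 0 = Suc t" "s2 ''q'' 0 = q" "s2 ''T'' = s ''T''" "table n p ?w s2"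
      using 2(1) 1(1) s1 by (simp_all add: table_def)
    show ?case
    proof (rule wp_seq[where U = "70 * n" and U' = 20 and R = "table n p (hub v p k q (Suc t))"], goal_cases)
      case 1
      show ?case
      proof (rule wp_cond[where U = "60 * n"], goal_cases)
        case 1
        then have "Suc t < p" using s2 by (simp add: ctxD[OF c2])
        then show ?case unfolding hub using wp_mark_com[OF c2 n p s2(1) _ s2(4)] by simp
      next
        case 2
        then have "\<not> Suc t < p" using s2 by (simp add: ctxD[OF c2])
        then show ?case unfolding hub using n s2(4) by (intro wp_straight) simp_all
      qed (use n in simp)
    next
      case (2 s3)
      have s3: "s3 ''d'' 0 = Suc t" "s3 ''q'' 0 = q" "s3 ''T'' = s ''T''" using 2(2) s2 by simp_all
      \<comment> \<open>Row \<open>0\<close> has offset \<open>0\<close>, so cell \<open>q\<close>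
        of \<open>W\<close> is the entry for a forward run closing in \<open>0\<close> and a
        backward run closing in \<open>q\<close>.\<close>
      have "s3 ''W'' (0 * n + q) = hub v p k q (Suc t) 0 q"
        using 2(1) q unfolding table_def by blast
      then have W: "s3 ''W'' q = hub v p k q (Suc t) 0 q" by simp
      show ?case
        by (rule wp_straight) (use 2(1) in \<open>simp_all add: s3 W table_def del: hub.simps\<close>)
    qed (use n in simp)
  qed (use n in simp)
next
  case 2
  have "n * 1 \<le> n * (n * k)" "1 \<le> n" using n k by (auto simp: Suc_le_eq)
  then show ?case by linarith
qed

definition hub_com :: com where
  "hub_com = Seq zero_com (Seq (Assign ''W'' (V ''q'') (Const 1)) (For ''t'' ''n'' hub_body))"

definition rotation_com :: com where
  "rotation_com = Seq (For ''t'' ''n'' (Assign ''T'' (Plus (V ''t'') (Const 1)) (Const 0)))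
     (For ''q'' ''p'' hub_com)"

lemma mods_hub_com[simp]:
  "mods hub_com = {''x'', ''y'', ''U'', ''W'', ''i'', ''j'', ''c'', ''d'', ''T'', ''t''}"
  by (auto simp: hub_com_def)

lemma mods_rotation_com[simp]:
  "mods rotation_com = {''x'', ''y'', ''U'', ''W'', ''i'', ''j'', ''c'', ''d'', ''T'', ''t'', ''q''}"
  by (auto simp: rotation_com_def)

lemma wp_hub_com:
  assumes c: "ctx n k p v s" and n: "0 < n" and k: "0 < k" and p: "p \<le> n"
    and q: "s ''q'' 0 = q" "q < p" and U: "\<forall>m<n * n. s ''U'' m = 0"
  shows "wp hub_com (400 * (n * (n * (n * k)))) (\<lambda>s'. (\<forall>m<n * n. s' ''U'' m = 0) \<and>
    (\<forall>d\<in>{1..n}. s' ''T'' d = s ''T'' d + hub v p k q d 0 q)) s"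
  unfolding hub_com_def
proof (rule wp_seq[OF wp_zero_com[OF c n], where U' = "360 * (n * (n * (n * k)))"], goal_cases)
  case (1 s1)
  have c1: "ctx n k p v s1" by (rule ctx_same[OF 1(2) c]) simp
  have s1: "s1 ''q'' 0 = q" "s1 ''U'' = s ''U''" "s1 ''T'' = s ''T''" using 1(2) q by simp_all
  show ?case
  proof (rule wp_seq[where U = 20 and U' = "340 * (n * (n * (n * k)))" and R = "\<lambda>s'. s' = s1(''W'' := (s1 ''W'')(q := 1))"], goal_cases)
    case 1
    show ?case by (rule wp_straight) (auto simp: s1)
  next
    case (2 s2)
    have c2: "ctx n k p v s2" by (rule ctx_same[OF 2(2) c1]) simp
    have s2: "s2 ''q'' 0 = q" "s2 ''T'' = s ''T''" using 2(1) s1 by simp_all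
    have tab: "table n p (hub v p k q 0) s2"
    proof -
      have "i * n + j = q \<longleftrightarrow> i = 0 \<and> j = q" if "j < p" for i j
        using pair_eq[of j n q i 0] that q p by simp
      moreover have "s1 ''W'' (i * n + j) = 0" if "i < p" "j < p" for i j
        using 1(1) pair_less[of i n j] that p by simp
      ultimately show ?thesis using 2(1) U s1 by (simp add: table_def)
    qed
    show ?case
    proof (rule wp_for[where A = 300 and X = "n * (n * k)" and M = n and
        I = "\<lambda>t s'. table n p (hub v p k q t) s' \<and> (\<forall>d\<in>{1..t}. s' ''T'' d = s ''T'' d + hub v p k q d 0 q)
          \<and> (\<forall>d>t. s' ''T'' d = s ''T'' d)"], goal_cases)
      case (4 i s f)
      show ?case by (simp add: table_def del: hub.simps)
    next
      case 5
      show ?case using tab s2 by simp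
    next
      case (6 t s')
      have c': "ctx n k p v s'" by (rule ctx_same[OF 6(3) c2]) simp
      have q': "s' ''q'' 0 = q" using 6(3) s2 by simp
      show ?case
      proof (rule wp_conseq[OF wp_hub_body[OF c' n k p 6(2) q' q(2)]], goal_cases)
        case (3 z)
        have T: "s' ''T'' d = s ''T'' d + hub v p k q d 0 q" if "d \<in> {1..t}" for d using 6(4) that by blast
        have T': "s' ''T'' d = s ''T'' d" if "t < d" for d using 6(4) that by blast
        have "z ''T'' d = s ''T'' d + hub v p k q d 0 q" if "d \<in> {1..Suc t}" for d
        proof (cases "d = Suc t")
          case True
          then show ?thesis using 3(1) T'[of d] by (simp del: hub.simps)
        next
          case False
          then show ?thesis using 3(1) T[of d] that by (simp del: hub.simps)
        qed
        moreover have "z ''T'' d = s ''T'' d" if "Suc t < d" for d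
          using 3(1) T'[of d] that by (simp del: hub.simps)
        ultimately show ?case using 3(1) by blast
      qed (use 6(4) in blast, rule order_refl)
    next
      case (11 s')
      then show ?case by (simp add: ctxD[OF c2] table_def del: hub.simps)
    qed (use n k in \<open>simp_all add: ctxD[OF c2]\<close>)
  next
    case 3
    have "1 \<le> n * (n * (n * k))" using n k by (simp add: Suc_le_eq)
    then show ?case by simp
  qed
next
  case 2
  have "n * n \<le> n * (n * (n * k))" using n k by simp
  then show ?case by linarith
qed

lemma wp_rotation_com:
  assumes c: "ctx n k p v s" and n: "0 < n" and k: "0 < k" and p: "p \<le> n"
    and U: "\<forall>m<n * n. s ''U'' m = 0"
  shows "wp rotation_com (500 * (n * (n * (n * (n * k))))) (\<lambda>s'. (\<forall>m<n * n. s' ''U'' m = 0) \<and>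
    (\<forall>d\<in>{1..n}. s' ''T'' d = (\<Sum>q<p. hub v p k q d 0 q))) s"
  unfolding rotation_com_def
proof (rule wp_seq[where U = "60 * n" and U' = "440 * (n * (n * (n * (n * k))))" and R = "\<lambda>s'. \<forall>d\<in>{1..n}. s' ''T'' d = 0"], goal_cases)
  case 1
  show ?case
  proof (rule wp_for[where A = 20 and X = 1 and M = n and I = "\<lambda>t s'. \<forall>d\<in>{1..t}. s' ''T'' d = 0"], goal_cases)
    case (6 t s')
    show ?case by (rule wp_straight) (use 6(4) in \<open>auto simp: 6(2)\<close>)
  qed (use n in \<open>simp_all add: ctxD[OF c]\<close>)
next
  case (2 s1)
  have c1: "ctx n k p v s1" by (rule ctx_same[OF 2(2) c]) simp
  have U1: "s1 ''U'' = s ''U''" using 2(2) by simp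
  show ?case
  proof (rule wp_for[where A = 400 and X = "n * (n * (n * k))" and M = n and
      I = "\<lambda>q s'. (\<forall>m<n * n. s' ''U'' m = 0) \<and> (\<forall>d\<in>{1..n}. s' ''T'' d = (\<Sum>q<q. hub v p k q d 0 q))"], goal_cases)
    case 5
    show ?case using 2(1) U U1 by simp
  next
    case (6 q s')
    have c': "ctx n k p v s'" by (rule ctx_same[OF 6(3) c1]) simp
    have q: "q < p" using 6(1) by (simp add: ctxD[OF c1])
    show ?case
      by (rule wp_conseq[OF wp_hub_com[OF c' n k p 6(2) q]]) (use 6(4) in simp_all)
  qed (use n k p in \<open>simp_all add: ctxD[OF c1]\<close>)
next
  case 3
  have "n * 1 \<le> n * (n * (n * (n * k)))" using n k by (intro mult_le_mono2) (simp add: Suc_le_eq)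
  then show ?case by linarith
qed

text \<open>Euclid's algorithm by subtraction. At most one of the two truncated differences is
  nonzero, so their sum tests whether \<open>x\<close> and \<open>y\<close> differ.\<close>

definition gcd_loop :: com where
  "gcd_loop = While (Plus (Minus (V ''x'') (V ''y'')) (Minus (V ''y'') (V ''x'')))
     (Cond (Minus (V ''x'') (V ''y'')) (set_var ''x'' (Minus (V ''x'') (V ''y'')))
       (set_var ''y'' (Minus (V ''y'') (V ''x''))))"

definition gcd_com :: com where
  "gcd_com = For ''t'' ''n'' (Seq (Seq (set_var ''x'' (Plus (V ''t'') (Const 1))) (set_var ''y'' (V ''n'')))
     (Seq gcd_loop (set_var ''S'' (Plus (V ''S'') (Read ''T'' (V ''x''))))))"

lemma mods_gcd_loop[simp]: "mods gcd_loop = {''x'', ''y''}"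
  by (auto simp: gcd_loop_def)

lemma mods_gcd_com[simp]: "mods gcd_com = {''x'', ''y'', ''t'', ''S''}"
  by (auto simp: gcd_com_def)

text \<open>Each round lowers \<open>x + y\<close> by at least one. Linear time is good enough, as
  the \<open>n\<close> calls together cost only \<open>O(n^2)\<close>.\<close>

lemma wp_gcd_loop:
  assumes "0 < s ''x'' 0" "0 < s ''y'' 0"
  shows "wp gcd_loop (30 * (s ''x'' 0 + s ''y'' 0)) (\<lambda>s'. s' ''x'' 0 = gcd (s ''x'' 0) (s ''y'' 0)) s"
  using assms
proof (induction "s ''x'' 0 + s ''y'' 0" arbitrary: s rule: less_induct)
  case less
  let ?b = "Plus (Minus (V ''x'') (V ''y'')) (Minus (V ''y'') (V ''x''))"
  let ?c = "Cond (Minus (V ''x'') (V ''y'')) (set_var ''x'' (Minus (V ''x'') (V ''y'')))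
       (set_var ''y'' (Minus (V ''y'') (V ''x'')))"
  let ?x = "s ''x'' 0" and ?y = "s ''y'' 0"
  show ?case
  proof (cases "?x = ?y")
    case True
    then have "exec gcd_loop s (cost ?b + 1) s" unfolding gcd_loop_def by (intro exec.WhileFalse) simp
    then show ?thesis unfolding wp_def
      using True less.prems by (intro exI[of _ "cost ?b + 1"] exI[of _ s]) auto
  next
    case False
    define s1 where "s1 = post ?c s"
    have s1: "s1 ''x'' 0 = (if ?y < ?x then ?x - ?y else ?x)" "s1 ''y'' 0 = (if ?y < ?x then ?y else ?y - ?x)"
      by (auto simp: s1_def)
    then have dec: "s1 ''x'' 0 + s1 ''y'' 0 < ?x + ?y" and pos: "0 < s1 ''x'' 0" "0 < s1 ''y'' 0"
      using False less.prems by auto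
    have g: "gcd (s1 ''x'' 0) (s1 ''y'' 0) = gcd ?x ?y"
    proof (cases "?y < ?x")
      case True
      then show ?thesis using s1 by (simp add: gcd_diff1_nat)
    next
      case False
      then have "gcd (?y - ?x) ?x = gcd ?y ?x" by (intro gcd_diff1_nat) simp
      then show ?thesis using s1 False by (simp add: gcd.commute)
    qed
    have "wp ?c 13 (\<lambda>s'. s' = s1) s" by (rule wp_straight) (auto simp: s1_def)
    then obtain t1 where t1: "exec ?c s t1 s1" "t1 \<le> 13" by (auto simp: wp_def)
    obtain t2 s2 where t2: "exec gcd_loop s1 t2 s2" "t2 \<le> 30 * (s1 ''x'' 0 + s1 ''y'' 0)"
      "s2 ''x'' 0 = gcd ?x ?y"
      using less.hyps[of s1, OF dec pos] by (auto simp: wp_def g)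
    have "exec gcd_loop s (cost ?b + 1 + t1 + t2) s2"
      unfolding gcd_loop_def
      by (rule exec.WhileTrue[OF _ t1(1) t2(1)[unfolded gcd_loop_def]]) (use False in auto)
    moreover have "cost ?b + 1 + t1 + t2 \<le> 30 * (?x + ?y)" using t1(2) t2(2) dec by simp
    ultimately show ?thesis using t2(3) unfolding wp_def by blast
  qed
qed

lemma wp_gcd_com:
  assumes n: "s ''n'' 0 = n" "0 < n"
  shows "wp gcd_com (200 * (n * n)) (\<lambda>s'. s' ''S'' 0 = s ''S'' 0 + (\<Sum>r<n. s ''T'' (gcd (Suc r) n))) s"
  unfolding gcd_com_def
proof (rule wp_for[where A = 150 and X = n and M = n and
    I = "\<lambda>N s'. s' ''S'' 0 = s ''S'' 0 + (\<Sum>r<N. s ''T'' (gcd (Suc r) n))"], goal_cases)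
  case (6 r s1)
  have r: "r < n" "s1 ''n'' 0 = n" "s1 ''T'' = s ''T''" using 6(1,3) n by simp_all
  show ?case
  proof (rule wp_seq[where U = 30 and U' = "120 * n" and R = "\<lambda>s'. s' ''x'' 0 = Suc r \<and> s' ''y'' 0 = n"], goal_cases)
    case 1
    show ?case by (rule wp_straight) (auto simp: 6(2) r)
  next
    case (2 s2)
    show ?case
    proof (rule wp_seq[OF wp_gcd_loop, where U' = 20], goal_cases)
      case (3 s3)
      have x: "s3 ''x'' 0 = gcd (Suc r) n" using 3(1) 2(1) by simp
      have S: "s3 ''S'' = s1 ''S''" "s3 ''T'' = s ''T''" using 2(2) 3(2) r by simp_all
      show ?case by (rule wp_straight) (use 6(4) in \<open>simp_all add: x S\<close>)
    qed (use 2(1) r n in simp_all)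
  qed (use n in simp)
next
  case (11 s')
  then show ?case by (simp add: n)
qed (use n in simp_all)

subsection \<open>Reflections\<close>

definition half_com :: com where
  "half_com = Seq (Seq (set_var ''h'' (Const 0)) (set_var ''o'' (Const 0)))
     (For ''t'' ''n'' (Cond (V ''o'') (Seq (set_var ''h'' (Plus (V ''h'') (Const 1))) (set_var ''o'' (Const 0)))
        (set_var ''o'' (Const 1))))"

definition steps_com :: com where
  "steps_com = For ''t'' ''m'' step_com"

definition start_gap_com :: com where
  "start_gap_com = Seq zero_com (For ''i'' ''p'' (Assign ''W'' (cell ''i'' ''i'') (Const 1)))"

definition start_letter_com :: com where
  "start_letter_com = Seq zero_com (For ''j'' ''p'' (For ''c'' ''k''
     (Cond (Minus (Read ''v'' (V ''j'')) (V ''c'')) Skip (Seq (delta ''x'' ''j'')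
        (Assign ''W'' (cell ''x'' ''j'') (Plus (Read ''W'' (cell ''x'' ''j'')) (Const 1)))))))"

definition end_gap_com :: com where
  "end_gap_com = For ''i'' ''p'' (set_var ''z'' (Plus (V ''z'') (Read ''W'' (cell ''i'' ''i''))))"

definition end_letter_com :: com where
  "end_letter_com = For ''i'' ''p'' (For ''c'' ''k''
     (Cond (Minus (Read ''v'' (V ''i'')) (V ''c'')) Skip (Seq (delta ''x'' ''i'')
        (set_var ''z'' (Plus (V ''z'') (Read ''W'' (cell ''i'' ''x'')))))))"

lemma mods_reflection_parts[simp]:
  "mods half_com = {''h'', ''o'', ''t''}"
  "mods steps_com = {''t'', ''x'', ''y'', ''U'', ''W'', ''i'', ''j'', ''c''}"
  "mods start_gap_com = {''i'', ''W''}"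
  "mods start_letter_com = {''i'', ''j'', ''c'', ''x'', ''W''}"
  "mods end_gap_com = {''i'', ''z''}"
  "mods end_letter_com = {''i'', ''c'', ''x'', ''z''}"
  by (auto simp: half_com_def steps_com_def start_gap_com_def start_letter_com_def end_gap_com_def end_letter_com_def)

lemma wp_half_com:
  assumes n: "s ''n'' 0 = n" "0 < n"
  shows "wp half_com (80 * n) (\<lambda>s'. s' ''h'' 0 = n div 2 \<and> s' ''o'' 0 = n mod 2) s"
  unfolding half_com_def
proof (rule wp_seq[where U = 20 and U' = "60 * n" and R = "\<lambda>s'. s' ''h'' 0 = 0 \<and> s' ''o'' 0 = 0"], goal_cases)
  case 1
  show ?case by (rule wp_straight) auto
next
  case (2 s1)
  have n1: "s1 ''n'' 0 = n" using 2(2) n by simp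
  show ?case
  proof (rule wp_for[where A = 30 and X = 1 and M = n and I = "\<lambda>N s'. s' ''h'' 0 = N div 2 \<and> s' ''o'' 0 = N mod 2"], goal_cases)
    case (6 t s')
    show ?case
      by (rule wp_straight, simp, simp) (cases "even t"; use 6(4) in \<open>auto elim!: evenE oddE\<close>)
  next
    case (11 s')
    then show ?case by (simp add: n1)
  qed (use 2 n n1 in simp_all)
qed (use n in simp)

lemma wp_steps_com:
  assumes c: "ctx n k p v s" and p: "p \<le> n" and k: "0 < k" and n: "0 < n" and t: "table n p w s"
    and m: "s ''m'' 0 = m" "m \<le> n"
  shows "wp steps_com (250 * (n * (n * (n * k)))) (table n p ((step v p k ^^ m) w)) s"
  unfolding steps_com_def
proof (rule wp_for[where A = 190 and X = "n * (n * k)" and M = n and I = "\<lambda>t. table n p ((step v p k ^^ t) w)"], goal_cases)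
  case (4 i s f)
  show ?case by (simp add: table_def)
next
  case (6 i s')
  have "ctx n k p v s'" by (rule ctx_same[OF 6(3) c]) simp
  from wp_step_com[OF this p k n 6(4)] show ?case by simp
qed (use t m n k in simp_all)

lemma wp_start_gap_com:
  assumes c: "ctx n k p v s" and p: "p \<le> n" and n: "0 < n" and U: "\<forall>m<n * n. s ''U'' m = 0"
  shows "wp start_gap_com (100 * (n * n)) (table n p start_gap) s"
  unfolding start_gap_com_def
proof (rule wp_seq[OF wp_zero_com[OF c n], where U' = "60 * n"], goal_cases)
  case (1 s1)
  have c1: "ctx n k p v s1" by (rule ctx_same[OF 1(2) c]) simp
  have U1: "s1 ''U'' = s ''U''" using 1(2) by simp
  have W1: "s1 ''W'' (i * n + j) = 0" if "i < p" "j < p" for i j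
    using 1(1) pair_less[of i n j] that p by simp
  show ?case
  proof (rule wp_for[where A = 20 and X = 1 and M = n and
      I = "\<lambda>N. table n p (\<lambda>i j. of_bool (i = j \<and> i < N))"], goal_cases)
    case (4 i s f)
    show ?case by (simp add: table_def)
  next
    case 5
    show ?case using W1 U U1 by (simp add: table_def)
  next
    case (6 l s')
    have l: "l < p" using 6(1) by (simp add: ctxD[OF c1])
    have b: "s' ''b'' l = l * n" using 6(3) l p by (simp add: ctxD[OF c1])
    have pe: "i * n + j = l * n + l \<longleftrightarrow> i = l \<and> j = l" if "j < p" for i j
      using pair_eq[of j n l i l] that l p by simp
    show ?case
    proof (rule wp_straight, goal_cases)
      case 3
      show ?case
        using 6(4) unfolding table_def by (auto simp: cell_def 6(2) b pe less_Suc_eq)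
    qed (simp_all add: cell_def)
  next
    case (11 s')
    then show ?case by (simp add: table_def start_gap_def ctxD[OF c1])
  qed (use n p in \<open>simp_all add: ctxD[OF c1]\<close>)
next
  case 2
  show ?case using n by (simp add: Suc_le_eq)
qed

lemma wp_start_letter_com:
  assumes c: "ctx n k p v s" and p: "p \<le> n" and n: "0 < n" and k: "0 < k" and U: "\<forall>m<n * n. s ''U'' m = 0"
  shows "wp start_letter_com (200 * (n * (n * k))) (table n p (start_letter v p k)) s"
  unfolding start_letter_com_def
proof (rule wp_seq[OF wp_zero_com[OF c n], where U' = "150 * (n * k)"], goal_cases)
  case (1 s1)
  have c1: "ctx n k p v s1" by (rule ctx_same[OF 1(2) c]) simp
  have U1: "s1 ''U'' = s ''U''" using 1(2) by simp
  have W1: "s1 ''W'' (i * n + j) = 0" if "i < p" "j < p" for i j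
    using 1(1) pair_less[of i n j] that p by simp
  let ?body = "Cond (Minus (Read ''v'' (V ''j'')) (V ''c'')) Skip (Seq (delta ''x'' ''j'')
        (Assign ''W'' (cell ''x'' ''j'') (Plus (Read ''W'' (cell ''x'' ''j'')) (Const 1))))"
  let ?g = "\<lambda>j a m. of_bool (v j \<le> a \<and> nxt v p j a * n + j = m) :: nat"
  have inner: "wp (For ''c'' ''k'' ?body) (100 * k) (\<lambda>z. z ''W'' = (\<lambda>m. s' ''W'' m + (\<Sum>a<k. ?g j a m))) s'"
    if s': "same {''W'', ''j'', ''c'', ''x''} s1 s'" and j: "s' ''j'' 0 = j" "j < p" for s' j
  proof (rule wp_for_add[where B = "''W''" and A = 70 and X = 1 and M = k and g = "?g j"], goal_cases)
    case (5 a s2)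
    have s2: "same {''W'', ''j'', ''c'', ''x''} s1 s2" using s' 5(3) by simp
    have c2: "ctx n k p v s2" by (rule ctx_same[OF s2 c1]) simp
    have j2: "s2 ''j'' 0 = j" using 5(3) j by simp
    have x: "nxt v p j a < p" using nxt_less j by blast
    have b: "s2 ''b'' (nxt v p j a) = nxt v p j a * n" using x p by (simp add: ctxD[OF c2])
    have e: "post (delta ''x'' ''j'') s2 = s2(''x'' := (s2 ''x'')(0 := nxt v p j a))"
      using post_delta[OF c2, of "''j''" "''x''"] j j2 5(2) by simp
    show ?case
      by (rule wp_straight) (auto simp: cell_def e b j2 5(2) ctxD[OF c2] fun_eq_iff)
  next
    case 6
    then show ?case using s' by (simp add: ctxD[OF c1])
  next
    case (10 s2)
    then show ?case using s' by (simp add: ctxD[OF c1])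
  qed (use k in simp_all)
  show ?case
  proof (rule wp_for_add[where B = "''W''" and A = 100 and X = k and M = n and g = "\<lambda>j m. \<Sum>a<k. ?g j a m"], goal_cases)
    case (5 j s')
    show ?case by (rule inner) (use 5 in \<open>simp_all add: ctxD[OF c1]\<close>)
  next
    case (10 s')
    have "s' ''W'' (x * n + y) = start_letter v p k x y" if xy: "x < p" "y < p" for x y
    proof -
      have "s' ''W'' (x * n + y) = (\<Sum>j<p. \<Sum>a<k. ?g j a (x * n + y))"
        using 10(1) W1[OF xy] by (simp add: ctxD[OF c1])
      also have "\<dots> = (\<Sum>j<p. if j = y then (\<Sum>a<k. of_bool (v y \<le> a \<and> nxt v p y a = x)) else 0)"
      proof (intro sum.cong refl)
        fix j assume "j \<in> {..<p}"
        then have *: "j < n" "y < n" using xy p by auto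
        show "(\<Sum>a<k. ?g j a (x * n + y)) = (if j = y then (\<Sum>a<k. of_bool (v y \<le> a \<and> nxt v p y a = x)) else 0)"
          unfolding pair_eq[OF *] by (cases "j = y") simp_all
      qed
      also have "\<dots> = start_letter v p k x y" using xy by (simp add: start_letter_def)
      finally show ?thesis .
    qed
    moreover have "s' ''U'' = s ''U''" using 10(2) U1 by simp
    ultimately show ?case using U by (simp add: table_def)
  qed (use n k p in \<open>simp_all add: ctxD[OF c1]\<close>)
next
  case 2
  have "n * n \<le> n * (n * k)" "n * k \<le> n * (n * k)" using n k by simp_all
  then show ?case by linarith
qed

lemma wp_end_gap_com:
  assumes c: "ctx n k p v s" and p: "p \<le> n" and n: "0 < n" and t: "table n p w s"
  shows "wp end_gap_com (60 * n) (\<lambda>s'. s' ''z'' 0 = s ''z'' 0 + end_gap p w) s"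
  unfolding end_gap_com_def
proof (rule wp_for[where A = 30 and X = 1 and M = n and I = "\<lambda>N s'. s' ''z'' 0 = s ''z'' 0 + (\<Sum>i<N. w i i)"], goal_cases)
  case (6 i s')
  have i: "i < p" using 6(1) by (simp add: ctxD[OF c])
  have W: "s' ''W'' (i * n + i) = w i i" "s' ''b'' i = i * n"
    using 6(3) t i p by (simp_all add: table_def ctxD[OF c])
  show ?case by (rule wp_straight) (use 6(4) in \<open>simp_all add: cell_def 6(2) W\<close>)
next
  case (11 s')
  then show ?case by (simp add: end_gap_def ctxD[OF c])
qed (use n p in \<open>simp_all add: ctxD[OF c]\<close>)

lemma wp_end_letter_com:
  assumes c: "ctx n k p v s" and p: "p \<le> n" and n: "0 < n" and k: "0 < k" and t: "table n p w s"
  shows "wp end_letter_com (150 * (n * k)) (\<lambda>s'. s' ''z'' 0 = s ''z'' 0 + end_letter v p k w) s"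
proof -
  let ?body = "Cond (Minus (Read ''v'' (V ''i'')) (V ''c'')) Skip (Seq (delta ''x'' ''i'')
        (set_var ''z'' (Plus (V ''z'') (Read ''W'' (cell ''i'' ''x'')))))"
  let ?g = "\<lambda>i a. if v i \<le> a then w i (nxt v p i a) else 0"
  have inner: "wp (For ''c'' ''k'' ?body) (100 * k) (\<lambda>z. z ''z'' 0 = s' ''z'' 0 + (\<Sum>a<k. ?g i a)) s'"
    if s': "same {''z'', ''i'', ''c'', ''x''} s s'" and i: "s' ''i'' 0 = i" "i < p" for s' i
  proof (rule wp_for[where A = 70 and X = 1 and M = k and I = "\<lambda>N z. z ''z'' 0 = s' ''z'' 0 + (\<Sum>a<N. ?g i a)"], goal_cases)
    case (6 a s2)
    have s2: "same {''z'', ''i'', ''c'', ''x''} s s2" using s' 6(3) by simp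
    have c2: "ctx n k p v s2" by (rule ctx_same[OF s2 c]) simp
    have i2: "s2 ''i'' 0 = i" using 6(3) i by simp
    have x: "nxt v p i a < p" using nxt_less i by blast
    have W: "s2 ''W'' (i * n + nxt v p i a) = w i (nxt v p i a)" using s2 t i x by (simp add: table_def)
    have b: "s2 ''b'' i = i * n" using i p by (simp add: ctxD[OF c2])
    have e: "post (delta ''x'' ''i'') s2 = s2(''x'' := (s2 ''x'')(0 := nxt v p i a))"
      using post_delta[OF c2, of "''i''" "''x''"] i i2 6(2) by simp
    show ?case
      by (rule wp_straight) (use 6(4) in \<open>auto simp: cell_def e b i2 6(2) W ctxD[OF c2]\<close>)
  next
    case 7
    then show ?case using s' by (simp add: ctxD[OF c])
  next
    case (11 s2)
    then show ?case using s' by (simp add: ctxD[OF c])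
  qed (use k in simp_all)
  show ?thesis unfolding end_letter_com_def
  proof (rule wp_for[where A = 100 and X = k and M = n and I = "\<lambda>N z. z ''z'' 0 = s ''z'' 0 + (\<Sum>i<N. \<Sum>a<k. ?g i a)"], goal_cases)
    case (6 i s')
    have "i < p" using 6(1) by (simp add: ctxD[OF c])
    show ?case
      by (rule wp_conseq[OF inner[of s' i] order_refl]) (use 6 \<open>i < p\<close> in simp_all)
  next
    case (11 s')
    then show ?case by (simp add: end_letter_def ctxD[OF c])
  qed (use n k p in \<open>simp_all add: ctxD[OF c]\<close>)
qed

text \<open>By conjugation with rotations, all \<open>n\<close> reflections contribute the same number if \<open>n\<close> is odd, and
  \<open>n div 2\<close> of them each of two numbers if \<open>n\<close> is even.\<close>

definition reflection_com :: com where
  "reflection_com = Seq (Seq half_com (Seq (set_var ''z'' (Const 0))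
       (Seq start_gap_com (Seq (set_var ''m'' (V ''h'')) (Seq steps_com
         (Cond (V ''o'') (Seq end_letter_com (set_var ''m'' (V ''n'')))
           (Seq end_gap_com (Seq (set_var ''m'' (Minus (V ''h'') (Const 1)))
             (Seq start_letter_com (Seq steps_com (Seq end_letter_com
               (set_var ''m'' (V ''h'')))))))))))))
     (For ''t'' ''m'' (set_var ''S'' (Plus (V ''S'') (V ''z''))))"

definition count_com :: com where
  "count_com = Seq (set_var ''S'' (Const 0))
     (Seq duval_com (Seq rotation_com (Seq gcd_com reflection_com)))"

definition reflection_mods :: "string set" where
  "reflection_mods = {''h'', ''o'', ''z'', ''m'', ''t'', ''x'', ''y'', ''U'', ''W'', ''i'', ''j'', ''c'', ''S''}"

lemma mods_reflection_com[simp]: "mods reflection_com = reflection_mods"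
  by (auto simp: reflection_com_def reflection_mods_def)

lemma mods_count_com[simp]:
  "mods count_com = {''h'', ''o'', ''z'', ''m'', ''t'', ''x'', ''y'', ''U'', ''W'', ''i'', ''j'', ''c'', ''S'',
     ''e'', ''p'', ''d'', ''T'', ''q''}"
  by (auto simp: count_com_def reflection_mods_def)

lemma tableU: "table n p w s \<Longrightarrow> \<forall>m<n * n. s ''U'' m = 0"
  by (simp add: table_def)

lemma table_same:
  "same A s s' \<Longrightarrow> ''W'' \<notin> A \<Longrightarrow> ''U'' \<notin> A \<Longrightarrow> table n p w s \<Longrightarrow> table n p w s'"
  by (simp add: table_def)

lemma wp_reflection_com:
  assumes c: "ctx n k p v s" and n: "0 < n" and k: "0 < k" and p: "p \<le> n"
    and U: "\<forall>m<n * n. s ''U'' m = 0"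
  shows "wp reflection_com (2000 * (n * (n * (n * k)))) (\<lambda>s'. (\<forall>m<n * n. s' ''U'' m = 0) \<and>
    s' ''S'' 0 = s ''S'' 0 +
    (if odd n then n * end_letter v p k ((step v p k ^^ (n div 2)) start_gap)
     else n div 2 * (end_gap p ((step v p k ^^ (n div 2)) start_gap) +
        end_letter v p k ((step v p k ^^ (n div 2 - 1)) (start_letter v p k))))) s"
proof -
  let ?K = "n * (n * (n * k))" and ?h = "n div 2"
  let ?A = "(step v p k ^^ ?h) start_gap" and ?B = "(step v p k ^^ (?h - 1)) (start_letter v p k)"
  let ?z = "if odd n then end_letter v p k ?A else end_gap p ?A + end_letter v p k ?B"
  \<comment> \<open>\<open>m\<close> first holds numbers of steps and finally the multiplicity
    \<open>?m\<close>; the last loop replaces a multiplication by adding \<open>z\<close> that many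
    times.\<close>
  let ?m = "if odd n then n else ?h"
  have K: "1 \<le> ?K" "n \<le> ?K" "n * n \<le> ?K" "n * k \<le> ?K" "n * (n * k) \<le> ?K"
  proof -
    show "1 \<le> ?K" using n k by (simp add: Suc_le_eq)
    have "n * 1 \<le> ?K" using n k by (intro mult_le_mono2) (simp add: Suc_le_eq)
    then show "n \<le> ?K" by simp
    have "n * (n * 1) \<le> ?K" using n k by (intro mult_le_mono2) (simp add: Suc_le_eq)
    then show "n * n \<le> ?K" by simp
    show "n * k \<le> ?K" "n * (n * k) \<le> ?K" using n by simp_all
  qed
  have end_letter: "wp (Seq end_letter_com (set_var ''m'' (V x))) (200 * ?K)
      (\<lambda>z. z ''z'' 0 = s' ''z'' 0 + end_letter v p k w \<and> z ''m'' 0 = s' x 0 \<and> (\<forall>m<n * n. z ''U'' m = 0)) s'"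
    if "ctx n k p v s'" "table n p w s'" "x \<in> {''n'', ''h''}" for s' w x
  proof (rule wp_seq[OF wp_end_letter_com[OF that(1) p n k that(2)], where U' = 10], goal_cases)
    case (1 z)
    have "x \<notin> mods end_letter_com" using that(3) by auto
    then have e: "z x = s' x" "z ''U'' = s' ''U''" using 1(2) by simp_all
    have "\<forall>m<n * n. z ''U'' m = 0" unfolding e by (rule tableU[OF that(2)])
    then show ?case by (intro wp_straight) (simp_all add: 1(1) e)
  qed (use K in linarith)
  show ?thesis unfolding reflection_com_def
  proof (rule wp_seq[where U = "1900 * ?K" and U' = "40 * n" and
      R = "\<lambda>z. z ''z'' 0 = ?z \<and> z ''m'' 0 = ?m \<and> (\<forall>m<n * n. z ''U'' m = 0)"], goal_cases)
    case 1
    show ?case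
    proof (rule wp_seq[OF wp_half_com[of s n, OF ctxD(1)[OF c] n], where U' = "1800 * ?K"], goal_cases)
      case half: (1 s1)
      have c1: "ctx n k p v s1" by (rule ctx_same[OF half(2) c]) simp
      have U1: "\<forall>m<n * n. s1 ''U'' m = 0" using half(2) U by simp
      show ?case
      proof (rule wp_seq[where U = 10 and U' = "1700 * ?K" and R = "\<lambda>z. z = s1(''z'' := (s1 ''z'')(0 := 0))"], goal_cases)
        case 1
        show ?case by (rule wp_straight) auto
      next
        case (2 s2)
        have c2: "ctx n k p v s2" by (rule ctx_same[OF 2(2) c1]) simp
        have s2: "s2 ''h'' 0 = ?h" "s2 ''o'' 0 = n mod 2" "s2 ''z'' 0 = 0" "\<forall>m<n * n. s2 ''U'' m = 0"
          using 2(1) half(1) U1 by simp_all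
        show ?case
        proof (rule wp_seq[OF wp_start_gap_com[OF c2 p n s2(4)], where U' = "1600 * ?K"], goal_cases)
          case (1 s3)
          have c3: "ctx n k p v s3" by (rule ctx_same[OF 1(2) c2]) simp
          have s3: "s3 ''h'' 0 = ?h" "s3 ''o'' 0 = n mod 2" "s3 ''z'' 0 = 0" using 1(2) s2 by simp_all
          show ?case
          proof (rule wp_seq[where U = 10 and U' = "1500 * ?K" and R = "\<lambda>z. z = s3(''m'' := (s3 ''m'')(0 := ?h))"], goal_cases)
            case 1
            show ?case by (rule wp_straight) (auto simp: s3)
          next
            case (2 s4)
            have c4: "ctx n k p v s4" by (rule ctx_same[OF 2(2) c3]) simp
            have t4: "table n p start_gap s4" by (rule table_same[OF 2(2) _ _ 1(1)]) simp_all
            have s4: "s4 ''h'' 0 = ?h" "s4 ''o'' 0 = n mod 2" "s4 ''z'' 0 = 0" "s4 ''m'' 0 = ?h"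
              using 2(1) s3 by simp_all
            show ?case
            proof (rule wp_seq[OF wp_steps_com[OF c4 p k n t4 s4(4)], where U' = "1200 * ?K"], goal_cases)
              case (2 s5)
              have c5: "ctx n k p v s5" by (rule ctx_same[OF 2(2) c4]) simp
              have s5: "s5 ''h'' 0 = ?h" "s5 ''o'' 0 = n mod 2" "s5 ''z'' 0 = 0"
                using 2(2) s4 by simp_all
              show ?case
              proof (rule wp_cond[where U = "1100 * ?K"], goal_cases)
                case 1
                then have "odd n" using s5 by (simp add: odd_iff_mod_2_eq_one)
                then show ?case
                  by (intro wp_conseq[OF end_letter[OF c5 2(1), of "''n''"]]) (auto simp: s5 ctxD[OF c5])
              next
                case c0: 2
                then have ev: "even n" using s5 by (simp add: even_iff_mod_2_eq_zero)
                show ?case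
                proof (rule wp_seq[OF wp_end_gap_com[OF c5 p n 2(1)], where U' = "1000 * ?K"], goal_cases)
                  case (1 s6)
                  have c6: "ctx n k p v s6" by (rule ctx_same[OF 1(2) c5]) simp
                  have s6: "s6 ''h'' 0 = ?h" "s6 ''z'' 0 = end_gap p ?A" "\<forall>m<n * n. s6 ''U'' m = 0"
                    using 1 s5 tableU[OF 2(1)] by simp_all
                  show ?case
                  proof (rule wp_seq[where U = 10 and U' = "900 * ?K" and R = "\<lambda>z. z = s6(''m'' := (s6 ''m'')(0 := ?h - 1))"], goal_cases)
                    case 1
                    show ?case by (rule wp_straight) (auto simp: s6)
                  next
                    case (2 s7)
                    have c7: "ctx n k p v s7" by (rule ctx_same[OF 2(2) c6]) simp
                    have s7: "s7 ''h'' 0 = ?h" "s7 ''z'' 0 = end_gap p ?A" "s7 ''m'' 0 = ?h - 1" "\<forall>m<n * n. s7 ''U'' m = 0"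
                      using 2(1) s6 by simp_all
                    show ?case
                    proof (rule wp_seq[OF wp_start_letter_com[OF c7 p n k s7(4)], where U' = "600 * ?K"], goal_cases)
                      case (1 s8)
                      have c8: "ctx n k p v s8" by (rule ctx_same[OF 1(2) c7]) simp
                      have s8: "s8 ''h'' 0 = ?h" "s8 ''z'' 0 = end_gap p ?A" "s8 ''m'' 0 = ?h - 1"
                        using 1(2) s7 by simp_all
                      show ?case
                      proof (rule wp_seq[OF wp_steps_com[OF c8 p k n 1(1) s8(3)], where U' = "300 * ?K"], goal_cases)
                        case (2 s9)
                        have c9: "ctx n k p v s9" by (rule ctx_same[OF 2(2) c8]) simp
                        have s9: "s9 ''h'' 0 = ?h" "s9 ''z'' 0 = end_gap p ?A" using 2(2) s8 by simp_all
                        show ?case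
                          by (rule wp_conseq[OF end_letter[OF c9 2(1), of "''h''"]]) (simp_all add: s9 ev)
                      qed (use K in linarith)+
                    qed (use K in linarith)
                  qed (use K in linarith)
                qed (use K in linarith)
              qed (simp only: cost.simps, use K(1) in linarith)
            qed (use K in linarith)+
          qed (use K in linarith)
        qed (use K in linarith)
      qed (use K in linarith)
    qed (use K in linarith)
  next
    case (2 s1)
    have S: "s1 ''S'' = s ''S''" using 2(2) by simp
    have m: "?m \<le> n" by simp
    show ?case
    proof (rule wp_for[where A = 15 and X = 1 and M = n and I = "\<lambda>N z. z ''S'' 0 = s ''S'' 0 + N * ?z"], goal_cases)
      case (6 i s')
      have z: "s' ''z'' 0 = ?z" using 6(3) 2(1) by simp
      show ?case by (rule wp_straight) (use 6(4) z in simp_all)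
    next
      case (11 s')
      then show ?case using 2(1) by simp
    qed (use 2(1) S n m in simp_all)
  qed (use K in linarith)
qed

lemma wp_count_com:
  assumes s: "s ''n'' 0 = n" "s ''nn'' 0 = n * n" "s ''k'' 0 = k" "s ''v'' = v" "\<forall>i<n. s ''b'' i = i * n"
    and n: "0 < n" and k: "0 < k" and U: "\<forall>m<n * n. s ''U'' m = 0" and v: "\<And>i. i < n \<Longrightarrow> v i < k"
  shows "wp count_com (3000 * (n * (n * (n * (n * k))))) (\<lambda>s'. (\<forall>m<n * n. s' ''U'' m = 0) \<and>
    s' ''S'' 0 = fixed_sum v n k) s"
proof -
  let ?K = "n * (n * (n * (n * k)))"
  have K: "1 \<le> ?K" "n \<le> ?K" "n * n \<le> ?K" "n * (n * (n * k)) \<le> ?K"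
  proof -
    show "1 \<le> ?K" using n k by (simp add: Suc_le_eq)
    have "n * 1 \<le> ?K" using n k by (intro mult_le_mono2) (simp add: Suc_le_eq)
    then show "n \<le> ?K" by simp
    have "n * (n * 1) \<le> ?K" using n k by (intro mult_le_mono2) (simp add: Suc_le_eq)
    then show "n * n \<le> ?K" by simp
    show "n * (n * (n * k)) \<le> ?K" using n by simp
  qed
  show ?thesis unfolding count_com_def
  proof (rule wp_seq[where U = 10 and U' = "2900 * ?K" and R = "\<lambda>z. z = s(''S'' := (s ''S'')(0 := 0))"], goal_cases)
    case 1
    show ?case by (rule wp_straight) auto
  next
    case (2 s1)
    have s1: "s1 ''n'' 0 = n" "s1 ''nn'' 0 = n * n" "s1 ''k'' 0 = k" "s1 ''v'' = v" "s1 ''b'' = s ''b''"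
      "s1 ''U'' = s ''U''" "s1 ''S'' 0 = 0" using 2(1) s by simp_all
    show ?case
    proof (rule wp_seq[OF wp_duval_com[of s1, OF s1(1) n], where U' = "2800 * ?K"], goal_cases)
      case (1 s2)
      define p where "p = s2 ''p'' 0"
      have d: "duval v n p" using 1(1) s1 by (simp add: p_def)
      then have p: "p \<le> n" by (simp add: duval_def)
      have c2: "ctx n k p v s2" using 1(2) s1 s(5) by (simp add: ctx_def p_def)
      have s2: "s2 ''S'' 0 = 0" "\<forall>m<n * n. s2 ''U'' m = 0" using 1(2) s1 U by simp_all
      show ?case
      proof (rule wp_seq[OF wp_rotation_com[OF c2 n k p s2(2)], where U' = "2300 * ?K"], goal_cases)
        case (1 s3)
        have c3: "ctx n k p v s3" by (rule ctx_same[OF 1(2) c2]) simp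
        have s3: "s3 ''S'' 0 = 0" using 1(2) s2 by simp
        show ?case
        proof (rule wp_seq[OF wp_gcd_com[of s3, OF ctxD(1)[OF c3] n], where U' = "2000 * ?K"], goal_cases)
          case (1 s4)
          have c4: "ctx n k p v s4" by (rule ctx_same[OF 1(2) c3]) simp
          have U4: "\<forall>m<n * n. s4 ''U'' m = 0"
            using 1(2) \<open>(\<forall>m<n * n. s3 ''U'' m = 0) \<and> _\<close> by simp
          have "(\<Sum>r<n. s3 ''T'' (gcd (Suc r) n)) = (\<Sum>r<n. \<Sum>q<p. hub v p k q (gcd (Suc r) n) 0 q)"
          proof (intro sum.cong refl)
            fix r
            have "gcd (Suc r) n \<in> {1..n}" using n by (auto simp: Suc_le_eq gcd_le2_nat)
            then show "s3 ''T'' (gcd (Suc r) n) = (\<Sum>q<p. hub v p k q (gcd (Suc r) n) 0 q)"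
              using \<open>(\<forall>m<n * n. s3 ''U'' m = 0) \<and> _\<close> by blast
          qed
          then have S4: "s4 ''S'' 0 = (\<Sum>r<n. \<Sum>q<p. hub v p k q (gcd (Suc r) n) 0 q)"
            using 1(1) s3 by simp
          show ?case
          proof (rule wp_conseq[OF wp_reflection_com[OF c4 n k p U4]], goal_cases)
            case (2 z)
            have "fixed_sum v n k = s4 ''S'' 0 +
              (if odd n then n * end_letter v p k ((step v p k ^^ (n div 2)) start_gap)
               else n div 2 * (end_gap p ((step v p k ^^ (n div 2)) start_gap) +
                end_letter v p k ((step v p k ^^ (n div 2 - 1)) (start_letter v p k))))"
              unfolding S4 by (rule fixed_sum_eq[OF d v])
            then show ?case using 2(1) by simp
          qed (use K in linarith)
        qed (use K in linarith)
      qed (use K in linarith)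
    qed (use K in linarith)
  qed (use K in linarith)
qed

subsection \<open>The main program\<close>

definition setup_com :: com where
  "setup_com = For ''i'' ''n'' (Seq (Assign ''b'' (Plus (V ''i'') (Const 1)) (Plus (Read ''b'' (V ''i'')) (V ''n'')))
     (Seq (set_var ''nn'' (Plus (V ''nn'') (V ''n''))) (set_var ''E'' (Plus (V ''E'') (V ''k'')))))"

definition double_com :: com where
  "double_com = Seq (Assign ''D'' (Const 0) (Plus (V ''n'') (V ''n'')))
     (For ''t'' ''E'' (Assign ''D'' (Plus (V ''t'') (Const 1)) (Plus (Read ''D'' (V ''t'')) (Read ''D'' (V ''t'')))))"

text \<open>Binary long division: \<open>D\<close> holds the divisor times the powers of \<open>2\<close>, and \<open>E\<close> (equal to \<open>n k\<close>) bounds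
  the number of binary digits of the quotient.\<close>

definition quotient_com :: com where
  "quotient_com = For ''t'' ''E'' (Seq (set_var ''e'' (Minus (V ''E'') (Plus (V ''t'') (Const 1))))
     (Seq (set_var ''result'' (Plus (V ''result'') (V ''result'')))
       (Cond (Minus (Read ''D'' (V ''e'')) (V ''g'')) Skip
         (Seq (set_var ''g'' (Minus (V ''g'') (Read ''D'' (V ''e''))))
           (set_var ''result'' (Plus (V ''result'') (Const 1)))))))"

definition rank_com :: com where
  "rank_com = Seq setup_com (Seq count_com (Seq (set_var ''g'' (V ''S''))
     (Seq (For ''i'' ''n'' (Assign ''v'' (V ''i'') (Const 0))) (Seq count_com
       (Seq (set_var ''g'' (Minus (V ''S'') (V ''g''))) (Seq double_com quotient_com))))))"

lemma mods_main_parts[simp]: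
  "mods setup_com = {''i'', ''b'', ''nn'', ''E''}"
  "mods double_com = {''D'', ''t''}"
  "mods quotient_com = {''t'', ''e'', ''result'', ''g''}"
  by (auto simp: setup_com_def double_com_def quotient_com_def)

lemma wp_setup_com:
  assumes n: "s ''n'' 0 = n" "0 < n" and s: "s ''k'' 0 = k" "s ''b'' 0 = 0" "s ''nn'' 0 = 0" "s ''E'' 0 = 0"
  shows "wp setup_com (100 * n) (\<lambda>s'. (\<forall>i<n. s' ''b'' i = i * n) \<and> s' ''nn'' 0 = n * n \<and> s' ''E'' 0 = n * k) s"
  unfolding setup_com_def
proof (rule wp_for[where A = 60 and X = 1 and M = n and
    I = "\<lambda>N s'. (\<forall>i\<le>N. s' ''b'' i = i * n) \<and> s' ''nn'' 0 = N * n \<and> s' ''E'' 0 = N * k"], goal_cases)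
  case (6 i s')
  have "s' ''n'' 0 = n" "s' ''k'' 0 = k" using 6(3) n s by simp_all
  moreover have "s' ''b'' i = i * n" "\<forall>j\<le>i. s' ''b'' j = j * n" using 6(4) by simp_all
  ultimately show ?case
    by (intro wp_straight) (use 6(4) in \<open>simp_all add: 6(2) le_Suc_eq\<close>)
next
  case (11 s')
  then show ?case by (simp add: n)
qed (use n s in simp_all)

lemma wp_double_com:
  assumes n: "s ''n'' 0 = n" "0 < n" and E: "s ''E'' 0 = E" "0 < E"
  shows "wp double_com (100 * E) (\<lambda>s'. \<forall>e\<le>E. s' ''D'' e = 2 * n * 2 ^ e) s"
  unfolding double_com_def
proof (rule wp_seq[where U = 20 and U' = "80 * E" and R = "\<lambda>s'. s' ''D'' 0 = 2 * n"], goal_cases)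
  case 1
  show ?case by (rule wp_straight) (simp_all add: n)
next
  case (2 s1)
  have E1: "s1 ''E'' 0 = E" using 2(2) E by simp
  show ?case
  proof (rule wp_for[where A = 30 and X = 1 and M = E and I = "\<lambda>N s'. \<forall>e\<le>N. s' ''D'' e = 2 * n * 2 ^ e"], goal_cases)
    case (6 i s')
    then have "s' ''D'' i = 2 * n * 2 ^ i" "\<forall>e\<le>i. s' ''D'' e = 2 * n * 2 ^ e" by simp_all
    then show ?case by (intro wp_straight) (simp_all add: 6(2) le_Suc_eq)
  next
    case (11 s')
    then show ?case by (simp add: E1)
  qed (use 2(1) E E1 in simp_all)
qed (use E in simp)

lemma wp_quotient_com:
  assumes D: "\<forall>e\<le>E. s ''D'' e = N * 2 ^ e" and E: "s ''E'' 0 = E" "0 < E" and N: "0 < N"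
    and g: "s ''g'' 0 = N * Q" "Q < 2 ^ E" and r: "s ''result'' 0 = 0"
  shows "wp quotient_com (100 * E) (\<lambda>s'. s' ''result'' 0 = Q) s"
  unfolding quotient_com_def
\<comment> \<open>After \<open>t\<close> digits, \<open>g\<close> is the remainder and
  \<open>result\<close> the quotient of \<open>N * Q\<close> by \<open>N * 2 ^ (E - t)\<close>. At
  the end the divisor is \<open>N\<close>, and the remainder of the multiple \<open>N * Q\<close> is
  \<open>0\<close>.\<close>
proof (rule wp_for[where A = 60 and X = 1 and M = E and
    I = "\<lambda>t s'. s' ''g'' 0 + N * 2 ^ (E - t) * s' ''result'' 0 = N * Q \<and> s' ''g'' 0 < N * 2 ^ (E - t)"], goal_cases)
  case 5
  show ?case using g N r by simp
next
  case (6 t s')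
  have t: "t < E" using 6(1) E by simp
  define e where "e = E - Suc t"
  have e: "E - t = Suc e" "e \<le> E" using t by (auto simp: e_def)
  have s': "s' ''E'' 0 = E" "s' ''D'' e = N * 2 ^ e" using 6(3) E D e by simp_all
  have g': "s' ''g'' 0 + N * 2 ^ e * (s' ''result'' 0 + s' ''result'' 0) = N * Q"
    "s' ''g'' 0 < N * 2 ^ e + N * 2 ^ e"
    using 6(4) unfolding e(1) by (simp_all add: algebra_simps)
  show ?case
    by (rule wp_straight) (use g' in \<open>auto simp: 6(2) s' e_def[symmetric] algebra_simps\<close>)
next
  case (11 s')
  then have *: "s' ''g'' 0 + N * s' ''result'' 0 = N * Q" "s' ''g'' 0 < N" using E by simp_all
  then have "(s' ''g'' 0 + N * s' ''result'' 0) div N = Q" using N by simp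
  then show ?case using *(2) N by simp
qed (use E in simp_all)

lemma wp_rank_com:
  fixes \<Sigma> :: "'a::linorder set"
  assumes fin: "finite \<Sigma>" and n: "0 < n" and w: "w \<in> words \<Sigma> n"
  shows "wp rank_com (10000 * (card \<Sigma> * n ^ 4)) (\<lambda>s. result s = RB \<Sigma> w) (input_state \<Sigma> w)"
proof -
  let ?k = "card \<Sigma>" and ?s = "input_state \<Sigma> w"
  let ?K = "n * (n * (n * (n * ?k)))" and ?v = "?s ''v''"
  have len: "length w = n" using w by (simp add: words_def)
  have k: "0 < ?k" using w n fin by (auto simp: words_def card_gt_0_iff)
  have v: "\<And>i. i < n \<Longrightarrow> ?v i = letter_index \<Sigma> (w ! i)" using len by (simp add: input_state_def)
  note RB = RB_fixed_sum[OF fin n w v]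
  have s: "?s ''n'' 0 = n" "?s ''k'' 0 = ?k" "?s ''b'' 0 = 0" "?s ''nn'' 0 = 0" "?s ''E'' 0 = 0"
    "?s ''U'' = (\<lambda>_. 0)" "?s ''result'' 0 = 0"
    using len by (simp_all add: input_state_def)
  have K: "1 \<le> ?K" "n \<le> ?K" "n * ?k \<le> ?K"
  proof -
    show "1 \<le> ?K" using n k by (simp add: Suc_le_eq)
    have "n * 1 \<le> ?K" using n k by (intro mult_le_mono2) (simp add: Suc_le_eq)
    then show "n \<le> ?K" by simp
    show "n * ?k \<le> ?K" using n by simp
  qed
  \<comment> \<open>With \<open>RB \<Sigma> w \<le> ?k ^ n\<close> this shows that
    \<open>n * ?k\<close> binary digits suffice, a number available from repeated addition and small
    enough for the time bound.\<close>
  have "?k < 2 ^ ?k" by (rule less_exp)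
  then have "?k ^ n < (2 ^ ?k) ^ n" using n by (intro power_strict_mono) simp_all
  then have Q: "RB \<Sigma> w < 2 ^ (n * ?k)" using RB(3) by (simp add: power_mult[symmetric] mult.commute)
  have "wp rank_com (10000 * ?K) (\<lambda>s. s ''result'' 0 = RB \<Sigma> w) ?s"
    unfolding rank_com_def
  proof (rule wp_seq[OF wp_setup_com[of ?s, OF s(1) n s(2-5)], where U' = "9900 * ?K"], goal_cases)
    case (1 s1)
    have s1: "s1 ''n'' 0 = n" "s1 ''nn'' 0 = n * n" "s1 ''k'' 0 = ?k" "s1 ''v'' = ?v" "\<forall>i<n. s1 ''b'' i = i * n"
      "\<forall>m<n * n. s1 ''U'' m = 0" "s1 ''E'' 0 = n * ?k" "s1 ''result'' 0 = 0"
      using 1 s by simp_all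
    show ?case
    proof (rule wp_seq[OF wp_count_com[of s1, OF s1(1-5) n k s1(6)], where U' = "6900 * ?K"], goal_cases)
      case (1 i)
      then show ?case using RB(2)[of i] by simp
    next
      case (2 s2)
      have s2: "s2 ''n'' 0 = n" "s2 ''nn'' 0 = n * n" "s2 ''k'' 0 = ?k" "\<forall>i<n. s2 ''b'' i = i * n"
        "s2 ''E'' 0 = n * ?k" "s2 ''result'' 0 = 0" "s2 ''v'' = ?v"
        using 2(2) s1 by simp_all
      show ?case
      proof (rule wp_seq[where U = 10 and U' = "6800 * ?K" and
          R = "\<lambda>z. z = s2(''g'' := (s2 ''g'')(0 := fixed_sum ?v n ?k))"], goal_cases)
        case 1
        show ?case by (rule wp_straight) (use 2(1) in auto)
      next
        case (2 s3)
        have s3: "s3 ''n'' 0 = n" "s3 ''nn'' 0 = n * n" "s3 ''k'' 0 = ?k" "\<forall>i<n. s3 ''b'' i = i * n"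
          "s3 ''E'' 0 = n * ?k" "s3 ''result'' 0 = 0" "s3 ''g'' 0 = fixed_sum ?v n ?k" "s3 ''U'' = s2 ''U''"
          using 2(1) s2 by simp_all
        have U3: "\<forall>m<n * n. s3 ''U'' m = 0"
          unfolding s3(8) using \<open>(\<forall>m<n * n. s2 ''U'' m = 0) \<and> _\<close> by blast
        have v3: "s3 ''v'' i = 0" if "n \<le> i" for i using 2(1) s2(7) that len by (simp add: input_state_def)
        show ?case
        proof (rule wp_seq[where U = "40 * n" and U' = "6700 * ?K" and R = "\<lambda>z. z ''v'' = (\<lambda>_. 0)"], goal_cases)
          case 1
          show ?case
          proof (rule wp_for[where A = 10 and X = 1 and M = n and
              I = "\<lambda>N z. \<forall>m. m < N \<or> n \<le> m \<longrightarrow> z ''v'' m = 0"], goal_cases)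
            case (6 i s')
            show ?case by (rule wp_straight) (use 6(4) in \<open>auto simp: 6(2) less_Suc_eq\<close>)
          next
            case (11 s')
            then have "s' ''v'' m = 0" for m using not_less[of m n] s3(1) by metis
            then show ?case by (simp add: fun_eq_iff)
          qed (use n s3 v3 in simp_all)
        next
          case (2 s4)
          have s4: "s4 ''n'' 0 = n" "s4 ''nn'' 0 = n * n" "s4 ''k'' 0 = ?k" "s4 ''v'' = (\<lambda>_. 0)"
            "\<forall>i<n. s4 ''b'' i = i * n" "\<forall>m<n * n. s4 ''U'' m = 0"
            "s4 ''E'' 0 = n * ?k" "s4 ''result'' 0 = 0" "s4 ''g'' 0 = fixed_sum ?v n ?k"
            using 2 s3 U3 by simp_all
          show ?case
          proof (rule wp_seq[OF wp_count_com[of s4, OF s4(1-5) n k s4(6)], where U' = "3000 * ?K"], goal_cases)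
            case 1
            show ?case by (rule k)
          next
            case (2 s5)
            have s5: "s5 ''n'' 0 = n" "s5 ''E'' 0 = n * ?k" "s5 ''result'' 0 = 0" "s5 ''g'' 0 = fixed_sum ?v n ?k"
              using 2(2) s4 by simp_all
            show ?case
            \<comment> \<open>\<open>g\<close> still holds the sum for \<open>w\<close>, as
              \<open>count_com\<close> leaves it alone, and \<open>S\<close> now holds the sum for
              the word of zeros; by \<open>RB_fixed_sum\<close> the difference is exactly
              \<open>2 * n\<close> times the rank.\<close>
            proof (rule wp_seq[where U = 20 and U' = "2000 * ?K" and
                R = "\<lambda>z. z = s5(''g'' := (s5 ''g'')(0 := 2 * n * RB \<Sigma> w))"], goal_cases)
              case 1
              have "s5 ''S'' 0 - fixed_sum ?v n ?k = 2 * n * RB \<Sigma> w" using 2(1) RB(1) by simp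
              then show ?case by (intro wp_straight) (auto simp: s5(4))
            next
              case (2 s6)
              have s6: "s6 ''n'' 0 = n" "s6 ''E'' 0 = n * ?k" "s6 ''result'' 0 = 0" "s6 ''g'' 0 = 2 * n * RB \<Sigma> w"
                using 2(1) s5 by simp_all
              have E: "0 < n * ?k" using n k by simp
              show ?case
              proof (rule wp_seq[OF wp_double_com[of s6, OF s6(1) n s6(2) E], where U' = "100 * (n * ?k)"], goal_cases)
                case (1 s7)
                have s7: "s7 ''E'' 0 = n * ?k" "s7 ''result'' 0 = 0" "s7 ''g'' 0 = 2 * n * RB \<Sigma> w"
                  using 1(2) s6 by simp_all
                show ?case
                  by (rule wp_quotient_com[of _ s7, OF 1(1) s7(1) E _ s7(3) Q s7(2)]) (use n in simp)
              qed (use K in linarith)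
            qed (use K in linarith)
          qed (use K in linarith)
        qed (use K in linarith)
      qed (use K in linarith)
    qed (use K in linarith)
  qed (use K in linarith)
  moreover have "?K = ?k * n ^ 4" by (simp add: eval_nat_numeral algebra_simps)
  ultimately show ?thesis by (simp add: result_def)
qed

theorem theorem1:
  "\<exists>(P :: com) (C :: nat). \<forall>(\<Sigma> :: 'a::linorder set) (n :: nat) (v :: 'a list).
     finite \<Sigma> \<longrightarrow> v \<in> words \<Sigma> n \<longrightarrow>
     (\<exists>t s. exec P (input_state \<Sigma> v) t s \<and> result s = RB \<Sigma> v \<and>
            (0 < n \<longrightarrow> t \<le> C * (card \<Sigma> * n ^ 4)))"
\<comment> \<open>The outer test costs \<open>3\<close>, which is added to the constant
  \<open>10000\<close> of \<open>rank_com\<close>.\<close>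
proof (rule exI[of _ "Cond (V ''n'') rank_com Skip"], rule exI[of _ 10003], intro allI impI)
  fix \<Sigma> :: "'a set" and n :: nat and v :: "'a list"
  assume fin: "finite \<Sigma>" and v: "v \<in> words \<Sigma> n"
  let ?s = "input_state \<Sigma> v"
  have len: "length v = n" using v by (simp add: words_def)
  have sn: "val (V ''n'') ?s = n" using len by (simp add: input_state_def)
  show "\<exists>t s. exec (Cond (V ''n'') rank_com Skip) ?s t s \<and> result s = RB \<Sigma> v \<and>
    (0 < n \<longrightarrow> t \<le> 10003 * (card \<Sigma> * n ^ 4))"
  proof (cases "n = 0")
    \<comment> \<open>No word is below the empty word, so its rank is \<open>0\<close>, the initial
      content of \<open>result\<close>.\<close>
    case True
    then have e: "exec (Cond (V ''n'') rank_com Skip) ?s (cost (V ''n'') + 1 + 1) ?s"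
      using sn by (intro exec.CondFalse exec.Skip) simp
    have "v = []" using True len by simp
    then have "result ?s = RB \<Sigma> v" by (simp add: RB_def result_def input_state_def)
    then show ?thesis using e True by blast
  next
    case False
    then have n: "0 < n" by simp
    have "card \<Sigma> \<noteq> 0" using v n fin by (auto simp: words_def)
    then have K: "1 \<le> card \<Sigma> * n ^ 4" using n by (simp add: Suc_le_eq)
    obtain t s where t: "exec rank_com ?s t s" "t \<le> 10000 * (card \<Sigma> * n ^ 4)" "result s = RB \<Sigma> v"
      using wp_rank_com[OF fin n v] by (auto simp: wp_def)
    have "exec (Cond (V ''n'') rank_com Skip) ?s (cost (V ''n'') + 1 + t) s"
      by (rule exec.CondTrue[OF _ t(1)]) (use sn n in simp)
    moreover have "cost (V ''n'') + 1 + t = t + 3" by simp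
    then have "cost (V ''n'') + 1 + t \<le> 10003 * (card \<Sigma> * n ^ 4)" using t(2) K by linarith
    ultimately show ?thesis using t(3) by blast
  qed
qed

end
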